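(* Consider the three-layer delayed hierarchical system described in the context, with interlayer delays $\tau_2,\tau_3\ge0$. Then, for every initial value $x^{(1)}_0$, all physical-layer states converge to the consensus \[ \lim_{t\to\infty}x^{(1)}(t)=\frac{\mathbf{1}\mathbf{1}^TK}{\mathbf{1}^TK\mathbf{1}}\,x^{(1)}_0,\qquad K=\mathrm{diag}(a_1,\dots,a_{N^{(1)}}), \] if and only if both \[ \tau_2<\frac{\pi}{4\lambda^{(2)}_{\max}}\quad\text{and}\quad \tau_2+\tau_3<\frac{\pi}{4\lambda^{(3)}_{\max}}, \] where $\lambda^{(2)}_{\max}$ and $\lambda^{(3)}_{\max}$ are the maximum eigenvalues of $L^{(2)}$ and $L^{(3)}$, respectively.
   Context: Three-layer hierarchical structure ($M=3$). Fix positive integers $N^{(1)},N^{(2)},N^{(3)}$ and set $N^{(4)}:=1$. For each $l\in\{1,2,3\}$ the $N^{(l)}$ nodes of layer $l$ are partitioned into $N^{(l+1)}$ groups $G^{(l)}_1,\dots,G^{(l)}_{N^{(l+1)}}$ of sizes $k^{(l)}_p\ge1$, numbered consecutively: group $G^{(l)}_p$ consists of nodes $\sum_{m<p}k^{(l)}_m+1,\dots,\sum_{m\le p}k^{(l)}_m$ of layer $l$; group $G^{(l)}_p$ ($l\le2$) is subordinate to node $p$ of layer $l+1$. Each group carries a connected undirected graph with binary adjacency matrix; $L^{(l)}_p$ is its Laplacian, $L^{(l)}_D=\mathrm{diag}(L^{(l)}_1,\dots,L^{(l)}_{N^{(l+1)}})$. Weights: positive constants $a_1,\dots,a_{N^{(1)}}$;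 $a^{(1)}_i=a_i$, $a^{(l+1)}_p=\sum_{i\in G^{(l)}_p}a^{(l)}_i$; $K^{(l)}=\mathrm{diag}(a^{(l)}_1,\dots,a^{(l)}_{N^{(l)}})^{-1}$. For $l=1,2$: $B^{(l)}=\mathrm{diag}(\mathbf{1}_{k^{(l)}_1},\dots,\mathbf{1}_{k^{(l)}_{N^{(l+1)}}})\in\mathbb{R}^{N^{(l)}\times N^{(l+1)}}$ ($\mathbf 1_k$ all-ones column vector), $C^{(l)}=\mathrm{diag}(C^{(l)}_1,\dots,C^{(l)}_{N^{(l+1)}})\in\mathbb{R}^{N^{(l+1)}\times N^{(l)}}$ with each row vector $C^{(l)}_p$ having nonnegative entries summing to $1$. $L^{(1)}=K^{(1)}L^{(1)}_D$, $L^{(2)}=B^{(1)}K^{(2)}L^{(2)}_DC^{(1)}$, $L^{(3)}=B^{(1)}B^{(2)}K^{(3)}L^{(3)}_DC^{(2)}C^{(1)}$ (these have real nonnegative eigenvalues). Delayed system ($\tau_2$ is the communication delay between layers 1 and 2, $\tau_3$ between layers 2 and 3): $\dot x^{(1)}(t)=-K^{(1)}L^{(1)}_Dx^{(1)}(t)+y^{(1)}(t)$, $x^{(2)}(t)=C^{(1)}x^{(1)}(t-\tau_2)$, $y^{(1)}(t)=B^{(1)}\big[-K^{(2)}L^{(2)}_Dx^{(2)}(t-\tau_2)+y^{(2)}(t-\tau_2)\big]$, $x^{(3)}(t)=C^{(2)}x^{(2)}(t-\tau_3)$, $y^{(2)}(t)=B^{(2)}\big[-K^{(3)}L^{(3)}_Dx^{(3)}(t-\tau_3)\big]$,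 with $x^{(1)}(0)=x^{(1)}_0$ and all signals taken to be zero at negative time arguments. *)

theory Defs
  imports "HOL-Analysis.Analysis" "Jordan_Normal_Form.Char_Poly"
begin

text \<open>Group sizes of one layer are given by k :: nat => nat (group p has size k p).
  Group p consists of the (0-based) nodes grp_off k p, ..., grp_off k (Suc p) - 1.\<close>

definition grp_off :: "(nat \<Rightarrow> nat) \<Rightarrow> nat \<Rightarrow> nat" where
  "grp_off k p = (\<Sum>m<p. k m)"

definition in_grp :: "(nat \<Rightarrow> nat) \<Rightarrow> nat \<Rightarrow> nat \<Rightarrow> bool" where
  "in_grp k p i \<longleftrightarrow> grp_off k p \<le> i \<and> i < grp_off k (Suc p)"

definition partition_sizes :: "nat \<Rightarrow> nat \<Rightarrow> (nat \<Rightarrow> nat) \<Rightarrow> bool" where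
  "partition_sizes n ng k \<longleftrightarrow> (\<forall>p<ng. 1 \<le> k p) \<and> (\<Sum>p<ng. k p) = n"

definition undirected_connected :: "nat \<Rightarrow> (nat \<Rightarrow> nat \<Rightarrow> bool) \<Rightarrow> bool" where
  "undirected_connected m A \<longleftrightarrow>
     (\<forall>i<m. \<forall>j<m. A i j \<longleftrightarrow> A j i) \<and>
     (\<forall>i<m. \<forall>j<m. (\<lambda>u v. u < m \<and> v < m \<and> A u v)\<^sup>*\<^sup>* i j)"

definition adj :: "(nat \<Rightarrow> nat \<Rightarrow> bool) \<Rightarrow> nat \<Rightarrow> nat \<Rightarrow> real" where
  "adj A i j = (if A i j then 1 else 0)"

definition laplacian_entry :: "nat \<Rightarrow> (nat \<Rightarrow> nat \<Rightarrow> bool) \<Rightarrow> nat \<Rightarrow> nat \<Rightarrow> real" where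
  "laplacian_entry m A i j =
     (if i = j then (\<Sum>l<m. adj A i l) - adj A i i else - adj A i j)"

definition laplacian :: "nat \<Rightarrow> (nat \<Rightarrow> nat \<Rightarrow> bool) \<Rightarrow> real mat" where
  "laplacian m A = mat m m (\<lambda>(i,j). laplacian_entry m A i j)"

definition block_laplacian ::
  "nat \<Rightarrow> nat \<Rightarrow> (nat \<Rightarrow> nat) \<Rightarrow> (nat \<Rightarrow> nat \<Rightarrow> nat \<Rightarrow> bool) \<Rightarrow> real mat" where
  "block_laplacian n ng k G = mat n n (\<lambda>(i,j).
     \<Sum>p<ng. if in_grp k p i \<and> in_grp k p j
             then laplacian_entry (k p) (G p) (i - grp_off k p) (j - grp_off k p) else 0)"

definition B_mat :: "nat \<Rightarrow> nat \<Rightarrow> (nat \<Rightarrow> nat) \<Rightarrow> real mat" where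
  "B_mat n ng k = mat n ng (\<lambda>(i,p). if in_grp k p i then 1 else 0)"

definition C_mat :: "nat \<Rightarrow> nat \<Rightarrow> (nat \<Rightarrow> nat) \<Rightarrow> (nat \<Rightarrow> nat \<Rightarrow> real) \<Rightarrow> real mat" where
  "C_mat n ng k c = mat ng n (\<lambda>(p,i). if in_grp k p i then c p (i - grp_off k p) else 0)"

definition stochastic_rows :: "nat \<Rightarrow> (nat \<Rightarrow> nat) \<Rightarrow> (nat \<Rightarrow> nat \<Rightarrow> real) \<Rightarrow> bool" where
  "stochastic_rows ng k c \<longleftrightarrow>
     (\<forall>p<ng. (\<forall>j<k p. 0 \<le> c p j) \<and> (\<Sum>j<k p. c p j) = 1)"

definition agg_weights :: "(nat \<Rightarrow> nat) \<Rightarrow> (nat \<Rightarrow> real) \<Rightarrow> nat \<Rightarrow> real" where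
  "agg_weights k a p = (\<Sum>j<k p. a (grp_off k p + j))"

definition K_mat :: "nat \<Rightarrow> (nat \<Rightarrow> real) \<Rightarrow> real mat" where
  "K_mat n a = mat n n (\<lambda>(i,j). if i = j then inverse (a i) else 0)"

definition lambda_max :: "real mat \<Rightarrow> real" where
  "lambda_max L = Max {e. eigenvalue L e}"

text \<open>Solutions of the delayed system.  x1, x2, x3, y1, y2 are the signals of the
  system (vectors of dimensions N1, N2, N3, N1, N2), all zero at negative times.
  The differential equation for x1 is understood in the integral (Caratheodory)
  sense on [0, infinity), since its right-hand side jumps at finitely many times.\<close>
definition delayed_solution ::
  "nat \<Rightarrow> nat \<Rightarrow> nat \<Rightarrow> real mat \<Rightarrow> real mat \<Rightarrow> real mat \<Rightarrow> real mat \<Rightarrow> real mat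
   \<Rightarrow> real mat \<Rightarrow> real mat \<Rightarrow> real mat \<Rightarrow> real mat \<Rightarrow> real mat \<Rightarrow> real \<Rightarrow> real
   \<Rightarrow> real vec \<Rightarrow> (real \<Rightarrow> real vec) \<Rightarrow> (real \<Rightarrow> real vec) \<Rightarrow> (real \<Rightarrow> real vec)
   \<Rightarrow> (real \<Rightarrow> real vec) \<Rightarrow> (real \<Rightarrow> real vec) \<Rightarrow> bool" where
  "delayed_solution N1 N2 N3 K1 LD1 K2 LD2 K3 LD3 B1 C1 B2 C2 \<tau>2 \<tau>3 x0 x1 x2 x3 y1 y2 \<longleftrightarrow>
     (\<forall>t. x1 t \<in> carrier_vec N1 \<and> x2 t \<in> carrier_vec N2 \<and> x3 t \<in> carrier_vec N3 \<and>
          y1 t \<in> carrier_vec N1 \<and> y2 t \<in> carrier_vec N2) \<and>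
     (\<forall>t<0. x1 t = 0\<^sub>v N1 \<and> x2 t = 0\<^sub>v N2 \<and> x3 t = 0\<^sub>v N3 \<and>
            y1 t = 0\<^sub>v N1 \<and> y2 t = 0\<^sub>v N2) \<and>
     x1 0 = x0 \<and>
     (\<forall>t\<ge>0. x2 t = C1 *\<^sub>v x1 (t - \<tau>2)) \<and>
     (\<forall>t\<ge>0. y1 t = B1 *\<^sub>v (- ((K2 * LD2) *\<^sub>v x2 (t - \<tau>2)) + y2 (t - \<tau>2))) \<and>
     (\<forall>t\<ge>0. x3 t = C2 *\<^sub>v x2 (t - \<tau>3)) \<and>
     (\<forall>t\<ge>0. y2 t = B2 *\<^sub>v (- ((K3 * LD3) *\<^sub>v x3 (t - \<tau>3)))) \<and>
     (\<forall>t\<ge>0. \<forall>i<N1.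
        ((\<lambda>s. (- ((K1 * LD1) *\<^sub>v x1 s) + y1 s) $ i) has_integral (x1 t $ i - x0 $ i)) {0..t})"

end

theory Submission
  imports Defs "Jordan_Normal_Form.Schur_Decomposition"
begin

text \<open>Eliminating the auxiliary signals gives
  \<open>x' = - L\<^sub>1 x(t) - L\<^sub>2 x(t - 2 \<tau>\<^sub>2) - L\<^sub>3 x(t - 2 \<tau>\<^sub>2 - 2 \<tau>\<^sub>3)\<close>. The weighted group averages make
  this system block triangular: the deviations of layer 1 from their group averages solve an ordinary
  differential equation, the deviations of these averages from the averages of layer 2 solve a delay
  equation with delay \<open>2 \<tau>\<^sub>2\<close> forced by the former, and the layer 3 averages solve one with delay
  \<open>2 \<tau>\<^sub>2 + 2 \<tau>\<^sub>3\<close> forced by both. Each weighted Laplacian is symmetrizable, so every block splits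
  into a triangular cascade of scalar equations \<open>z' = - l z(t - h) + f\<close>. If \<open>l h < \<pi>/2\<close>, a
  quadratic Lyapunov functional shows that square integrable forcing yields a square integrable
  solution tending to 0. If \<open>l h \<ge> \<pi>/2\<close>, the characteristic equation has a root in the closed right
  half plane, which gives a conserved functional that excludes convergence to 0; projecting a suitable
  solution of the whole system onto a left eigenvector yields such a scalar equation. The limit value
  is determined by the conserved weighted sum of the physical states.\<close>

subsection \<open>Square integrability on a tail\<close>

text \<open>The averages formed by \<open>C1\<close> and \<open>C2\<close> differ from the weighted
  averages that the Laplacians preserve, so the three coupling terms need not share an eigenbasis.
  The discrepancy consists of deviations in lower layers and is treated as forcing. This calls for a
  class of forcings that is closed under shifts and linear combinations and that a stable delay
  equation maps into itself. Square integrability on a tail is such a class, and a Lyapunov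
  functional that works up to the critical value pi/2 proves this without any rate of decay. The
  class is encoded by a differentiable majorant that is bounded above, so that the estimates become
  monotonicity arguments. The bound pi/4 is pi/2 halved, since every interlayer delay is passed
  twice, on the way up and on the way down. For necessity, convergence is assumed only of solutions,
  so a solution has to be constructed. Initial states that are constant on suitable groups make all
  undelayed terms vanish, and then the method of steps applies.\<close>

definition sq_integrable_tail :: "(real \<Rightarrow> real) \<Rightarrow> bool" where
  "sq_integrable_tail f \<longleftrightarrow> (\<exists>T B F F'. \<forall>t\<ge>T. (F has_real_derivative F' t) (at t) \<and>
      (f t)\<^sup>2 \<le> F' t \<and> F t \<le> B)"

lemma sq_integrable_tailI:
  assumes "\<And>t. t \<ge> T \<Longrightarrow> (F has_real_derivative F' t) (at t) \<and> (f t)\<^sup>2 \<le> F' t \<and> F t \<le> B"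
  shows "sq_integrable_tail f"
  unfolding sq_integrable_tail_def using assms
  by (intro exI[of _ T] exI[of _ B] exI[of _ F] exI[of _ F']) auto

text \<open>Scaling the majorant by \<open>c^2\<close> yields a majorant for \<open>g\<close>. Since
  only the majorant has to be differentiable, no regularity of \<open>g\<close> enters.\<close>

lemma sq_integrable_tail_mono:
  assumes "sq_integrable_tail f" "\<And>t. t \<ge> T \<Longrightarrow> \<bar>g t\<bar> \<le> c * \<bar>f t\<bar>"
  shows "sq_integrable_tail g"
proof -
  obtain S B F F' where F: "\<And>t. t \<ge> S \<Longrightarrow> (F has_real_derivative F' t) (at t) \<and>
      (f t)\<^sup>2 \<le> F' t \<and> F t \<le> B"
    using assms(1) unfolding sq_integrable_tail_def by auto
  have "((\<lambda>u. c\<^sup>2 * F u) has_real_derivative c\<^sup>2 * F' t) (at t) \<and>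
      (g t)\<^sup>2 \<le> c\<^sup>2 * F' t \<and> c\<^sup>2 * F t \<le> c\<^sup>2 * B" if t: "t \<ge> max S T" for t
  proof -
    have "\<bar>g t\<bar> \<le> \<bar>c * f t\<bar>"
      using assms(2)[of t] t mult_right_mono[OF abs_ge_self[of c] abs_ge_zero[of "f t"]]
      by (simp add: abs_mult)
    then have "(g t)\<^sup>2 \<le> c\<^sup>2 * (f t)\<^sup>2"
      by (metis power_mult_distrib abs_le_square_iff)
    moreover have "c\<^sup>2 * (f t)\<^sup>2 \<le> c\<^sup>2 * F' t" "c\<^sup>2 * F t \<le> c\<^sup>2 * B"
      using F[of t] t by (auto intro!: mult_left_mono)
    ultimately show ?thesis
      using F[of t] t by (auto intro!: derivative_eq_intros)
  qed
  then show ?thesis by (rule sq_integrable_tailI)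
qed

lemma sq_integrable_tail_cmult: "sq_integrable_tail f \<Longrightarrow> sq_integrable_tail (\<lambda>t. c * f t)"
  by (erule sq_integrable_tail_mono[where c = "\<bar>c\<bar>"]) (simp add: abs_mult)

lemma sq_integrable_tail_zero: "sq_integrable_tail (\<lambda>t. 0)"
  unfolding sq_integrable_tail_def
  by (rule exI[of _ 0], rule exI[of _ 0], rule exI[of _ "\<lambda>_. 0"], rule exI[of _ "\<lambda>_. 0"]) auto

lemma sq_integrable_tail_add:
  assumes "sq_integrable_tail f" "sq_integrable_tail g"
  shows "sq_integrable_tail (\<lambda>t. f t + g t)"
proof -
  obtain S B F F' where F: "\<And>t. t \<ge> S \<Longrightarrow> (F has_real_derivative F' t) (at t) \<and>
      (f t)\<^sup>2 \<le> F' t \<and> F t \<le> B"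
    using assms(1) unfolding sq_integrable_tail_def by auto
  obtain T C G G' where G: "\<And>t. t \<ge> T \<Longrightarrow> (G has_real_derivative G' t) (at t) \<and>
      (g t)\<^sup>2 \<le> G' t \<and> G t \<le> C"
    using assms(2) unfolding sq_integrable_tail_def by auto
  have "((\<lambda>u. 2 * (F u + G u)) has_real_derivative 2 * (F' t + G' t)) (at t) \<and>
      (f t + g t)\<^sup>2 \<le> 2 * (F' t + G' t) \<and> 2 * (F t + G t) \<le> 2 * (B + C)"
    if t: "t \<ge> max S T" for t
  proof -
    have "(f t + g t)\<^sup>2 \<le> 2 * ((f t)\<^sup>2 + (g t)\<^sup>2)"
      using zero_le_power2[of "f t - g t"] by (simp add: power2_eq_square algebra_simps)
    then show ?thesis
      using F[of t] G[of t] t by (auto intro!: derivative_eq_intros)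
  qed
  then show ?thesis by (rule sq_integrable_tailI)
qed

lemma sq_integrable_tail_sum:
  "(\<And>i. i \<in> I \<Longrightarrow> sq_integrable_tail (f i)) \<Longrightarrow> sq_integrable_tail (\<lambda>t. \<Sum>i\<in>I. f i t)"
  by (induction I rule: infinite_finite_induct)
    (auto intro: sq_integrable_tail_zero sq_integrable_tail_add)

lemma sq_integrable_tail_shift:
  assumes "sq_integrable_tail f"
  shows "sq_integrable_tail (\<lambda>t. f (t - h))"
proof -
  obtain S B F F' where F: "\<And>t. t \<ge> S \<Longrightarrow> (F has_real_derivative F' t) (at t) \<and>
      (f t)\<^sup>2 \<le> F' t \<and> F t \<le> B"
    using assms(1) unfolding sq_integrable_tail_def by auto
  have "((\<lambda>u. F (u - h)) has_real_derivative F' (t - h)) (at t) \<and>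
      (f (t - h))\<^sup>2 \<le> F' (t - h) \<and> F (t - h) \<le> B" if t: "t \<ge> S + h" for t
    using F[of "t - h"] t DERIV_shift[of F "F' (t - h)" t "-h"] by simp
  then show ?thesis by (rule sq_integrable_tailI)
qed

text \<open>Barbalat's argument: \<open>z\<^sup>2\<close> has an integrable derivative, hence a limit, and an integrable
  nonnegative function can only tend to 0.\<close>

lemma sq_integrable_tail_tendsto_0:
  assumes z: "sq_integrable_tail z" and z': "sq_integrable_tail z'"
    and deriv: "\<And>t. t \<ge> U \<Longrightarrow> (z has_real_derivative z' t) (at t)"
  shows "(z \<longlongrightarrow> 0) at_top"
proof -
  obtain S B F F' where F: "\<And>t. t \<ge> S \<Longrightarrow> (F has_real_derivative F' t) (at t) \<and>
      (z t)\<^sup>2 \<le> F' t \<and> F t \<le> B"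
    using z unfolding sq_integrable_tail_def by auto
  obtain T C G G' where G: "\<And>t. t \<ge> T \<Longrightarrow> (G has_real_derivative G' t) (at t) \<and>
      (z' t)\<^sup>2 \<le> G' t \<and> G t \<le> C"
    using z' unfolding sq_integrable_tail_def by auto
  define R where "R = max S (max T U)"
  define H where "H t = F t + G t" for t
  have R: "R \<ge> S" "R \<ge> T" "R \<ge> U" by (auto simp: R_def)
  have zz: "\<bar>2 * z t * z' t\<bar> \<le> (z t)\<^sup>2 + (z' t)\<^sup>2" for t
    using zero_le_power2[of "z t - z' t"] zero_le_power2[of "z t + z' t"]
    by (auto simp: abs_le_iff power2_eq_square algebra_simps)
  \<comment> \<open>Both \<open>H - z^2\<close> and \<open>H + z^2\<close> are nondecreasing,
    because \<open>2 z z'\<close> is dominated by \<open>z^2 + z'^2\<close> and hence by the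
    derivative of \<open>H\<close>. The variation of \<open>z^2\<close> is thus controlled by the
    growth of the bounded function \<open>H\<close>.\<close>
  have up: "(z s)\<^sup>2 - (z r)\<^sup>2 \<le> H s - H r \<and> (z r)\<^sup>2 - (z s)\<^sup>2 \<le> H s - H r \<and> F r \<le> F s \<and> H r \<le> H s"
    if "R \<le> r" "r \<le> s" for r s
  proof -
    have D: "(F has_real_derivative F' t) (at t)" "(G has_real_derivative G' t) (at t)"
       "(z has_real_derivative z' t) (at t)" "(z t)\<^sup>2 \<le> F' t" "(z' t)\<^sup>2 \<le> G' t" if "r \<le> t" for t
      using F[of t] G[of t] deriv[of t] that R \<open>R \<le> r\<close> by auto
    have "H r - (z r)\<^sup>2 \<le> H s - (z s)\<^sup>2" unfolding H_def
    proof (rule DERIV_nonneg_imp_nondecreasing[OF that(2)])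
      fix t assume "r \<le> t"
      have "((\<lambda>t. F t + G t - (z t)\<^sup>2) has_real_derivative F' t + G' t - 2 * z t * z' t) (at t)"
        using D[OF \<open>r \<le> t\<close>] by (auto intro!: derivative_eq_intros)
      then show "\<exists>y. ((\<lambda>t. F t + G t - (z t)\<^sup>2) has_real_derivative y) (at t) \<and> 0 \<le> y"
        using D(4,5)[OF \<open>r \<le> t\<close>] zz[of t] by (intro exI conjI) auto
    qed
    moreover have "H r + (z r)\<^sup>2 \<le> H s + (z s)\<^sup>2" unfolding H_def
    proof (rule DERIV_nonneg_imp_nondecreasing[OF that(2)])
      fix t assume "r \<le> t"
      have "((\<lambda>t. F t + G t + (z t)\<^sup>2) has_real_derivative F' t + G' t + 2 * z t * z' t) (at t)"
        using D[OF \<open>r \<le> t\<close>] by (auto intro!: derivative_eq_intros)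
      then show "\<exists>y. ((\<lambda>t. F t + G t + (z t)\<^sup>2) has_real_derivative y) (at t) \<and> 0 \<le> y"
        using D(4,5)[OF \<open>r \<le> t\<close>] zz[of t] by (intro exI conjI) auto
    qed
    moreover have "F r \<le> F s"
    proof (rule DERIV_nonneg_imp_nondecreasing[OF that(2)])
      fix t assume "r \<le> t"
      then show "\<exists>y. (F has_real_derivative y) (at t) \<and> 0 \<le> y"
        using D(1,4)[OF \<open>r \<le> t\<close>] order_trans[OF zero_le_power2] by blast
    qed
    ultimately show ?thesis by simp
  qed
  have Hb: "H t \<le> B + C" if "t \<ge> R" for t
    using F[of t] G[of t] R that by (auto simp: H_def intro: add_mono)
  define L where "L = Sup (H ` {R..})"
  have bdd: "bdd_above (H ` {R..})" using Hb by (auto simp: bdd_above_def)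
  show ?thesis
  proof (rule tendstoI)
    fix e :: real assume e: "e > 0"
    \<comment> \<open>Beyond \<open>r\<close> less than \<open>d\<close> is left for
      \<open>H\<close> to grow, so a value of \<open>z^2\<close> that is at least
      \<open>e^2 = 2 d\<close> could never drop below \<open>d\<close> again.\<close>
    define d where "d = e\<^sup>2 / 2"
    have d: "d > 0" using e by (simp add: d_def)
    obtain r where r: "r \<ge> R" "L - d < H r"
    proof -
      have "L - d < L" using d by simp
      then obtain y where "y \<in> H ` {R..}" "L - d < y"
        unfolding L_def using less_cSup_iff[OF _ bdd, of "Sup (H ` {R..}) - d"] by (auto simp: L_def)
      then show ?thesis using that by auto
    qed
    have "(z s)\<^sup>2 < e\<^sup>2" if s: "s \<ge> r" for s
    proof (rule ccontr)
      assume "\<not> (z s)\<^sup>2 < e\<^sup>2"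
      have low: "(z u)\<^sup>2 \<ge> d" if "u \<ge> s" for u
      proof -
        have "H u \<le> L" unfolding L_def using bdd r s that by (intro cSup_upper) auto
        moreover have "H r \<le> H s" using up[of r s] r s by auto
        ultimately have "H u - H s \<le> d" using r by auto
        then show ?thesis using up[of s u] that r s \<open>\<not> (z s)\<^sup>2 < e\<^sup>2\<close> by (auto simp: d_def)
      qed
      \<comment> \<open>By the time \<open>u\<close>, growth of \<open>F\<close> at rate
        \<open>d\<close> has exceeded the bound \<open>B\<close> by \<open>d\<close>.\<close>
      define u where "u = s + (B - F s) / d + 1"
      have "F s \<le> B" using F[of s] R r s by auto
      then have us: "u \<ge> s" using d by (simp add: u_def)
      have "F s - d * s \<le> F u - d * u"
      proof (rule DERIV_nonneg_imp_nondecreasing[OF us])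
        fix t assume t: "s \<le> t"
        have Ft: "(F has_real_derivative F' t) (at t)" "(z t)\<^sup>2 \<le> F' t" using F[of t] R r s t by auto
        have "((\<lambda>a. F a - d * a) has_real_derivative F' t - d) (at t)"
          using Ft by (auto intro!: derivative_eq_intros)
        then show "\<exists>y. ((\<lambda>a. F a - d * a) has_real_derivative y) (at t) \<and> 0 \<le> y"
          using low[OF t] Ft by (intro exI conjI) auto
      qed
      then have "F s + d * (u - s) \<le> B" using F[of u] R r s us by (auto simp: algebra_simps)
      moreover have "d * (u - s) = B - F s + d" using d by (simp add: u_def field_simps)
      ultimately show False using d by simp
    qed
    then have "\<forall>s\<ge>r. dist (z s) 0 < e"
      using e by (auto intro!: power2_less_imp_less[of "\<bar>_\<bar>" e])
    then show "\<forall>\<^sub>F t in at_top. dist (z t) 0 < e" by (auto simp: eventually_at_top_linorder)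
  qed
qed

text \<open>The potential \<open>- a b - j + b\<^sup>2 tan (\<theta> - l (t - u))\<close>, with \<open>(a, b)\<close> the vector \<open>(d, s)\<close> in the
  frame rotated by \<open>\<theta> = l (r - u)\<close>, has derivative \<open>l (a - b tan (\<theta> - l (t - u)))\<^sup>2\<close>.\<close>

lemma swept_area_bound:
  fixes l u t :: real
  assumes l: "l \<ge> 0" and ut: "u \<le> t" "l * (t - u) < pi / 2"
    and d: "\<And>r. \<lbrakk>u \<le> r; r \<le> t\<rbrakk> \<Longrightarrow> (d has_real_derivative l * y r * cos (l * (r - u))) (at r)"
    and s: "\<And>r. \<lbrakk>u \<le> r; r \<le> t\<rbrakk> \<Longrightarrow> (s has_real_derivative l * y r * sin (l * (r - u))) (at r)"
    and j: "\<And>r. \<lbrakk>u \<le> r; r \<le> t\<rbrakk> \<Longrightarrow> (j has_real_derivative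
        l * y r * (sin (l * (r - u)) * d r - cos (l * (r - u)) * s r)) (at r)"
    and init: "s u = 0" "j u = 0"
  shows "2 * j t \<le> (d t)\<^sup>2 + (s t)\<^sup>2"
proof -
  \<comment> \<open>In the rotated frame the oscillating factors disappear:
    \<open>a' = l y + l b\<close> and \<open>b' = - l a\<close>, so the input \<open>y\<close>
    enters one component only.\<close>
  define a where "a r = d r * cos (l * (r - u)) + s r * sin (l * (r - u))" for r
  define b where "b r = s r * cos (l * (r - u)) - d r * sin (l * (r - u))" for r
  \<comment> \<open>The tangent solves the Riccati equation \<open>T' = l (1 + T^2)\<close>, which
    is what completes the square in the derivative of \<open>Q\<close>. It stays finite because
    \<open>l (t - u) < pi / 2\<close>, and it vanishes at \<open>r = t\<close>. At
    \<open>r = u\<close> all of \<open>Q\<close> vanishes, since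
    \<open>b u = s u = 0\<close>.\<close>
  define Q where "Q r = - a r * b r - j r + (b r)\<^sup>2 * tan (l * (r - t))" for r
  have "Q u \<le> Q t"
  proof (rule DERIV_nonneg_imp_nondecreasing[OF ut(1)])
    fix r assume r: "u \<le> r" "r \<le> t"
    have trig: "(sin x)\<^sup>2 + (cos x)\<^sup>2 = 1" for x :: real by simp
    have rot: "ly * C * C + dd * (- S * l) + (ly * S * S + ss * (C * l)) = ly + l * (ss * C - dd * S)"
      if "S\<^sup>2 + C\<^sup>2 = 1" for ly C S dd ss :: real
      using arg_cong[OF that, of "\<lambda>x. ly * x"] by (simp add: power2_eq_square algebra_simps)
    have a': "(a has_real_derivative l * y r + l * b r) (at r)"
    proof -
      have "(a has_real_derivative l * y r * cos (l * (r - u)) * cos (l * (r - u)) +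
          d r * (- sin (l * (r - u)) * l) + (l * y r * sin (l * (r - u)) * sin (l * (r - u)) +
          s r * (cos (l * (r - u)) * l))) (at r)"
        unfolding a_def[abs_def] by (rule derivative_eq_intros d[OF r] s[OF r] refl | simp)+
      moreover have "l * y r * cos (l * (r - u)) * cos (l * (r - u)) +
          d r * (- sin (l * (r - u)) * l) + (l * y r * sin (l * (r - u)) * sin (l * (r - u)) +
          s r * (cos (l * (r - u)) * l)) = l * y r + l * b r"
        unfolding b_def using rot[OF trig] by simp
      ultimately show ?thesis by metis
    qed
    have b': "(b has_real_derivative - l * a r) (at r)"
    proof -
      have "(b has_real_derivative l * y r * sin (l * (r - u)) * cos (l * (r - u)) +
          s r * (- sin (l * (r - u)) * l) - (l * y r * cos (l * (r - u)) * sin (l * (r - u)) +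
          d r * (cos (l * (r - u)) * l))) (at r)"
        unfolding b_def[abs_def] by (rule derivative_eq_intros d[OF r] s[OF r] refl | simp)+
      moreover have "l * y r * sin (l * (r - u)) * cos (l * (r - u)) +
          s r * (- sin (l * (r - u)) * l) - (l * y r * cos (l * (r - u)) * sin (l * (r - u)) +
          d r * (cos (l * (r - u)) * l)) = - l * a r"
        unfolding a_def by (simp add: algebra_simps)
      ultimately show ?thesis by metis
    qed
    have "l * (r - t) > - (pi / 2)"
    proof -
      have "l * (t - r) \<le> l * (t - u)" using l r by (intro mult_left_mono) auto
      then show ?thesis using ut by (simp add: algebra_simps)
    qed
    moreover have "l * (r - t) \<le> 0" using l r by (simp add: mult_nonneg_nonpos)
    ultimately have cpos: "cos (l * (r - t)) > 0"
      using pi_half_gt_zero by (intro cos_gt_zero_pi) linarith+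
    define T where "T = tan (l * (r - t))"
    have inv: "inverse ((cos (l * (r - t)))\<^sup>2) = 1 + T\<^sup>2"
      using cpos tan_sec[of "l * (r - t)"] by (simp add: T_def power_inverse)
    have tan': "((\<lambda>r. tan (l * (r - t))) has_real_derivative l * (1 + T\<^sup>2)) (at r)"
    proof -
      have "((\<lambda>r. tan (l * (r - t))) has_real_derivative inverse ((cos (l * (r - t)))\<^sup>2) * l) (at r)"
        using cpos by (auto intro!: derivative_eq_intros simp: divide_inverse power_inverse)
      then show ?thesis unfolding inv by (simp add: mult.commute)
    qed
    have "(Q has_real_derivative - (l * y r + l * b r) * b r + - l * a r * - a r -
        l * y r * (sin (l * (r - u)) * d r - cos (l * (r - u)) * s r) +
        (2 * b r * (- l * a r) * T + l * (1 + T\<^sup>2) * (b r)\<^sup>2)) (at r)"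
      unfolding Q_def[abs_def] T_def
      by (rule derivative_eq_intros a' b' tan'[unfolded T_def] j[OF r] refl | simp)+
    moreover have "- (l * y r + l * b r) * b r + - l * a r * - a r -
        l * y r * (sin (l * (r - u)) * d r - cos (l * (r - u)) * s r) +
        (2 * b r * (- l * a r) * T + l * (1 + T\<^sup>2) * (b r)\<^sup>2) = l * (a r - b r * T)\<^sup>2"
    proof -
      have b: "sin (l * (r - u)) * d r - cos (l * (r - u)) * s r = - b r" by (simp add: b_def)
      show ?thesis unfolding b by (simp add: power2_eq_square algebra_simps)
    qed
    ultimately show "\<exists>y. (Q has_real_derivative y) (at r) \<and> 0 \<le> y"
      using l by (metis mult_nonneg_nonneg zero_le_power2)
  qed
  then have "j t \<le> - a t * b t" using init by (simp add: Q_def b_def)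
  moreover have "- 2 * (a t * b t) \<le> (a t)\<^sup>2 + (b t)\<^sup>2"
    using zero_le_power2[of "a t + b t"] by (simp add: power2_eq_square algebra_simps)
  moreover have "(a t)\<^sup>2 + (b t)\<^sup>2 = (d t)\<^sup>2 + (s t)\<^sup>2"
  proof -
    have "(a t)\<^sup>2 + (b t)\<^sup>2 =
        ((d t)\<^sup>2 + (s t)\<^sup>2) * ((sin (l * (t - u)))\<^sup>2 + (cos (l * (t - u)))\<^sup>2)"
      unfolding a_def b_def power2_eq_square by (simp only: algebra_simps)
    then show ?thesis by simp
  qed
  ultimately show ?thesis by simp
qed

subsection \<open>The scalar delay equation below the critical delay\<close>

lemma antiderivative_right_of:
  fixes g :: "real \<Rightarrow> real"
  assumes "continuous_on {T..} g"
  obtains G where "\<And>t. t > T \<Longrightarrow> (G has_real_derivative g t) (at t)"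
proof
  fix t assume t: "t > T"
  have "((\<lambda>x. integral {T..x} g) has_real_derivative g t) (at t within {T..t + 1})"
    using t by (intro integral_has_real_derivative continuous_on_subset[OF assms]) auto
  moreover have "at t within {T..t + 1} = at t"
    using t by (intro at_within_interior) auto
  ultimately show "((\<lambda>x. integral {T..x} g) has_real_derivative g t) (at t)" by simp
qed

text \<open>The derivative of \<open>g\<close> is at least \<open>(m - p z)^2\<close>, because
  \<open>(p z)^2\<close> is at most \<open>z^2\<close>. The mean slope \<open>m\<close> of
  \<open>P\<close> over the window is the value for which the integrated inequality is
  sharpest.\<close>

lemma window_Cauchy_Schwarz:
  fixes P Y :: "real \<Rightarrow> real"
  assumes h: "h > 0"
    and P: "\<And>r. \<lbrakk>t - h \<le> r; r \<le> t\<rbrakk> \<Longrightarrow> (P has_real_derivative p r * z r) (at r)"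
    and Y: "\<And>r. \<lbrakk>t - h \<le> r; r \<le> t\<rbrakk> \<Longrightarrow> (Y has_real_derivative (z r)\<^sup>2) (at r)"
    and p: "\<And>r. \<bar>p r\<bar> \<le> 1"
  shows "(P t - P (t - h))\<^sup>2 \<le> h * (Y t - Y (t - h))"
proof -
  define m where "m = (P t - P (t - h)) / h"
  define g where "g r = Y r + m\<^sup>2 * r - 2 * m * P r" for r
  have "g (t - h) \<le> g t"
  proof (rule DERIV_nonneg_imp_nondecreasing[of "t - h" t g])
    fix r assume r: "t - h \<le> r" "r \<le> t"
    have "(g has_real_derivative (z r)\<^sup>2 + m\<^sup>2 - 2 * m * (p r * z r)) (at r)"
      unfolding g_def[abs_def] by (rule derivative_eq_intros Y[OF r] P[OF r] refl | simp)+
    moreover have "0 \<le> (z r)\<^sup>2 + m\<^sup>2 - 2 * m * (p r * z r)"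
    proof -
      have "(p r * z r)\<^sup>2 \<le> 1 * (z r)\<^sup>2"
        unfolding power_mult_distrib using p[of r]
        by (intro mult_right_mono) (simp_all add: abs_square_le_1)
      then show ?thesis
        using zero_le_power2[of "m - p r * z r"] by (simp add: power2_diff)
    qed
    ultimately show "\<exists>y. (g has_real_derivative y) (at r) \<and> 0 \<le> y"
      by blast
  qed (use h in simp)
  then have "2 * m * (P t - P (t - h)) \<le> m\<^sup>2 * h + (Y t - Y (t - h))" by (simp add: g_def algebra_simps)
  moreover have "P t - P (t - h) = m * h" using h by (simp add: m_def)
  ultimately have "m\<^sup>2 * h \<le> Y t - Y (t - h)" by (simp add: power2_eq_square algebra_simps)
  then have "h * (m\<^sup>2 * h) \<le> h * (Y t - Y (t - h))" using h by simp
  then show ?thesis using \<open>P t - P (t - h) = m * h\<close> by (simp add: power2_eq_square algebra_simps)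
qed

lemma real_Young:
  fixes x y e :: real
  assumes "e > 0"
  shows "2 * x * y \<le> e * x\<^sup>2 + y\<^sup>2 / e"
proof -
  have "0 \<le> (e * x - y)\<^sup>2 / e" using assms by simp
  also have "\<dots> = e * x\<^sup>2 + y\<^sup>2 / e - 2 * x * y"
    using assms by (simp add: power2_eq_square field_simps)
  finally show ?thesis by simp
qed

text \<open>Write \<open>C\<close> and \<open>S\<close> for the integrals of \<open>l cos (l (r - t + h)) z r\<close> and
  \<open>l sin (l (r - t + h)) z r\<close> over \<open>[t - h, t]\<close>, and \<open>D = C - z\<close>. The Lyapunov functional is
  \<open>V = D\<^sup>2 + S\<^sup>2 - 2 k J\<close>, where \<open>J\<close> is the area term of the swept-area bound, which gives
  \<open>V \<ge> (1 - k) (D\<^sup>2 + S\<^sup>2)\<close>. The constant \<open>k = cos (l h) / (1 + sin (l h))\<close> is the one for which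
  all mixed terms cancel, leaving \<open>V' = - 2 k l z\<^sup>2 + f (2 k S - 2 D)\<close>. The summand \<open>H\<close> of \<open>W\<close>
  absorbs the forcing term.\<close>

lemma DDE_sq_integrable_pos_delay:
  fixes l h :: real
  assumes l: "l > 0" and h: "h > 0" and lh: "l * h < pi / 2"
    and z: "\<And>t. t \<ge> T \<Longrightarrow> (z has_real_derivative - l * z (t - h) + f t) (at t)"
    and f: "sq_integrable_tail f"
  shows "sq_integrable_tail z"
proof -
  have zc: "continuous_on {T..} z"
    using z by (intro continuous_at_imp_continuous_on) (auto intro: DERIV_isCont)
  obtain P where P: "\<And>t. t > T \<Longrightarrow> (P has_real_derivative cos (l * t) * z t) (at t)"
    by (rule antiderivative_right_of[of T "\<lambda>t. cos (l * t) * z t"]) (auto intro!: continuous_intros zc)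
  obtain Q where Q: "\<And>t. t > T \<Longrightarrow> (Q has_real_derivative sin (l * t) * z t) (at t)"
    by (rule antiderivative_right_of[of T "\<lambda>t. sin (l * t) * z t"]) (auto intro!: continuous_intros zc)
  obtain Y where Y: "\<And>t. t > T \<Longrightarrow> (Y has_real_derivative (z t)\<^sup>2) (at t)"
    by (rule antiderivative_right_of[of T "\<lambda>t. (z t)\<^sup>2"]) (auto intro!: continuous_intros zc)
  \<comment> \<open>The antiderivatives are differentiable only on the open ray beyond
    \<open>T\<close>, so continuity on a closed ray is claimed from \<open>T + 1\<close> on. This is
    the origin of the \<open>1\<close> in \<open>U = T + h + 1\<close>.\<close>
  have cont: "continuous_on {T + 1..} g" if "\<And>t. t > T \<Longrightarrow> (g has_real_derivative g' t) (at t)" for g g'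
    by (intro continuous_at_imp_continuous_on ballI DERIV_isCont[OF that]) simp
  have zc1: "continuous_on {T + 1..} z" by (rule continuous_on_subset[OF zc]) auto
  obtain R where R: "\<And>t. t > T + 1 \<Longrightarrow>
      (R has_real_derivative z t * (sin (l * t) * P t - cos (l * t) * Q t)) (at t)"
    by (rule antiderivative_right_of[of "T + 1" "\<lambda>t. z t * (sin (l * t) * P t - cos (l * t) * Q t)"])
       (auto intro!: continuous_intros zc1 cont[OF P] cont[OF Q])
  obtain YY where YY: "\<And>t. t > T + 1 \<Longrightarrow> (YY has_real_derivative Y t) (at t)"
    by (rule antiderivative_right_of[OF cont[OF Y]]) auto
  have shift: "((\<lambda>t. g (t - h)) has_real_derivative g' (t - h)) (at t)"
    if "\<And>t. t > U \<Longrightarrow> (g has_real_derivative g' t) (at t)" "t > U + h" for g g' U t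
    using that(1)[of "t - h"] that(2) DERIV_shift[of g "g' (t - h)" t "-h"] by simp

  define ch where "ch = cos (l * h)"
  define sh where "sh = sin (l * h)"
  define k where "k = ch / (1 + sh)"
  have ch0: "ch > 0" unfolding ch_def using l h lh
    by (intro cos_gt_zero_pi) (auto intro: less_trans[of _ 0])
  have lh0: "l * h > 0" using l h by simp
  have sh0: "sh > 0" unfolding sh_def using lh lh0 pi_gt_zero by (intro sin_gt_zero) linarith+
  have cs1: "ch\<^sup>2 + sh\<^sup>2 = 1" by (simp add: ch_def sh_def)
  have k0: "k > 0" using ch0 sh0 by (simp add: k_def)
  have ch1: "ch \<le> 1" by (simp add: ch_def)
  have k1: "k < 1" using ch1 sh0 by (simp add: k_def)
  have kch: "ch = k * (1 + sh)" using sh0 by (simp add: k_def)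
  \<comment> \<open>Cancelling the terms in \<open>D z\<close> needs
    \<open>ch = k * (1 + sh)\<close>, and cancelling those in \<open>S z\<close> needs
    \<open>k * ch = 1 - sh\<close>. One \<open>k\<close> serves both because
    \<open>ch^2 = (1 - sh) * (1 + sh)\<close>.\<close>
  have "k * ch = ch\<^sup>2 / (1 + sh)" by (simp add: k_def power2_eq_square)
  also have "\<dots> = 1 - sh"
  proof -
    have "ch\<^sup>2 = (1 - sh) * (1 + sh)" using cs1 by (simp add: power2_eq_square algebra_simps)
    then show ?thesis using sh0 by simp
  qed
  finally have ksh: "k * ch = 1 - sh" .

  \<comment> \<open>The kernel of the window integral moves with \<open>t\<close>. The addition
    formulas separate it into trigonometric factors in \<open>t\<close> and the fixed
    antiderivatives \<open>P\<close> and \<open>Q\<close>, so that \<open>C\<close> and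
    \<open>S\<close> can be differentiated termwise.\<close>
  define C where "C t = l * (cos (l * (t - h)) * (P t - P (t - h)) + sin (l * (t - h)) * (Q t - Q (t - h)))" for t
  define S where "S t = l * (cos (l * (t - h)) * (Q t - Q (t - h)) - sin (l * (t - h)) * (P t - P (t - h)))" for t
  define D where "D t = C t - z t" for t
  \<comment> \<open>The bracket is the antisymmetric double integral over the window, expressed
    through \<open>R\<close>. The term \<open>- z t * S t\<close> appears because the curve
    considered in \<open>J_le\<close> starts at first coordinate \<open>- z t\<close> instead of
    0.\<close>
  define J where "J t = - z t * S t + l\<^sup>2 * (R t - R (t - h) - P (t - h) * Q t + Q (t - h) * P t)" for t
  define w where "w t = Y t - Y (t - h)" for t
  \<comment> \<open>\<open>V\<close> alone dissipates only \<open>z^2\<close>, whereas the forcing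
    is multiplied by \<open>D\<close> and \<open>S\<close>, which involve the whole window. Since
    \<open>H' = h z^2 - w\<close>, adding \<open>k * l / h * H\<close> trades half of the
    dissipation for a multiple of the window integral \<open>w\<close>.\<close>
  define H where "H t = h * Y t - (YY t - YY (t - h))" for t
  define V where "V t = (D t)\<^sup>2 + (S t)\<^sup>2 - 2 * k * J t" for t
  define W where "W t = V t + k * l / h * H t" for t
  define U where "U = T + h + 1"

  have trig1: "cos (l * t) * cos (l * (t - h)) + sin (l * t) * sin (l * (t - h)) = ch" for t
    unfolding ch_def cos_diff[symmetric] by (simp add: algebra_simps)
  have trig2: "sin (l * t) * cos (l * (t - h)) - cos (l * t) * sin (l * (t - h)) = sh" for t
    unfolding sh_def sin_diff[symmetric] by (simp add: algebra_simps)
  have trig0: "cos (l * (t - h)) * cos (l * (t - h)) + sin (l * (t - h)) * sin (l * (t - h)) = 1" for t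
    using sin_cos_squared_add2[of "l * (t - h)"] by (simp add: power2_eq_square)

  have C': "(C has_real_derivative l * (ch * z t - z (t - h)) + l * S t) (at t)" if t: "t > U" for t
  proof -
    define c s ct st where "c = cos (l * (t - h))" and "s = sin (l * (t - h))"
      and "ct = cos (l * t)" and "st = sin (l * t)"
    have "(C has_real_derivative l * ((- s * l * (P t - P (t - h)) + (ct * z t - c * z (t - h)) * c)
        + (c * l * (Q t - Q (t - h)) + (st * z t - s * z (t - h)) * s))) (at t)"
      unfolding C_def[abs_def] c_def s_def ct_def st_def
      by (rule derivative_eq_intros shift[OF P] shift[OF Q] P Q refl | (use t h in \<open>simp add: U_def\<close>))+
    moreover have "l * ((- s * l * (P t - P (t - h)) + (ct * z t - c * z (t - h)) * c)
        + (c * l * (Q t - Q (t - h)) + (st * z t - s * z (t - h)) * s)) =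
        l * ((ct * c + st * s) * z t - (c * c + s * s) * z (t - h)) + l * S t"
      unfolding S_def c_def[symmetric] s_def[symmetric] by (simp add: algebra_simps)
    moreover have "ct * c + st * s = ch" "c * c + s * s = 1"
      using trig1[of t] trig0[of t] by (simp_all add: c_def s_def ct_def st_def)
    ultimately show ?thesis by simp
  qed
  have S': "(S has_real_derivative l * sh * z t - l * C t) (at t)" if t: "t > U" for t
  proof -
    define c s ct st where "c = cos (l * (t - h))" and "s = sin (l * (t - h))"
      and "ct = cos (l * t)" and "st = sin (l * t)"
    have "(S has_real_derivative l * ((- s * l * (Q t - Q (t - h)) + (st * z t - s * z (t - h)) * c)
        - (c * l * (P t - P (t - h)) + (ct * z t - c * z (t - h)) * s))) (at t)"
      unfolding S_def[abs_def] c_def s_def ct_def st_def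
      by (rule derivative_eq_intros shift[OF P] shift[OF Q] P Q refl | (use t h in \<open>simp add: U_def\<close>))+
    moreover have "l * ((- s * l * (Q t - Q (t - h)) + (st * z t - s * z (t - h)) * c)
        - (c * l * (P t - P (t - h)) + (ct * z t - c * z (t - h)) * s)) =
        l * (st * c - ct * s) * z t - l * C t"
      unfolding C_def c_def[symmetric] s_def[symmetric] by (simp add: algebra_simps)
    moreover have "st * c - ct * s = sh"
      using trig2[of t] by (simp_all add: c_def s_def ct_def st_def)
    ultimately show ?thesis by simp
  qed
  have z': "(z has_real_derivative - l * z (t - h) + f t) (at t)" if t: "t > U" for t
    using z[of t] t h by (simp add: U_def)
  have D': "(D has_real_derivative l * ch * z t + l * S t - f t) (at t)" if t: "t > U" for t
    unfolding D_def[abs_def]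
    by (rule derivative_eq_intros C'[OF t] z'[OF t] refl | simp add: algebra_simps)+

  have J': "(J has_real_derivative l * (z t)\<^sup>2 - S t * f t + l * (1 + sh) * z t * D t - l * ch * S t * z t) (at t)"
    if t: "t > U" for t
  proof -
    define c s ct st where "c = cos (l * (t - h))" and "s = sin (l * (t - h))"
      and "ct = cos (l * t)" and "st = sin (l * t)"
    define p ph q qh where "p = P t" and "ph = P (t - h)" and "q = Q t" and "qh = Q (t - h)"
    have "(J has_real_derivative (- z t * (l * sh * z t - l * C t) + - (- l * z (t - h) + f t) * S t) +
       l\<^sup>2 * (z t * (st * p - ct * q) - z (t - h) * (s * ph - c * qh)
         - (c * z (t - h) * q + st * z t * ph) + (s * z (t - h) * p + ct * z t * qh))) (at t)"
      unfolding J_def[abs_def] c_def s_def ct_def st_def p_def ph_def q_def qh_def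
      by (rule derivative_eq_intros shift[OF P] shift[OF Q] shift[OF R] P Q R z'[OF t] S'[OF t] refl
         | (use t h in \<open>simp add: U_def\<close>))+
    moreover have "l\<^sup>2 * (z t * (st * p - ct * q) - z (t - h) * (s * ph - c * qh)
         - (c * z (t - h) * q + st * z t * ph) + (s * z (t - h) * p + ct * z t * qh)) =
       l * z t * (sh * C t - ch * S t) - l * z (t - h) * S t"
    proof -
      have C: "C t = l * (c * (p - ph) + s * (q - qh))" and S: "S t = l * (c * (q - qh) - s * (p - ph))"
        by (simp_all add: C_def S_def c_def s_def p_def ph_def q_def qh_def)
      have st: "st = s * ch + c * sh" and ct: "ct = c * ch - s * sh"
      proof -
        have "sin (l * (t - h) + l * h) = s * ch + c * sh" "cos (l * (t - h) + l * h) = c * ch - s * sh"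
          unfolding sin_add cos_add c_def s_def ch_def sh_def by simp_all
        then show "st = s * ch + c * sh" "ct = c * ch - s * sh"
          by (simp_all add: st_def ct_def algebra_simps)
      qed
      show ?thesis unfolding C S st ct by (simp add: power2_eq_square algebra_simps)
    qed
    moreover have "(- z t * (l * sh * z t - l * C t) + - (- l * z (t - h) + f t) * S t) +
        (l * z t * (sh * C t - ch * S t) - l * z (t - h) * S t) =
        l * (z t)\<^sup>2 - S t * f t + l * (1 + sh) * z t * D t - l * ch * S t * z t"
      unfolding D_def by (simp add: power2_eq_square algebra_simps)
    ultimately show ?thesis by metis
  qed

  have V': "(V has_real_derivative - 2 * k * l * (z t)\<^sup>2 + f t * (- 2 * D t + 2 * k * S t)) (at t)"
    if t: "t > U" for t
  proof -
    have "(V has_real_derivative 2 * D t * (l * ch * z t + l * S t - f t) +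
        2 * S t * (l * sh * z t - l * C t) - 2 * k *
        (l * (z t)\<^sup>2 - S t * f t + l * (1 + sh) * z t * D t - l * ch * S t * z t)) (at t)"
      unfolding V_def[abs_def]
      by (rule derivative_eq_intros D'[OF t] S'[OF t] J'[OF t] refl | simp)+
    moreover have "2 * D t * (l * ch * z t + l * S t - f t) +
        2 * S t * (l * sh * z t - l * C t) - 2 * k *
        (l * (z t)\<^sup>2 - S t * f t + l * (1 + sh) * z t * D t - l * ch * S t * z t) =
        - 2 * k * l * (z t)\<^sup>2 + f t * (- 2 * D t + 2 * k * S t)
        + 2 * l * z t * D t * (ch - k * (1 + sh)) + 2 * l * z t * S t * (k * ch - (1 - sh))"
      unfolding D_def by (simp add: algebra_simps)
    ultimately show ?thesis using kch ksh by simp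
  qed
  have H': "(H has_real_derivative h * (z t)\<^sup>2 - w t) (at t)" if t: "t > U" for t
    unfolding H_def[abs_def] w_def
    by (rule derivative_eq_intros shift[OF YY] Y YY refl | (use t h in \<open>simp add: U_def\<close>))+
  have W': "(W has_real_derivative - k * l * (z t)\<^sup>2 - k * l / h * w t
      + f t * (- 2 * D t + 2 * k * S t)) (at t)" if t: "t > U" for t
    unfolding W_def[abs_def]
    by (rule derivative_eq_intros V'[OF t] H'[OF t] refl | (use h in \<open>simp add: field_simps\<close>))+

  have DS: "(D t)\<^sup>2 + (S t)\<^sup>2 \<le> 2 * (z t)\<^sup>2 + 4 * l\<^sup>2 * h * w t" if t: "t > U" for t
  proof -
    have 1: "(P t - P (t - h))\<^sup>2 \<le> h * w t" unfolding w_def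
      by (rule window_Cauchy_Schwarz[where p = "\<lambda>r. cos (l * r)" and z = z]) (use t h P Y in \<open>auto simp: U_def\<close>)
    have 2: "(Q t - Q (t - h))\<^sup>2 \<le> h * w t" unfolding w_def
      by (rule window_Cauchy_Schwarz[where p = "\<lambda>r. sin (l * r)" and z = z]) (use t h Q Y in \<open>auto simp: U_def\<close>)
    have "(C t)\<^sup>2 + (S t)\<^sup>2 = l\<^sup>2 * ((P t - P (t - h))\<^sup>2 + (Q t - Q (t - h))\<^sup>2) *
        (cos (l * (t - h)) * cos (l * (t - h)) + sin (l * (t - h)) * sin (l * (t - h)))"
      unfolding C_def S_def power2_eq_square by (simp only: algebra_simps)
    then have "(C t)\<^sup>2 + (S t)\<^sup>2 = l\<^sup>2 * ((P t - P (t - h))\<^sup>2 + (Q t - Q (t - h))\<^sup>2)"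
      using trig0 by simp
    also have "\<dots> \<le> l\<^sup>2 * (h * w t + h * w t)" using 1 2 by (intro mult_left_mono add_mono) auto
    finally have CS: "(C t)\<^sup>2 + (S t)\<^sup>2 \<le> 2 * l\<^sup>2 * h * w t" by simp
    have "(D t)\<^sup>2 \<le> 2 * (C t)\<^sup>2 + 2 * (z t)\<^sup>2"
      using zero_le_power2[of "C t + z t"] by (simp add: D_def power2_eq_square algebra_simps)
    moreover have "(S t)\<^sup>2 \<le> 2 * (S t)\<^sup>2" by simp
    ultimately show ?thesis using CS by linarith
  qed

  \<comment> \<open>With \<open>t\<close> frozen, the curve \<open>(dd, ss)\<close> runs over the
    window from \<open>(- z t, 0)\<close> to \<open>(D t, S t)\<close> and \<open>jj\<close> ends at
    \<open>J t\<close>. The swept angle is \<open>l h < pi / 2\<close>, as the area bound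
    requires.\<close>
  have J_le: "2 * J t \<le> (D t)\<^sup>2 + (S t)\<^sup>2" if t: "t > U" for t
  proof -
    define u where "u = t - h"
    define c s where "c = cos (l * u)" and "s = sin (l * u)"
    have cs: "cos (l * (r - u)) = cos (l * r) * c + sin (l * r) * s"
       "sin (l * (r - u)) = sin (l * r) * c - cos (l * r) * s" for r
      unfolding c_def s_def by (simp_all add: right_diff_distrib cos_diff sin_diff)
    define dd where "dd r = l * (c * (P r - P u) + s * (Q r - Q u)) - z t" for r
    define ss where "ss r = l * (c * (Q r - Q u) - s * (P r - P u))" for r
    define jj where "jj r = - z t * ss r + l\<^sup>2 * (R r - R u - P u * Q r + Q u * P r)" for r
    have "2 * jj t \<le> (dd t)\<^sup>2 + (ss t)\<^sup>2"
    proof (rule swept_area_bound[of l u t dd z ss jj])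
      fix r assume r: "u \<le> r" "r \<le> t"
      then have rT: "r > T" "r > T + 1" using t by (auto simp: u_def U_def)
      have d1: "(dd has_real_derivative l * (c * (cos (l * r) * z r) + s * (sin (l * r) * z r))) (at r)"
        unfolding dd_def[abs_def] by (rule derivative_eq_intros P Q refl rT | simp)+
      have s1: "(ss has_real_derivative l * (c * (sin (l * r) * z r) - s * (cos (l * r) * z r))) (at r)"
        unfolding ss_def[abs_def] by (rule derivative_eq_intros P Q refl rT | simp)+
      have j1: "(jj has_real_derivative - z t * (l * (c * (sin (l * r) * z r) - s * (cos (l * r) * z r))) +
         l\<^sup>2 * (z r * (sin (l * r) * P r - cos (l * r) * Q r) - P u * (sin (l * r) * z r)
         + Q u * (cos (l * r) * z r))) (at r)"
        unfolding jj_def[abs_def] by (rule derivative_eq_intros P Q R s1 refl rT | simp)+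
      show "(dd has_real_derivative l * z r * cos (l * (r - u))) (at r)"
        using d1 unfolding cs by (simp add: algebra_simps)
      show "(ss has_real_derivative l * z r * sin (l * (r - u))) (at r)"
        using s1 unfolding cs by (simp add: algebra_simps)
      have c2: "c * c = 1 - s * s" using sin_cos_squared_add[of "l * u"]
        by (simp add: c_def s_def power2_eq_square)
      have c3: "c * (c * x) = x - s * (s * x)" for x
        using arg_cong[OF c2, of "\<lambda>y. y * x"] by (simp add: algebra_simps)
      have "l * z r * (sin (l * (r - u)) * dd r - cos (l * (r - u)) * ss r) =
         - z t * (l * (c * (sin (l * r) * z r) - s * (cos (l * r) * z r))) +
         l\<^sup>2 * (z r * (sin (l * r) * P r - cos (l * r) * Q r) - P u * (sin (l * r) * z r)
         + Q u * (cos (l * r) * z r))"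
        unfolding cs dd_def ss_def by (simp add: power2_eq_square algebra_simps c3)
      with j1 show "(jj has_real_derivative l * z r *
          (sin (l * (r - u)) * dd r - cos (l * (r - u)) * ss r)) (at r)" by simp
    qed (use l h lh in \<open>auto simp: u_def ss_def jj_def\<close>)
    then show ?thesis
      by (simp add: J_def D_def C_def S_def jj_def dd_def ss_def c_def s_def u_def)
  qed
  have V0: "V t \<ge> 0" if t: "t > U" for t
  proof -
    have "k * (2 * J t) \<le> k * ((D t)\<^sup>2 + (S t)\<^sup>2)" using J_le[OF t] k0 by simp
    also have "\<dots> \<le> 1 * ((D t)\<^sup>2 + (S t)\<^sup>2)" using k1 by (intro mult_right_mono) auto
    finally show ?thesis by (simp add: V_def)
  qed
  have Ymono: "Y r \<le> Y t" if "T < r" "r \<le> t" for r t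
    by (rule DERIV_nonneg_imp_nondecreasing[OF that(2)]) (use Y[OF less_le_trans[OF that(1)]] in \<open>auto intro!: exI[of _ "(z _)\<^sup>2"]\<close>)
  have H0: "H t \<ge> 0" if t: "t > U" for t
  proof -
    define g where "g r = Y t * r - YY r" for r
    have "g (t - h) \<le> g t"
    proof (rule DERIV_nonneg_imp_nondecreasing[of "t - h" t g])
      fix r assume r: "t - h \<le> r" "r \<le> t"
      then have rT: "r > T" "r > T + 1" using t by (auto simp: U_def)
      have "(g has_real_derivative Y t - Y r) (at r)"
        unfolding g_def[abs_def] by (rule derivative_eq_intros YY refl rT | simp)+
      then show "\<exists>y. (g has_real_derivative y) (at r) \<and> 0 \<le> y"
        using Ymono[OF rT(1) r(2)] by (intro exI conjI) auto
    qed (use h in simp)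
    then show ?thesis by (simp add: g_def H_def algebra_simps)
  qed
  have W0: "W t \<ge> 0" if t: "t > U" for t
    unfolding W_def using V0[OF t] H0[OF t] k0 l h by simp

  \<comment> \<open>By \<open>DS\<close>, the Young estimate with parameter \<open>e\<close> costs
    \<open>2 e\<close> of the coefficient of \<open>z^2\<close> and \<open>4 l^2 h e\<close> of that
    of \<open>w\<close>. The two arguments of the minimum keep the first cost below half of the
    available \<open>k l\<close> and the second within the available \<open>k l / h\<close>.\<close>
  define e where "e = min (k * l / 4) (k / (4 * l * h\<^sup>2))"
  have e: "e > 0" "2 * e \<le> k * l / 2" "4 * l\<^sup>2 * h * e \<le> k * l / h"
  proof -
    show "e > 0" using k0 l h by (simp add: e_def)
    show "2 * e \<le> k * l / 2" by (simp add: e_def min_def)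
    have "4 * l\<^sup>2 * h * e \<le> 4 * l\<^sup>2 * h * (k / (4 * l * h\<^sup>2))"
      using l h by (intro mult_left_mono) (auto simp: e_def)
    also have "\<dots> = k * l / h" using l h by (simp add: power2_eq_square field_simps)
    finally show "4 * l\<^sup>2 * h * e \<le> k * l / h" .
  qed
  have W'_le: "- k * l * (z t)\<^sup>2 - k * l / h * w t + f t * (- 2 * D t + 2 * k * S t)
      \<le> - (k * l / 2) * (z t)\<^sup>2 + 2 / e * (f t)\<^sup>2" if t: "t > U" for t
  proof -
    have "w t \<ge> 0" unfolding w_def using Ymono[of "t - h" t] t h by (auto simp: U_def)
    have "2 * D t * (- f t) \<le> e * (D t)\<^sup>2 + (- f t)\<^sup>2 / e" by (rule real_Young[OF e(1)])
    moreover have "2 * S t * (k * f t) \<le> e * (S t)\<^sup>2 + (k * f t)\<^sup>2 / e" by (rule real_Young[OF e(1)])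
    moreover have "(k * f t)\<^sup>2 / e \<le> (f t)\<^sup>2 / e"
    proof -
      have "k\<^sup>2 * (f t)\<^sup>2 \<le> 1 * (f t)\<^sup>2"
        using k0 k1 by (intro mult_right_mono) (auto simp: power_le_one)
      then show ?thesis using e(1) by (intro divide_right_mono) (auto simp: power_mult_distrib)
    qed
    ultimately have "f t * (- 2 * D t + 2 * k * S t) \<le> e * ((D t)\<^sup>2 + (S t)\<^sup>2) + 2 / e * (f t)\<^sup>2"
      by (simp add: algebra_simps)
    also have "e * ((D t)\<^sup>2 + (S t)\<^sup>2) \<le> e * (2 * (z t)\<^sup>2 + 4 * l\<^sup>2 * h * w t)"
      using DS[OF t] e(1) by simp
    also have "\<dots> = 2 * e * (z t)\<^sup>2 + 4 * l\<^sup>2 * h * e * w t" by (simp add: algebra_simps)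
    also have "\<dots> \<le> k * l / 2 * (z t)\<^sup>2 + k * l / h * w t"
      using e(2,3) \<open>w t \<ge> 0\<close> by (intro add_mono mult_right_mono) auto
    finally show ?thesis by (simp add: field_simps)
  qed

  obtain Sf B F F' where F: "\<And>t. t \<ge> Sf \<Longrightarrow> (F has_real_derivative F' t) (at t) \<and>
      (f t)\<^sup>2 \<le> F' t \<and> F t \<le> B"
    using f unfolding sq_integrable_tail_def by auto
  \<comment> \<open>Up to scaling this is \<open>2 / e * F - W\<close>: its derivative dominates
    \<open>z^2\<close> by \<open>W'_le\<close>, and it is bounded above because \<open>W\<close> is
    nonnegative.\<close>
  define G where "G t = 2 / (k * l) * (2 / e * F t - W t)" for t
  define G' where "G' t = 2 / (k * l) * (2 / e * F' t - (- k * l * (z t)\<^sup>2 - k * l / h * w t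
      + f t * (- 2 * D t + 2 * k * S t)))" for t
  show ?thesis
  proof (rule sq_integrable_tailI[of "max Sf (U + 1)" G G' z "2 / (k * l) * (2 / e * B)"])
    fix t assume "t \<ge> max Sf (U + 1)"
    then have t: "t > U" "t \<ge> Sf" by auto
    have "(G has_real_derivative G' t) (at t)" unfolding G_def[abs_def] G'_def
      by (rule derivative_eq_intros W'[OF t(1)] F[OF t(2), THEN conjunct1] refl | simp)+
    moreover have "(z t)\<^sup>2 \<le> G' t"
    proof -
      have "2 / e * (f t)\<^sup>2 \<le> 2 / e * F' t" using F[OF t(2)] e by (intro mult_left_mono) auto
      with W'_le[OF t(1)] have "k * l / 2 * (z t)\<^sup>2 \<le> 2 / e * F' t - (- k * l * (z t)\<^sup>2 - k * l / h * w t
        + f t * (- 2 * D t + 2 * k * S t))" by linarith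
      then have "2 / (k * l) * (k * l / 2 * (z t)\<^sup>2) \<le> G' t"
        unfolding G'_def using k0 l by (intro mult_left_mono) auto
      then show ?thesis using k0 l by simp
    qed
    moreover have "G t \<le> 2 / (k * l) * (2 / e * B)"
    proof -
      have "2 / e * F t \<le> 2 / e * B" using F[OF t(2)] e by (intro mult_left_mono) auto
      then show ?thesis unfolding G_def using k0 l W0[OF t(1)] by (intro mult_left_mono) auto
    qed
    ultimately show "(G has_real_derivative G' t) (at t) \<and> (z t)\<^sup>2 \<le> G' t \<and>
        G t \<le> 2 / (k * l) * (2 / e * B)" by blast
  qed
qed

text \<open>The functional for positive delay divides by \<open>h\<close>. Without delay,
  \<open>z^2\<close> itself serves: by Young its derivative is at most
  \<open>- l z^2 + f^2 / l\<close>.\<close>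

lemma ODE_sq_integrable:
  fixes l :: real
  assumes l: "l > 0"
    and z: "\<And>t. t \<ge> T \<Longrightarrow> (z has_real_derivative - l * z t + f t) (at t)"
    and f: "sq_integrable_tail f"
  shows "sq_integrable_tail z"
proof -
  obtain Sf B F F' where F: "\<And>t. t \<ge> Sf \<Longrightarrow> (F has_real_derivative F' t) (at t) \<and>
      (f t)\<^sup>2 \<le> F' t \<and> F t \<le> B"
    using f unfolding sq_integrable_tail_def by auto
  define G where "G t = 1 / l * (1 / l * F t - (z t)\<^sup>2)" for t
  define G' where "G' t = 1 / l * (1 / l * F' t - 2 * z t * (- l * z t + f t))" for t
  show ?thesis
  proof (rule sq_integrable_tailI[of "max Sf T" G G' z "1 / l * (1 / l * B)"])
    fix t assume "t \<ge> max Sf T"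
    then have t: "t \<ge> T" "t \<ge> Sf" by auto
    have "(G has_real_derivative G' t) (at t)" unfolding G_def[abs_def] G'_def
      by (rule derivative_eq_intros z[OF t(1)] F[OF t(2), THEN conjunct1] refl | simp)+
    moreover have "(z t)\<^sup>2 \<le> G' t"
    proof -
      have "1 / l * (f t)\<^sup>2 \<le> 1 / l * F' t" using F[OF t(2)] l by (intro mult_left_mono) auto
      with real_Young[OF l, of "z t" "f t"] have "l * (z t)\<^sup>2 \<le> 1 / l * F' t - 2 * z t * (- l * z t + f t)"
        by (simp add: power2_eq_square algebra_simps)
      then have "1 / l * (l * (z t)\<^sup>2) \<le> G' t"
        unfolding G'_def using l by (intro mult_left_mono) auto
      then show ?thesis using l by simp
    qed
    moreover have "G t \<le> 1 / l * (1 / l * B)"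
    proof -
      have "1 / l * F t \<le> 1 / l * B" using F[OF t(2)] l by (intro mult_left_mono) auto
      then show ?thesis unfolding G_def using l zero_le_power2[of "z t"]
        by (intro mult_left_mono) (linarith, simp)
    qed
    ultimately show "(G has_real_derivative G' t) (at t) \<and> (z t)\<^sup>2 \<le> G' t \<and>
        G t \<le> 1 / l * (1 / l * B)" by blast
  qed
qed

text \<open>Once \<open>z\<close> is square integrable, so is its derivative, a combination of a
  shift of \<open>z\<close> and the forcing, and Barbalat's argument yields the limit.\<close>

lemma DDE_stable:
  fixes l h :: real
  assumes l: "l > 0" and h: "h \<ge> 0" and lh: "l * h < pi / 2"
    and z: "\<And>t. t \<ge> T \<Longrightarrow> (z has_real_derivative - l * z (t - h) + f t) (at t)"
    and f: "sq_integrable_tail f"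
  shows "sq_integrable_tail z" and "(z \<longlongrightarrow> 0) at_top"
proof -
  show zs: "sq_integrable_tail z"
  proof (cases "h = 0")
    case True
    then show ?thesis using ODE_sq_integrable[OF l _ f, of T z] z by simp
  next
    case False
    then show ?thesis using DDE_sq_integrable_pos_delay[OF l _ lh z f] h by simp
  qed
  have "sq_integrable_tail (\<lambda>t. - l * z (t - h) + f t)"
    by (intro sq_integrable_tail_add sq_integrable_tail_cmult sq_integrable_tail_shift zs f)
  then show "(z \<longlongrightarrow> 0) at_top" by (rule sq_integrable_tail_tendsto_0[OF zs _ z])
qed

subsection \<open>The scalar delay equation above the critical delay\<close>

text \<open>With \<open>s h = X + i \<theta>\<close>, dividing the real by the imaginary part of the
  equation gives \<open>X = - \<theta> cot \<theta>\<close>, and what remains is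
  \<open>g \<theta> = l h\<close>. On \<open>[pi/2, pi)\<close> this \<open>X\<close> is
  nonnegative, while \<open>g\<close> starts at \<open>pi/2\<close> and tends to infinity, so the
  intermediate value theorem supplies the root.\<close>

lemma DDE_unstable_characteristic_root:
  fixes l h :: real
  assumes h: "h > 0" and lh: "l * h \<ge> pi / 2"
  obtains s :: complex where "Re s \<ge> 0" "s \<noteq> 0" "s = - of_real l * exp (- s * of_real h)"
proof -
  define g where "g \<theta> = \<theta> * exp (- (\<theta> * cos \<theta> / sin \<theta>)) / sin \<theta>" for \<theta> :: real
  \<comment> \<open>Chosen so that \<open>g (pi - e)\<close> reaches \<open>l h\<close>: there the
    exponential factor is at least 1 and the angle at least \<open>pi/2\<close>, and
    \<open>sin e \<le> e\<close> leaves \<open>pi / (2 e)\<close> as a lower bound.\<close>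
  define e where "e = min (pi / 2) (pi / (2 * (l * h)))"
  have lh0: "l * h > 0" using lh pi_gt_zero by linarith
  have e: "e > 0" "e \<le> pi / 2" "e \<le> pi / (2 * (l * h))" using lh0 by (auto simp: e_def)
  have sin0: "sin \<theta> > 0" if "pi / 2 \<le> \<theta>" "\<theta> \<le> pi - e" for \<theta>
    using that e pi_gt_zero by (intro sin_gt_zero) linarith+
  have "\<exists>\<theta>. pi / 2 \<le> \<theta> \<and> \<theta> \<le> pi - e \<and> g \<theta> = l * h"
  proof (rule IVT')
    show "g (pi / 2) \<le> l * h" using lh by (simp add: g_def)
    have s: "sin (pi - e) > 0" using sin0[of "pi - e"] e by simp
    have "l * h \<le> (pi / 2) / e" using e lh0 by (simp add: field_simps)
    also have "\<dots> \<le> (pi / 2) / sin e" using e s by (intro divide_left_mono) (auto simp: sin_x_le_x)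
    also have "\<dots> \<le> (pi - e) * exp (- ((pi - e) * cos (pi - e) / sin (pi - e))) / sin e"
    proof -
      have "0 \<le> cos e" using e pi_gt_zero by (intro cos_ge_zero) linarith+
      then have "0 \<le> - ((pi - e) * cos (pi - e) / sin (pi - e))"
        using e s pi_gt_zero by (simp add: divide_nonneg_pos)
      then have "1 \<le> exp (- ((pi - e) * cos (pi - e) / sin (pi - e)))" by simp
      moreover have "pi / 2 \<le> pi - e" using e by simp
      ultimately have "pi / 2 * 1 \<le> (pi - e) * exp (- ((pi - e) * cos (pi - e) / sin (pi - e)))"
        using pi_gt_zero by (intro mult_mono) linarith+
      then show ?thesis using s by (intro divide_right_mono) auto
    qed
    finally show "l * h \<le> g (pi - e)" by (simp add: g_def)
    show "pi / 2 \<le> pi - e" using e by simp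
    show "continuous_on {pi / 2..pi - e} g"
      unfolding g_def[abs_def] using sin0 by (intro continuous_intros) force+
  qed
  then obtain \<theta> where \<theta>: "pi / 2 \<le> \<theta>" "\<theta> \<le> pi - e" "g \<theta> = l * h" by blast
  note s0 = sin0[OF \<theta>(1,2)]
  define X where "X = - (\<theta> * cos \<theta> / sin \<theta>)"
  have "cos \<theta> \<le> 0"
  proof -
    have "cos (pi - \<theta>) \<ge> 0" using \<theta> e pi_gt_zero by (intro cos_ge_zero) linarith+
    then show ?thesis by simp
  qed
  moreover have "\<theta> \<ge> 0" using \<theta>(1) pi_gt_zero by linarith
  ultimately have X0: "X \<ge> 0" using s0 unfolding X_def
    by (simp add: divide_nonpos_pos mult_nonneg_nonpos)
  have "\<theta> * exp X = l * h * sin \<theta>"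
    using \<theta>(3) s0 unfolding g_def X_def by (simp add: field_simps)
  then have im: "\<theta> = l * h * (exp (- X) * sin \<theta>)"
    by (simp add: exp_minus field_simps)
  have "X = - (\<theta> / sin \<theta>) * cos \<theta>" by (simp add: X_def)
  also have "\<theta> / sin \<theta> = l * h * exp (- X)" using im s0 by (simp add: field_simps)
  finally have re: "X = - (l * h * (exp (- X) * cos \<theta>))" by simp
  define s where "s = Complex (X / h) (\<theta> / h)"
  have sh: "s * of_real h = Complex X \<theta>" using h by (simp add: s_def complex_eq_iff)
  have "s = - of_real l * exp (- s * of_real h)"
  proof -
    have "exp (- s * of_real h) = exp (- Complex X \<theta>)" using sh by simp
    moreover have "Re s = - l * (exp (- X) * cos \<theta>)"
      using re h unfolding s_def by (metis complex.sel(1) mult.commute mult.left_commute mult_minus_left nonzero_mult_div_cancel_left less_irrefl)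
    moreover have "Im s = l * (exp (- X) * sin \<theta>)"
      using im h unfolding s_def by (metis complex.sel(2) mult.commute mult.left_commute nonzero_mult_div_cancel_left less_irrefl)
    ultimately show ?thesis by (simp add: complex_eq_iff Re_exp Im_exp)
  qed
  moreover have "Re s \<ge> 0" using X0 h by (simp add: s_def)
  moreover have "s \<noteq> 0"
  proof -
    have "\<theta> > 0" using \<theta>(1) pi_gt_zero by linarith
    then show ?thesis using h by (simp add: s_def complex_eq_iff)
  qed
  ultimately show ?thesis using that by blast
qed

text \<open>For a characteristic root \<open>s\<close> the functional
  \<open>exp (- s t) z t + s \<integral> exp (- s r) z r dr\<close>, with the integral over \<open>[t - h, t]\<close>, is conserved;
  if \<open>Re s \<ge> 0\<close> it would tend to 0 along with \<open>z\<close>.\<close>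

lemma DDE_unstable:
  fixes l h :: real and z :: "real \<Rightarrow> real"
  assumes h: "h > 0" and lh: "l * h \<ge> pi / 2"
    and init: "\<And>t. \<lbrakk>0 \<le> t; t \<le> h\<rbrakk> \<Longrightarrow> z t = z0"
    and cont: "continuous_on {0..} z"
    and deriv: "\<And>t. t > h \<Longrightarrow> (z has_real_derivative - l * z (t - h)) (at t)"
    and lim: "(z \<longlongrightarrow> 0) at_top"
  shows "z0 = 0"
proof -
  obtain s :: complex where s: "Re s \<ge> 0" "s \<noteq> 0" "s = - of_real l * exp (- s * of_real h)"
    using DDE_unstable_characteristic_root[OF h lh] .
  define E where "E t = exp (- s * complex_of_real t)" for t
  define p where "p t = E t * complex_of_real (z t)" for t
  define P where "P t = integral {0..t} p" for t
  define A where "A t = p t + s * (P t - P (t - h))" for t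
  have E': "(E has_vector_derivative - s * E t) (at t within X)" for t X
  proof -
    have "((\<lambda>w. exp (- s * w)) has_field_derivative - s * exp (- s * of_real t)) (at (of_real t))"
      by (auto intro!: derivative_eq_intros)
    from has_vector_derivative_real_field[OF this] show ?thesis
      unfolding E_def[abs_def] by (rule has_vector_derivative_at_within)
  qed
  have Ec: "continuous_on X E" for X
    unfolding E_def[abs_def] by (intro continuous_intros)
  have pc: "continuous_on {0..} p"
    unfolding p_def[abs_def] by (intro continuous_intros Ec cont)
  have pint: "p integrable_on {a..b}" if "a \<ge> 0" for a b
    by (intro integrable_continuous_real continuous_on_subset[OF pc]) (use that in auto)
  have P': "(P has_vector_derivative p t) (at t)" if "t > 0" for t
  proof -
    have "(P has_vector_derivative p t) (at t within {0..t + 1})" unfolding P_def[abs_def]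
      using that by (intro integral_has_vector_derivative continuous_on_subset[OF pc]) auto
    moreover have "at t within {0..t + 1} = at t" using that by (intro at_within_interior) auto
    ultimately show ?thesis by simp
  qed
  have Ph: "((\<lambda>t. P (t - h)) has_vector_derivative p (t - h)) (at t)" if "t > h" for t
  proof -
    have "((\<lambda>t. t - h) has_vector_derivative 1) (at t)"
      by (auto intro!: derivative_eq_intros)
    from vector_diff_chain_at[OF this P'[of "t - h"]] show ?thesis
      using that by (simp add: o_def)
  qed
  have A': "(A has_vector_derivative 0) (at t)" if t: "t > h" for t
  proof -
    have z': "((\<lambda>t. complex_of_real (z t)) has_vector_derivative of_real (- l * z (t - h))) (at t)"
      using deriv[OF t] unfolding has_real_derivative_iff_has_vector_derivative
      by (rule bounded_linear.has_vector_derivative[OF bounded_linear_of_real])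
    have p': "(p has_vector_derivative E t * of_real (- l * z (t - h)) + - s * E t * of_real (z t)) (at t)"
      unfolding p_def[abs_def] by (rule has_vector_derivative_mult[OF E' z'])
    have "(A has_vector_derivative E t * of_real (- l * z (t - h)) + - s * E t * of_real (z t)
        + s * (p t - p (t - h))) (at t)"
      unfolding A_def[abs_def] using t h
      by (intro has_vector_derivative_add p' has_vector_derivative_mult_right has_vector_derivative_diff P' Ph) auto
    moreover have "E t * of_real (- l * z (t - h)) + - s * E t * of_real (z t) + s * (p t - p (t - h)) = 0"
    proof -
      \<comment> \<open>Here the characteristic equation enters: it turns \<open>- l * E t\<close>
        into \<open>s * E (t - h)\<close>, which cancels the contribution of the lower end of the
        window.\<close>
      have "E t = E (t - h) * exp (- s * of_real h)"
        unfolding E_def exp_add[symmetric] by (simp add: algebra_simps)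
      then have "- of_real l * E t = E (t - h) * s"
        using s(3) by (metis mult.commute mult.left_commute)
      then have "E t * of_real (- l * z (t - h)) = E (t - h) * s * of_real (z (t - h))"
        by (metis (no_types, lifting) mult.commute of_real_minus of_real_mult mult.assoc)
      then show ?thesis by (simp add: p_def algebra_simps)
    qed
    ultimately show ?thesis by simp
  qed
  have Pc: "continuous_on {0..b} P" for b
    unfolding P_def[abs_def] by (intro indefinite_integral_continuous_1 pint) simp
  have Ac: "continuous_on {h..b} A" for b
    unfolding A_def[abs_def] using h
    by (intro continuous_intros continuous_on_subset[OF pc] continuous_on_subset[OF Pc[of b]]
        continuous_on_compose2[OF Pc[of b]]) auto
  have const: "A t = A h" if t: "t \<ge> h" for t
  proof (rule has_derivative_zero_unique_strong_interval[of "{h}" h t A])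
    show "(A has_derivative (\<lambda>h. 0)) (at x within {h..t})" if "x \<in> {h..t} - {h}" for x
      using has_vector_derivative_at_within[OF A'[of x], of "{h..t}"] that
      by (auto simp: has_vector_derivative_def)
  qed (use t Ac in auto)
  \<comment> \<open>As \<open>z\<close> equals \<open>z0\<close> on \<open>[0, h]\<close>, the
    integral contributes \<open>z0 * (1 - E h)\<close>, exactly what \<open>p h = z0 * E h\<close>
    lacks.\<close>
  have Ah: "A h = of_real z0"
  proof -
    have "((\<lambda>r. of_real z0 * E r) has_integral of_real z0 * (- E h / s) - of_real z0 * (- E 0 / s)) {0..h}"
    proof (rule fundamental_theorem_of_calculus)
      fix x assume "x \<in> {0..h}"
      have "((\<lambda>r. of_real z0 * (- (1 / s)) * E r) has_vector_derivative of_real z0 * (- (1 / s)) * (- s * E x))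
          (at x within {0..h})" by (intro has_vector_derivative_mult_right E')
      then show "((\<lambda>r. of_real z0 * (- E r / s)) has_vector_derivative of_real z0 * E x) (at x within {0..h})"
        using s(2) by simp
    qed (use h in simp)
    then have "(p has_integral of_real z0 * (- E h / s) - of_real z0 * (- E 0 / s)) {0..h}"
      by (rule has_integral_eq[rotated]) (simp add: p_def init)
    then have "P h = of_real z0 * (- E h / s) - of_real z0 * (- E 0 / s)"
      unfolding P_def by (rule integral_unique)
    moreover have "P 0 = 0" by (simp add: P_def)
    ultimately show ?thesis
      using s(2) h init[of h] by (simp add: A_def p_def E_def field_simps)
  qed
  have Enorm: "norm (E t) \<le> 1" if "t \<ge> 0" for t
    using s(1) that by (simp add: E_def)
  have "norm (of_real z0 :: complex) \<le> 0"
  proof (rule field_le_epsilon)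
    fix e :: real assume e: "e > 0"
    \<comment> \<open>Since \<open>Re s \<ge> 0\<close>, the factor \<open>E\<close> is bounded by
      1, so \<open>z\<close> below \<open>d\<close> on the window bounds the functional by
      \<open>d * (1 + norm s * h)\<close>. The critical case \<open>Re s = 0\<close> is covered
      too.\<close>
    define d where "d = e / (1 + norm s * h)"
    have den: "1 + norm s * h > 0" using h by (simp add: add_pos_nonneg)
    have d: "d > 0" using e den by (simp add: d_def)
    have "\<forall>\<^sub>F t in at_top. \<bar>z t\<bar> < d" using tendstoD[OF lim d] by simp
    then obtain T where T: "\<And>t. t \<ge> T \<Longrightarrow> \<bar>z t\<bar> < d" by (auto simp: eventually_at_top_linorder)
    define t where "t = max T 0 + h"
    have pd: "norm (p r) \<le> d" if "r \<ge> t - h" for r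
    proof -
      have "norm (p r) \<le> 1 * d" unfolding p_def norm_mult
        using that Enorm[of r] T[of r] by (intro mult_mono) (auto simp: t_def)
      then show ?thesis by simp
    qed
    have "P t - P (t - h) = integral {t - h..t} p"
      unfolding P_def using Henstock_Kurzweil_Integration.integral_combine[where a = 0 and c = "t - h" and b = t and f = p] h pint
      by (auto simp: t_def algebra_simps)
    moreover have "norm (integral {t - h..t} p) \<le> d * (t - (t - h))"
      using h pd pint by (intro integral_bound continuous_on_subset[OF pc]) (auto simp: t_def)
    ultimately have "norm (P t - P (t - h)) \<le> d * h" by simp
    then have "norm s * norm (P t - P (t - h)) \<le> norm s * (d * h)" by (intro mult_left_mono) auto
    then have "norm (A t) \<le> d + norm s * (d * h)"
      unfolding A_def using pd[of t] h norm_triangle_ineq[of "p t" "s * (P t - P (t - h))"]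
      by (simp add: norm_mult)
    also have "\<dots> = d * (1 + norm s * h)" by (simp add: algebra_simps)
    also have "\<dots> = e" using den by (simp add: d_def)
    finally show "norm (of_real z0 :: complex) \<le> 0 + e"
      using const[of t] Ah h by (simp add: t_def)
  qed
  then show ?thesis by simp
qed

subsection \<open>Systems with a symmetrizable coefficient matrix\<close>

text \<open>In the Hermitian form weighted by \<open>a\<close> the matrix is self-adjoint:
  \<open>q\<close> is its own conjugate and equals \<open>\<mu>\<close> times the positive number
  \<open>r\<close>.\<close>

lemma symmetrizable_eigenvalue_real:
  fixes M :: "nat \<Rightarrow> nat \<Rightarrow> real" and v :: "nat \<Rightarrow> complex"
  assumes pos: "\<And>i. i < n \<Longrightarrow> 0 < a i"
    and sym: "\<And>i j. \<lbrakk>i < n; j < n\<rbrakk> \<Longrightarrow> a i * M i j = a j * M j i"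
    and v: "\<And>i. i < n \<Longrightarrow> (\<Sum>j<n. of_real (M i j) * v j) = \<mu> * v i" "i0 < n" "v i0 \<noteq> 0"
  shows "\<mu> \<in> \<real>"
proof -
  have nsq: "(complex_of_real (cmod w))\<^sup>2 = w * cnj w" for w
    using complex_norm_square[of w] by simp
  define q where "q = (\<Sum>i<n. \<Sum>j<n. of_real (a i * M i j) * cnj (v i) * v j)"
  define r where "r = (\<Sum>i<n. a i * (norm (v i))\<^sup>2)"
  have "cnj q = (\<Sum>i<n. \<Sum>j<n. of_real (a i * M i j) * v i * cnj (v j))"
    by (simp add: q_def)
  also have "\<dots> = (\<Sum>j<n. \<Sum>i<n. of_real (a i * M i j) * v i * cnj (v j))" by (rule sum.swap)
  also have "\<dots> = q" unfolding q_def
    by (intro sum.cong refl) (use sym in \<open>simp add: mult_ac flip: of_real_mult\<close>)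
  finally have q: "q \<in> \<real>" by (simp add: complex_is_Real_iff complex_eq_iff)
  have "q = (\<Sum>i<n. of_real (a i) * cnj (v i) * (\<Sum>j<n. of_real (M i j) * v j))"
    unfolding q_def by (simp add: sum_distrib_left mult_ac)
  also have "\<dots> = (\<Sum>i<n. of_real (a i) * cnj (v i) * (\<mu> * v i))" using v by simp
  also have "\<dots> = \<mu> * of_real r"
    unfolding r_def of_real_sum sum_distrib_left
    using nsq by (intro sum.cong refl) (simp add: mult_ac)
  finally have qr: "q = \<mu> * of_real r" .
  have "0 < a i0 * (norm (v i0))\<^sup>2" using v pos by simp
  also have "\<dots> \<le> r" unfolding r_def
    by (rule member_le_sum) (use v pos in \<open>auto intro!: mult_nonneg_nonneg simp: less_imp_le\<close>)
  finally have "\<mu> = q / of_real r" using qr by simp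
  then show ?thesis using q by simp
qed

lemma eigenvalue_sum_iff:
  fixes X :: "'a :: field mat"
  assumes X: "X \<in> carrier_mat n n"
  shows "eigenvalue X e \<longleftrightarrow>
    (\<exists>v. (\<exists>i<n. v i \<noteq> 0) \<and> (\<forall>i<n. (\<Sum>j<n. X $$ (i, j) * v j) = e * v i))"
proof
  assume "eigenvalue X e"
  then obtain v where v: "v \<in> carrier_vec n" "v \<noteq> 0\<^sub>v n" "X *\<^sub>v v = e \<cdot>\<^sub>v v"
    using X by (auto simp: eigenvalue_def eigenvector_def)
  have "(\<Sum>j<n. X $$ (i, j) * vec_index v j) = e * vec_index v i" if "i < n" for i
    using arg_cong[OF v(3), of "\<lambda>w. vec_index w i"] that v(1) X
    by (simp add: scalar_prod_def lessThan_atLeast0)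
  moreover have "\<exists>i<n. vec_index v i \<noteq> 0"
  proof (rule ccontr)
    assume "\<not> ?thesis"
    then have "v = 0\<^sub>v n" using v(1) by (intro eq_vecI) auto
    then show False using v(2) by simp
  qed
  ultimately show "\<exists>v. (\<exists>i<n. v i \<noteq> 0) \<and> (\<forall>i<n. (\<Sum>j<n. X $$ (i, j) * v j) = e * v i)"
    by (intro exI[of _ "vec_index v"]) auto
next
  assume "\<exists>v. (\<exists>i<n. v i \<noteq> 0) \<and> (\<forall>i<n. (\<Sum>j<n. X $$ (i, j) * v j) = e * v i)"
  then obtain v i where v: "i < n" "v i \<noteq> 0" "\<And>i. i < n \<Longrightarrow> (\<Sum>j<n. X $$ (i, j) * v j) = e * v i"
    by blast
  have "vec n v \<noteq> 0\<^sub>v n" using v(1,2) by (metis index_vec index_zero_vec(1))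
  moreover have "X *\<^sub>v vec n v = e \<cdot>\<^sub>v vec n v"
    using X v(3) by (intro eq_vecI) (auto simp: scalar_prod_def lessThan_atLeast0)
  ultimately show "eigenvalue X e"
    using X by (auto simp: eigenvalue_def eigenvector_def intro!: exI[of _ "vec n v"])
qed

text \<open>A triangular form suffices for a cascade. The complex characteristic polynomial splits
  and its roots are real by symmetrizability, so the real one splits as well and a Schur
  decomposition exists over the reals. The last clause identifies the diagonal entries as
  eigenvalues, in the form of the spectral hypotheses below.\<close>

lemma symmetrizable_triangularization:
  fixes M :: "nat \<Rightarrow> nat \<Rightarrow> real"
  assumes pos: "\<And>i. i < n \<Longrightarrow> 0 < a i"
    and sym: "\<And>i j. \<lbrakk>i < n; j < n\<rbrakk> \<Longrightarrow> a i * M i j = a j * M j i"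
  shows "\<exists>P Q B :: nat \<Rightarrow> nat \<Rightarrow> real.
    (\<forall>k<n. \<forall>m<n. (\<Sum>j<n. Q k j * M j m) = (\<Sum>r<n. B k r * Q r m)) \<and>
    (\<forall>k<n. \<forall>r<k. B k r = 0) \<and>
    (\<forall>i<n. \<forall>m<n. (\<Sum>k<n. P i k * Q k m) = (if i = m then 1 else 0)) \<and>
    (\<forall>k<n. \<exists>v. (\<exists>i<n. v i \<noteq> 0) \<and> (\<forall>i<n. (\<Sum>j<n. M i j * v j) = B k k * v i))"
proof -
  define A where "A = mat n n (\<lambda>(i, j). M i j)"
  define cA where "cA = map_mat complex_of_real A"
  have A: "A \<in> carrier_mat n n" and cA: "cA \<in> carrier_mat n n" by (auto simp: A_def cA_def)
  obtain as where as: "char_poly cA = (\<Prod>e\<leftarrow>as. [:- e, 1:])" "length as = n"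
    using char_poly_factorized[OF cA] by auto
  have as_real: "e \<in> \<real>" if "e \<in> set as" for e
  proof -
    have "poly (char_poly cA) e = 0"
      unfolding as poly_prod_list using that by (auto simp: prod_list_zero_iff o_def)
    then have "eigenvalue cA e" using eigenvalue_root_char_poly[OF cA] by simp
    with eigenvalue_sum_iff[OF cA] obtain v where v: "\<exists>i<n. v i \<noteq> 0"
       "\<And>i. i < n \<Longrightarrow> (\<Sum>j<n. cA $$ (i, j) * v j) = e * v i" by auto
    obtain i0 where "i0 < n" "v i0 \<noteq> 0" using v by auto
    then show ?thesis
      by (intro symmetrizable_eigenvalue_real[of n a M v e i0])
        (use v(2) pos sym in \<open>auto simp: cA_def A_def\<close>)
  qed
  define es where "es = map Re as"
  have "as = map complex_of_real es"
    unfolding es_def using as_real by (simp add: map_idI o_def)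
  have map_poly_of_real_mult: "map_poly complex_of_real (p * q) =
      map_poly complex_of_real p * map_poly complex_of_real q" for p q
    by (simp add: poly_eq_iff coeff_map_poly coeff_mult)
  have hom: "char_poly cA = map_poly complex_of_real (char_poly A)"
    unfolding cA_def by (rule of_real_hom.char_poly_hom[OF A])
  from \<open>as = map complex_of_real es\<close> have "map_poly complex_of_real (char_poly A) = (\<Prod>e\<leftarrow>es. [:- complex_of_real e, 1:])"
    using as(1) hom by (simp add: o_def)
  also have "\<dots> = map_poly complex_of_real (\<Prod>e\<leftarrow>es. [:- e, 1:])"
    by (induction es) (simp_all add: map_poly_of_real_mult map_poly_pCons del: mult_pCons_left mult_pCons_right)
  finally have cp: "char_poly A = (\<Prod>e\<leftarrow>es. [:- e, 1:])"
    by (auto simp: poly_eq_iff coeff_map_poly)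
  obtain B P Q where BPQ: "schur_decomposition A es = (B, P, Q)" by (rule prod_cases3)
  from schur_decomposition[OF A cp BPQ]
  have wit: "similar_mat_wit A B P Q" and ut: "upper_triangular B" and dg: "diag_mat B = es" by auto
  note w = similar_mat_witD2[OF A wit]
  show ?thesis
  proof (rule exI[of _ "\<lambda>i k. P $$ (i, k)"], rule exI[of _ "\<lambda>k j. Q $$ (k, j)"],
      rule exI[of _ "\<lambda>k r. B $$ (k, r)"], intro conjI allI impI)
    fix k m assume km: "k < n" "m < n"
    have "Q * A = B * Q"
    proof -
      have "Q * A = Q * (P * (B * Q))" using w by (simp add: assoc_mult_mat[of _ n n _ n _ n])
      also have "\<dots> = (Q * P) * (B * Q)" using w(4-7) by (simp add: assoc_mult_mat[of Q n n P n _ n, symmetric])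
      finally show ?thesis using w by simp
    qed
    then have "(Q * A) $$ (k, m) = (B * Q) $$ (k, m)" by simp
    then show "(\<Sum>j<n. Q $$ (k, j) * M j m) = (\<Sum>r<n. B $$ (k, r) * Q $$ (r, m))"
      using km w(4-7) by (simp add: scalar_prod_def lessThan_atLeast0 A_def)
  next
    fix k r assume "k < n" "r < k"
    then show "B $$ (k, r) = 0" using ut w(5) by (auto simp: upper_triangular_def)
  next
    fix i m assume im: "i < n" "m < n"
    have "(P * Q) $$ (i, m) = 1\<^sub>m n $$ (i, m)" using w by simp
    then show "(\<Sum>k<n. P $$ (i, k) * Q $$ (k, m)) = (if i = m then 1 else 0)"
      using im w(4-7) by (simp add: scalar_prod_def lessThan_atLeast0)
  next
    fix k assume k: "k < n"
    have "B $$ (k, k) \<in> set es" unfolding dg[symmetric] diag_mat_def using k w(5) by auto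
    then have "poly (char_poly A) (B $$ (k, k)) = 0"
      unfolding cp poly_prod_list by (auto simp: prod_list_zero_iff o_def)
    then have "eigenvalue A (B $$ (k, k))" using eigenvalue_root_char_poly[OF A] by simp
    with eigenvalue_sum_iff[OF A] show "\<exists>v. (\<exists>i<n. v i \<noteq> 0) \<and> (\<forall>i<n. (\<Sum>j<n. M i j * v j) = B $$ (k, k) * v i)"
      by (simp add: A_def)
  qed
qed

lemma DDE_system_stable:
  fixes M :: "nat \<Rightarrow> nat \<Rightarrow> real"
  assumes pos: "\<And>i. i < n \<Longrightarrow> 0 < a i"
    and sym: "\<And>i j. \<lbrakk>i < n; j < n\<rbrakk> \<Longrightarrow> a i * M i j = a j * M j i"
    and h: "h \<ge> 0"
    and eigen: "\<And>\<mu> v. \<lbrakk>\<exists>i<n. v i \<noteq> 0; \<forall>i<n. (\<Sum>j<n. M i j * v j) = \<mu> * v i\<rbrakk> \<Longrightarrow> 0 < \<mu> \<and> \<mu> * h < pi / 2"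
    and x: "\<And>t i. \<lbrakk>t \<ge> T; i < n\<rbrakk> \<Longrightarrow>
        (x i has_real_derivative - (\<Sum>j<n. M i j * x j (t - h)) + f i t) (at t)"
    and f: "\<And>i. i < n \<Longrightarrow> sq_integrable_tail (f i)"
    and i: "i < n"
  shows "sq_integrable_tail (x i)" and "(x i \<longlongrightarrow> 0) at_top"
proof -
  obtain P Q B :: "nat \<Rightarrow> nat \<Rightarrow> real" where PQB:
    "\<forall>k<n. \<forall>m<n. (\<Sum>j<n. Q k j * M j m) = (\<Sum>r<n. B k r * Q r m)"
    "\<forall>k<n. \<forall>r<k. B k r = 0"
    "\<forall>i<n. \<forall>m<n. (\<Sum>k<n. P i k * Q k m) = (if i = m then 1 else 0)"
    "\<forall>k<n. \<exists>v. (\<exists>i<n. v i \<noteq> 0) \<and> (\<forall>i<n. (\<Sum>j<n. M i j * v j) = B k k * v i)"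
    by (rule symmetrizable_triangularization[of n a M, OF pos sym, THEN exE])
      (assumption, assumption, assumption, elim exE conjE, rule that)
  note QM = PQB(1)[rule_format] and B0 = PQB(2)[rule_format] and PQ = PQB(3)[rule_format]
    and Bev = PQB(4)[rule_format]
  define u where "u k t = (\<Sum>j<n. Q k j * x j t)" for k t
  define g where "g k t = (\<Sum>j<n. Q k j * f j t)" for k t
  have g: "sq_integrable_tail (g k)" for k
    unfolding g_def[abs_def] by (intro sq_integrable_tail_sum sq_integrable_tail_cmult f) auto
  have u': "(u k has_real_derivative - B k k * u k (t - h) + (- (\<Sum>r\<in>{k<..<n}. B k r * u r (t - h)) + g k t)) (at t)"
    if "t \<ge> T" "k < n" for k t
  proof -
    have D: "(u k has_real_derivative (\<Sum>j<n. Q k j * (- (\<Sum>m<n. M j m * x m (t - h)) + f j t))) (at t)"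
      unfolding u_def[abs_def] using that by (intro DERIV_sum DERIV_cmult x) auto
    have "(\<Sum>j<n. Q k j * (- (\<Sum>m<n. M j m * x m (t - h)) + f j t)) =
        - (\<Sum>j<n. \<Sum>m<n. Q k j * M j m * x m (t - h)) + g k t"
      by (simp add: g_def distrib_left sum.distrib sum_negf sum_distrib_left mult.assoc sum_subtractf right_diff_distrib)
    moreover have "(\<Sum>j<n. \<Sum>m<n. Q k j * M j m * x m (t - h)) = (\<Sum>m<n. (\<Sum>j<n. Q k j * M j m) * x m (t - h))"
      by (subst sum.swap) (simp add: sum_distrib_right)
    moreover have "\<dots> = (\<Sum>m<n. \<Sum>r<n. B k r * Q r m * x m (t - h))"
      using QM that by (simp add: sum_distrib_right)
    moreover have "\<dots> = (\<Sum>r<n. B k r * u r (t - h))"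
      by (subst sum.swap) (simp add: u_def sum_distrib_left mult.assoc)
    moreover have "\<dots> = B k k * u k (t - h) + (\<Sum>r\<in>{k<..<n}. B k r * u r (t - h))"
    proof -
      have "(\<Sum>r<n. B k r * u r (t - h)) = (\<Sum>r\<in>insert k {k<..<n}. B k r * u r (t - h))"
        using that B0 by (intro sum.mono_neutral_right) auto
      then show ?thesis by simp
    qed
    ultimately have "(\<Sum>j<n. Q k j * (- (\<Sum>m<n. M j m * x m (t - h)) + f j t)) =
        - B k k * u k (t - h) + (- (\<Sum>r\<in>{k<..<n}. B k r * u r (t - h)) + g k t)"
      by linarith
    with D show ?thesis by (simp only:)
  qed
  \<comment> \<open>The induction runs downwards from the last coordinate: row \<open>k\<close> of
    \<open>B\<close> involves only coordinates from \<open>k\<close> on, and those beyond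
    \<open>k\<close>, already square integrable, join the forcing.\<close>
  have u_stable: "sq_integrable_tail (u k) \<and> (u k \<longlongrightarrow> 0) at_top" if "k < n" for k
    using that
  proof (induction "n - k" arbitrary: k rule: less_induct)
    case less
    have ev: "0 < B k k \<and> B k k * h < pi / 2" using Bev[OF less.prems] eigen by blast
    have "sq_integrable_tail (\<lambda>t. (- 1) * (\<Sum>r\<in>{k<..<n}. B k r * u r (t - h)) + g k t)"
      using less.hyps less.prems
      by (intro sq_integrable_tail_add sq_integrable_tail_cmult sq_integrable_tail_sum
          sq_integrable_tail_shift g) auto
    then have F: "sq_integrable_tail (\<lambda>t. - (\<Sum>r\<in>{k<..<n}. B k r * u r (t - h)) + g k t)" by simp
    show ?case using DDE_stable[OF _ h _ u'[OF _ less.prems] F] ev by blast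
  qed
  have x_u: "x i = (\<lambda>t. \<Sum>k<n. P i k * u k t)"
  proof
    fix t
    have "(\<Sum>k<n. P i k * u k t) = (\<Sum>j<n. (\<Sum>k<n. P i k * Q k j) * x j t)"
      unfolding u_def sum_distrib_left sum_distrib_right by (subst sum.swap) (simp add: mult.assoc)
    also have "\<dots> = (\<Sum>j<n. if i = j then x j t else 0)"
      using PQ[OF i] by (intro sum.cong refl) auto
    also have "\<dots> = x i t" using i by simp
    finally show "x i t = (\<Sum>k<n. P i k * u k t)" by simp
  qed
  show "sq_integrable_tail (x i)"
    unfolding x_u using u_stable by (intro sq_integrable_tail_sum sq_integrable_tail_cmult) auto
  show "(x i \<longlongrightarrow> 0) at_top"
    unfolding x_u using u_stable by (intro tendsto_null_sum tendsto_mult_right_zero) auto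
qed

subsection \<open>Laplacians of graphs with prescribed components\<close>

text \<open>\<open>\<gamma>\<close> labels the connected components of a single graph on all nodes
  of a layer. Layers 1 and 2, with their groups as classes, and layer 3, with a constant label,
  thereby fall under one notion.\<close>

definition component_graph :: "nat \<Rightarrow> (nat \<Rightarrow> nat) \<Rightarrow> (nat \<Rightarrow> nat \<Rightarrow> bool) \<Rightarrow> bool" where
  "component_graph n \<gamma> E \<longleftrightarrow> (\<forall>i<n. \<forall>j<n. E i j \<longrightarrow> E j i \<and> \<gamma> i = \<gamma> j) \<and>
     (\<forall>i<n. \<forall>j<n. \<gamma> i = \<gamma> j \<longrightarrow> (\<lambda>u v. u < n \<and> v < n \<and> E u v)\<^sup>*\<^sup>* i j)"

lemma laplacian_sum:
  assumes "i < n"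
  shows "(\<Sum>j<n. laplacian_entry n E i j * v j) = (\<Sum>j<n. adj E i j * (v i - v j))"
proof -
  have "(\<Sum>j<n. laplacian_entry n E i j * v j) =
      (\<Sum>j<n. (if i = j then (\<Sum>l<n. adj E i l) * v i else 0) - adj E i j * v j)"
    by (intro sum.cong refl) (auto simp: laplacian_entry_def algebra_simps)
  also have "\<dots> = (\<Sum>l<n. adj E i l) * v i - (\<Sum>j<n. adj E i j * v j)"
    using assms by (simp add: sum_subtractf)
  also have "\<dots> = (\<Sum>j<n. adj E i j * (v i - v j))"
    by (simp add: sum_distrib_right sum_subtractf right_diff_distrib)
  finally show ?thesis .
qed

context
  fixes n :: nat and \<gamma> :: "nat \<Rightarrow> nat" and E :: "nat \<Rightarrow> nat \<Rightarrow> bool"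
  assumes graph: "component_graph n \<gamma> E"
begin

lemma component_adj_sym: "i < n \<Longrightarrow> j < n \<Longrightarrow> adj E i j = adj E j i"
  using graph unfolding component_graph_def adj_def by metis

lemma component_laplacian_sym: "i < n \<Longrightarrow> j < n \<Longrightarrow> laplacian_entry n E i j = laplacian_entry n E j i"
  using component_adj_sym by (auto simp: laplacian_entry_def)

lemma component_laplacian_kernel:
  assumes "i < n"
  shows "(\<Sum>j<n. laplacian_entry n E i j * f (\<gamma> j)) = 0"
  unfolding laplacian_sum[OF assms, of E "\<lambda>j. f (\<gamma> j)"]
proof (intro sum.neutral ballI)
  fix j assume "j \<in> {..<n}"
  then have "E i j \<Longrightarrow> \<gamma> i = \<gamma> j" using graph assms unfolding component_graph_def by blast
  then show "adj E i j * (f (\<gamma> i) - f (\<gamma> j)) = 0" by (cases "E i j") (auto simp: adj_def)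
qed

text \<open>By symmetry this is the kernel property applied to the indicator of a class. It
  expresses that coupling inside a group leaves the weighted sum of the group unchanged.\<close>

lemma component_laplacian_group_sum:
  assumes "j < n"
  shows "(\<Sum>i | i < n \<and> \<gamma> i = p. laplacian_entry n E i j) = 0"
proof -
  have "(\<Sum>i | i < n \<and> \<gamma> i = p. laplacian_entry n E i j) =
      (\<Sum>i<n. laplacian_entry n E j i * (if \<gamma> i = p then 1 else 0))"
  proof -
    have "{i. i < n \<and> \<gamma> i = p} = {i \<in> {..<n}. \<gamma> i = p}" by auto
    then have "(\<Sum>i | i < n \<and> \<gamma> i = p. laplacian_entry n E i j) =
        (\<Sum>i<n. if \<gamma> i = p then laplacian_entry n E i j else 0)"
      by (simp add: sum.If_cases Int_def)
    also have "\<dots> = (\<Sum>i<n. laplacian_entry n E j i * (if \<gamma> i = p then 1 else 0))"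
      using component_laplacian_sym assms by (intro sum.cong refl) auto
    finally show ?thesis .
  qed
  also have "\<dots> = 0"
    using component_laplacian_kernel[OF assms, of "\<lambda>q. if q = p then 1 else 0"] by simp
  finally show ?thesis .
qed

text \<open>Exchanging \<open>i\<close> and \<open>j\<close> in the double sum and adding both
  expressions produces the Dirichlet energy of the graph.\<close>

lemma component_laplacian_quadratic_form:
  "2 * (\<Sum>i<n. v i * (\<Sum>j<n. laplacian_entry n E i j * v j)) =
    (\<Sum>i<n. \<Sum>j<n. adj E i j * (v i - v j)\<^sup>2)"
proof -
  have 1: "(\<Sum>i<n. v i * (\<Sum>j<n. laplacian_entry n E i j * v j)) =
      (\<Sum>i<n. \<Sum>j<n. adj E i j * (v i - v j) * v i)"
  proof (intro sum.cong refl)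
    fix i assume "i \<in> {..<n}"
    then show "v i * (\<Sum>j<n. laplacian_entry n E i j * v j) = (\<Sum>j<n. adj E i j * (v i - v j) * v i)"
      by (subst laplacian_sum) (auto simp: sum_distrib_left mult_ac)
  qed
  also have "\<dots> = (\<Sum>j<n. \<Sum>i<n. adj E i j * (v i - v j) * v i)" by (rule sum.swap)
  also have "\<dots> = (\<Sum>i<n. \<Sum>j<n. adj E i j * (v j - v i) * v j)"
    using component_adj_sym by (intro sum.cong refl) auto
  finally have 2: "(\<Sum>i<n. v i * (\<Sum>j<n. laplacian_entry n E i j * v j)) =
      (\<Sum>i<n. \<Sum>j<n. adj E i j * (v j - v i) * v j)" .
  have "2 * (\<Sum>i<n. v i * (\<Sum>j<n. laplacian_entry n E i j * v j)) =
      (\<Sum>i<n. \<Sum>j<n. adj E i j * (v i - v j) * v i) + (\<Sum>i<n. \<Sum>j<n. adj E i j * (v j - v i) * v j)"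
    using 1 2 by simp
  also have "\<dots> = (\<Sum>i<n. \<Sum>j<n. adj E i j * (v i - v j)\<^sup>2)"
    unfolding sum.distrib[symmetric]
    by (intro sum.cong refl) (simp add: power2_eq_square algebra_simps)
  finally show ?thesis .
qed

lemma component_laplacian_nonneg: "0 \<le> (\<Sum>i<n. v i * (\<Sum>j<n. laplacian_entry n E i j * v j))"
proof -
  have "0 \<le> (\<Sum>i<n. \<Sum>j<n. adj E i j * (v i - v j)\<^sup>2)"
    by (intro sum_nonneg) (auto simp: adj_def)
  then show ?thesis using component_laplacian_quadratic_form[of v] by linarith
qed

text \<open>Vanishing Dirichlet energy forces equal values along every edge, hence along every
  path.\<close>

lemma component_laplacian_kernel_const:
  assumes v: "\<And>i. i < n \<Longrightarrow> (\<Sum>j<n. laplacian_entry n E i j * v j) = 0"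
    and ij: "i < n" "j < n" "\<gamma> i = \<gamma> j"
  shows "v i = v j"
proof -
  have "(\<Sum>i<n. \<Sum>j<n. adj E i j * (v i - v j)\<^sup>2) = 0"
    using component_laplacian_quadratic_form[of v] v by simp
  then have "\<forall>i\<in>{..<n}. (\<Sum>j<n. adj E i j * (v i - v j)\<^sup>2) = 0"
    by (subst (asm) sum_nonneg_eq_0_iff) (auto intro!: sum_nonneg simp: adj_def)
  then have "adj E u w * (v u - v w)\<^sup>2 = 0" if "u < n" "w < n" for u w
    using that sum_nonneg_eq_0_iff[of "{..<n}" "\<lambda>w. adj E u w * (v u - v w)\<^sup>2"]
    by (auto simp: adj_def)
  then have edge: "v u = v w" if "u < n \<and> w < n \<and> E u w" for u w
    using that by (fastforce simp: adj_def)
  have "(\<lambda>u v. u < n \<and> v < n \<and> E u v)\<^sup>*\<^sup>* i j" using graph ij by (auto simp: component_graph_def)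
  then show ?thesis by (induction rule: rtranclp_induct) (use edge in auto)
qed

subsection \<open>One layer\<close>

text \<open>Adding a multiple \<open>c\<close> of the projection onto the group-wise constant vectors does not change
  the dynamics of the deviations from the group averages, and moves the eigenvalue 0 of the weighted
  Laplacian to \<open>c > 0\<close>.\<close>

lemma layer_decay:
  fixes a :: "nat \<Rightarrow> real" and x g :: "nat \<Rightarrow> real \<Rightarrow> real" and r :: "nat \<Rightarrow> real \<Rightarrow> real"
  assumes pos: "\<And>i. i < n \<Longrightarrow> 0 < a i"
    and h: "h \<ge> 0"
    and eigen: "\<And>\<mu> v. \<lbrakk>\<exists>i<n. v i \<noteq> 0; \<forall>i<n. (\<Sum>j<n. laplacian_entry n E i j * v j) = \<mu> * a i * v i\<rbrakk>
        \<Longrightarrow> \<mu> * h < pi / 2"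
    and x: "\<And>t i. \<lbrakk>t \<ge> T; i < n\<rbrakk> \<Longrightarrow> (x i has_real_derivative
        - (\<Sum>j<n. laplacian_entry n E i j * (x j (t - h) + g j t)) / a i - r (\<gamma> i) t) (at t)"
    and g: "\<And>i. i < n \<Longrightarrow> sq_integrable_tail (g i)"
  defines "m \<equiv> \<lambda>p t. (\<Sum>i | i < n \<and> \<gamma> i = p. a i * x i t) / (\<Sum>i | i < n \<and> \<gamma> i = p. a i)"
  shows "\<And>i t. \<lbrakk>i < n; t \<ge> T\<rbrakk> \<Longrightarrow> (m (\<gamma> i) has_real_derivative - r (\<gamma> i) t) (at t)"
    and "\<And>i. i < n \<Longrightarrow> sq_integrable_tail (\<lambda>t. x i t - m (\<gamma> i) t)"
    and "\<And>i. i < n \<Longrightarrow> ((\<lambda>t. x i t - m (\<gamma> i) t) \<longlongrightarrow> 0) at_top"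
proof -
  let ?L = "laplacian_entry n E"
  define w where "w p = (\<Sum>i | i < n \<and> \<gamma> i = p. a i)" for p
  have w: "w (\<gamma> i) > 0" if "i < n" for i
    unfolding w_def using that pos by (intro sum_pos) auto
  define d where "d i t = x i t - m (\<gamma> i) t" for i t
  \<comment> \<open>A positive \<open>c\<close> with \<open>c * h < pi / 2\<close> is wanted; this
    choice gives \<open>c * h < 1\<close>, also for \<open>h = 0\<close>.\<close>
  define c where "c = 1 / (1 + h)"
  have c: "c > 0" "c * h < pi / 2"
  proof -
    show "c > 0" using h by (simp add: c_def)
    have "c * h < 1" using h by (simp add: c_def)
    then show "c * h < pi / 2" using pi_half_gt_zero pi_gt3 by linarith
  qed
  have grp: "(\<Sum>i | i < n \<and> \<gamma> i = p. f i) = (\<Sum>i<n. if \<gamma> i = p then f i else 0)" for p and f :: "nat \<Rightarrow> real"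
    by (simp add: sum.If_cases Int_def)
  have L0: "(\<Sum>i | i < n \<and> \<gamma> i = p. \<Sum>j<n. ?L i j * u j) = 0" for p u
    by (subst sum.swap) (simp add: component_laplacian_group_sum flip: sum_distrib_right)
  have m': "(m (\<gamma> i) has_real_derivative - r (\<gamma> i) t) (at t)" if "i < n" "t \<ge> T" for i t
  proof -
    let ?p = "\<gamma> i"
    have "(m ?p has_real_derivative (\<Sum>i | i < n \<and> \<gamma> i = ?p. a i *
        (- (\<Sum>j<n. ?L i j * (x j (t - h) + g j t)) / a i - r (\<gamma> i) t)) / w ?p) (at t)"
      unfolding m_def w_def by (intro DERIV_cdivide DERIV_sum DERIV_cmult x that) auto
    also have "(\<Sum>i | i < n \<and> \<gamma> i = ?p. a i *
        (- (\<Sum>j<n. ?L i j * (x j (t - h) + g j t)) / a i - r (\<gamma> i) t)) =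
        (\<Sum>i | i < n \<and> \<gamma> i = ?p. - (\<Sum>j<n. ?L i j * (x j (t - h) + g j t)) - a i * r ?p t)"
      using pos by (intro sum.cong refl) (force simp: right_diff_distrib)
    also have "\<dots> = - w ?p * r ?p t"
      unfolding sum_subtractf sum_negf L0 by (simp add: w_def sum_distrib_right)
    finally show ?thesis using w[OF that(1)] by simp
  qed
  then show "\<And>i t. \<lbrakk>i < n; t \<ge> T\<rbrakk> \<Longrightarrow> (m (\<gamma> i) has_real_derivative - r (\<gamma> i) t) (at t)" .
  define M where "M i j = ?L i j / a i + c * (if \<gamma> i = \<gamma> j then a j / w (\<gamma> i) else 0)" for i j
  have Msum: "(\<Sum>j<n. M i j * v j) = (\<Sum>j<n. ?L i j * v j) / a i +
      c * ((\<Sum>j | j < n \<and> \<gamma> j = \<gamma> i. a j * v j) / w (\<gamma> i))" for i v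
  proof -
    have "(\<Sum>j<n. M i j * v j) = (\<Sum>j<n. ?L i j * v j / a i +
        c * ((if \<gamma> j = \<gamma> i then a j * v j else 0) / w (\<gamma> i)))"
      by (intro sum.cong refl) (auto simp: M_def distrib_right)
    also have "\<dots> = (\<Sum>j<n. ?L i j * v j) / a i +
        c * ((\<Sum>j<n. if \<gamma> j = \<gamma> i then a j * v j else 0) / w (\<gamma> i))"
      by (simp add: sum.distrib sum_distrib_left sum_divide_distrib)
    finally show ?thesis unfolding grp .
  qed
  have Msym: "a i * M i j = a j * M j i" if "i < n" "j < n" for i j
    using component_laplacian_sym[OF that] pos[OF that(1)] pos[OF that(2)]
    by (auto simp: M_def field_simps)
  have dsum: "(\<Sum>j | j < n \<and> \<gamma> j = \<gamma> i. a j * d j t) = 0" if "i < n" for i t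
  proof -
    have "(\<Sum>j | j < n \<and> \<gamma> j = \<gamma> i. a j * d j t) =
        (\<Sum>j | j < n \<and> \<gamma> j = \<gamma> i. a j * x j t - a j * m (\<gamma> i) t)"
      by (intro sum.cong refl) (auto simp: d_def right_diff_distrib)
    also have "\<dots> = (\<Sum>j | j < n \<and> \<gamma> j = \<gamma> i. a j * x j t) - w (\<gamma> i) * m (\<gamma> i) t"
      by (simp add: sum_subtractf w_def sum_distrib_right)
    also have "\<dots> = 0" using w[OF that] by (simp add: m_def w_def)
    finally show ?thesis .
  qed
  define f where "f i t = - (\<Sum>j<n. ?L i j / a i * g j t)" for i t
  have f: "sq_integrable_tail (f i)" if "i < n" for i
  proof -
    have "sq_integrable_tail (\<lambda>t. (- 1) * (\<Sum>j<n. ?L i j / a i * g j t))"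
      by (intro sq_integrable_tail_cmult sq_integrable_tail_sum g) auto
    then show ?thesis by (simp add: f_def[abs_def])
  qed
  have d': "(d i has_real_derivative - (\<Sum>j<n. M i j * d j (t - h)) + f i t) (at t)"
    if "t \<ge> T" "i < n" for t i
  proof -
    have "(d i has_real_derivative
        - (\<Sum>j<n. ?L i j * (x j (t - h) + g j t)) / a i - r (\<gamma> i) t - - r (\<gamma> i) t) (at t)"
      unfolding d_def[abs_def] by (intro DERIV_diff x m' that)
    moreover have "(\<Sum>j<n. ?L i j * (x j (t - h) + g j t)) / a i =
        (\<Sum>j<n. ?L i j * x j (t - h)) / a i - f i t"
      by (simp add: f_def distrib_left sum.distrib sum_divide_distrib add_divide_distrib)
    moreover have "(\<Sum>j<n. ?L i j * x j (t - h)) = (\<Sum>j<n. ?L i j * d j (t - h))"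
      using component_laplacian_kernel[OF that(2), of "\<lambda>p. m p (t - h)"]
      by (simp add: d_def right_diff_distrib sum_subtractf)
    moreover have "(\<Sum>j<n. M i j * d j (t - h)) = (\<Sum>j<n. ?L i j * d j (t - h)) / a i"
      unfolding Msum dsum[OF that(2)] by simp
    ultimately show ?thesis by simp
  qed
  have Meigen: "0 < \<mu> \<and> \<mu> * h < pi / 2"
    if v: "\<exists>i<n. v i \<noteq> 0" "\<forall>i<n. (\<Sum>j<n. M i j * v j) = \<mu> * v i" for \<mu> v
  proof -
    define s where "s p = (\<Sum>j | j < n \<and> \<gamma> j = p. a j * v j)" for p
    have Lv: "(\<Sum>j<n. ?L i j * v j) + c * a i * (s (\<gamma> i) / w (\<gamma> i)) = \<mu> * a i * v i" if "i < n" for i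
      using v(2)[rule_format, OF that] pos[OF that] unfolding Msum s_def[symmetric]
      by (simp add: field_simps)
    \<comment> \<open>Summation over a group removes the Laplacian part of the eigenvalue equation.
      Hence either \<open>\<mu> = c\<close>, or all weighted group sums of \<open>v\<close> vanish
      and \<open>v\<close> is an eigenvector of the weighted Laplacian itself.\<close>
    have cs: "c * s (\<gamma> i) = \<mu> * s (\<gamma> i)" if "i < n" for i
    proof -
      let ?p = "\<gamma> i"
      have "(\<Sum>j | j < n \<and> \<gamma> j = ?p. \<Sum>l<n. ?L j l * v l) +
          (\<Sum>j | j < n \<and> \<gamma> j = ?p. c * a j * (s ?p / w ?p)) = (\<Sum>j | j < n \<and> \<gamma> j = ?p. \<mu> * a j * v j)"
        unfolding sum.distrib[symmetric]
      proof (intro sum.cong refl)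
        fix j assume "j \<in> {j. j < n \<and> \<gamma> j = ?p}"
        then show "(\<Sum>l<n. ?L j l * v l) + c * a j * (s ?p / w ?p) = \<mu> * a j * v j"
          using Lv[of j] by simp
      qed
      also have "(\<Sum>j | j < n \<and> \<gamma> j = ?p. c * a j * (s ?p / w ?p)) = c * (s ?p / w ?p) * w ?p"
        by (simp add: w_def sum_distrib_left mult_ac sum_divide_distrib)
      also have "\<dots> = c * s ?p" using w[OF that] by simp
      finally show ?thesis unfolding L0 by (simp add: s_def sum_distrib_left mult.assoc)
    qed
    show ?thesis
    proof (cases "\<exists>i<n. s (\<gamma> i) \<noteq> 0")
      case True
      then have "\<mu> = c" using cs by auto
      then show ?thesis using c by simp
    next
      case False
      then have ev: "(\<Sum>j<n. ?L i j * v j) = \<mu> * a i * v i" if "i < n" for i using Lv[OF that] that by auto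
      \<comment> \<open>Nonnegativity of the energy leaves only \<open>\<mu> = 0\<close> to exclude.
        Then \<open>v\<close> would be constant on each group, and vanishing weighted group sums
        would make it zero.\<close>
      have "\<mu> > 0"
      proof (rule ccontr)
        assume "\<not> \<mu> > 0"
        have "0 \<le> (\<Sum>i<n. v i * (\<Sum>j<n. ?L i j * v j))" by (rule component_laplacian_nonneg)
        also have "\<dots> = \<mu> * (\<Sum>i<n. a i * (v i)\<^sup>2)"
          unfolding sum_distrib_left[of \<mu>]
          by (intro sum.cong refl) (use ev in \<open>simp add: power2_eq_square\<close>)
        finally have q: "0 \<le> \<mu> * (\<Sum>i<n. a i * (v i)\<^sup>2)" .
        obtain i0 where i0: "i0 < n" "v i0 \<noteq> 0" using v(1) by auto
        have "0 < a i0 * (v i0)\<^sup>2" using i0 pos by simp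
        also have "\<dots> \<le> (\<Sum>i<n. a i * (v i)\<^sup>2)"
          by (rule member_le_sum) (use i0 pos in \<open>auto intro!: mult_nonneg_nonneg simp: less_imp_le\<close>)
        finally have "\<mu> = 0" using q \<open>\<not> \<mu> > 0\<close> by (simp add: zero_le_mult_iff)
        then have "v j = v i0" if "j < n" "\<gamma> j = \<gamma> i0" for j
          using component_laplacian_kernel_const[of v j i0] ev that i0 by simp
        then have "s (\<gamma> i0) = (\<Sum>j | j < n \<and> \<gamma> j = \<gamma> i0. a j * v i0)"
          unfolding s_def by (intro sum.cong refl) auto
        also have "\<dots> = w (\<gamma> i0) * v i0" by (simp add: w_def sum_distrib_right)
        finally show False using False i0 w[OF i0(1)] by auto
      qed
      then show ?thesis using eigen[OF v(1), of \<mu>] ev by blast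
    qed
  qed
  have "sq_integrable_tail (d i)" "(d i \<longlongrightarrow> 0) at_top" if "i < n" for i
    by (rule DDE_system_stable[where n = n and a = a and M = M and h = h and T = T and f = f];
        use pos Msym h Meigen d' f that in blast)+
  then show "sq_integrable_tail (\<lambda>t. x i t - m (\<gamma> i) t)" "((\<lambda>t. x i t - m (\<gamma> i) t) \<longlongrightarrow> 0) at_top"
    if "i < n" for i
    using that by (simp_all add: d_def[abs_def])
qed

end

subsection \<open>Consecutive groups\<close>

definition grp_of :: "(nat \<Rightarrow> nat) \<Rightarrow> nat \<Rightarrow> nat" where
  "grp_of k i = (LEAST p. i < grp_off k (Suc p))"

definition block_graph :: "(nat \<Rightarrow> nat) \<Rightarrow> (nat \<Rightarrow> nat \<Rightarrow> nat \<Rightarrow> bool) \<Rightarrow> nat \<Rightarrow> nat \<Rightarrow> bool" where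
  "block_graph k G i j \<longleftrightarrow> grp_of k i = grp_of k j \<and>
     G (grp_of k i) (i - grp_off k (grp_of k i)) (j - grp_off k (grp_of k i))"

lemma grp_off_mono: "p \<le> q \<Longrightarrow> grp_off k p \<le> grp_off k q"
  unfolding grp_off_def by (intro sum_mono2) auto

lemma mult_mat_vec_index_sum:
  assumes "A \<in> carrier_mat n m" "v \<in> carrier_vec m" "i < n"
  shows "vec_index (A *\<^sub>v v) i = (\<Sum>j<m. A $$ (i, j) * vec_index v j)"
  using assms by (simp add: scalar_prod_def lessThan_atLeast0)

lemma K_mat_mult_index:
  assumes "A \<in> carrier_mat n m" "i < n" "j < m"
  shows "(K_mat n a * A) $$ (i, j) = A $$ (i, j) / a i"
proof -
  have "(K_mat n a * A) $$ (i, j) = (\<Sum>l<n. (if i = l then inverse (a i) else 0) * A $$ (l, j))"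
    using assms by (simp add: K_mat_def scalar_prod_def lessThan_atLeast0)
  also have "\<dots> = (\<Sum>l<n. if i = l then inverse (a i) * A $$ (l, j) else 0)"
    by (intro sum.cong refl) auto
  also have "\<dots> = A $$ (i, j) / a i" using assms by (simp add: divide_inverse mult.commute)
  finally show ?thesis .
qed

context
  fixes n ng :: nat and k :: "nat \<Rightarrow> nat"
  assumes part: "partition_sizes n ng k"
begin

lemma grp_of_less:
  assumes "i < n"
  shows "grp_of k i < ng" and "i < grp_off k (Suc (grp_of k i))"
proof -
  have n: "grp_off k ng = n" using part by (simp add: partition_sizes_def grp_off_def)
  with assms have "ng \<noteq> 0" by (cases ng) (auto simp: grp_off_def)
  then have ex: "i < grp_off k (Suc (ng - 1))" using n assms by simp
  from Least_le[of "\<lambda>p. i < grp_off k (Suc p)", OF ex] \<open>ng \<noteq> 0\<close>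
  show "grp_of k i < ng" unfolding grp_of_def by linarith
  from LeastI[of "\<lambda>p. i < grp_off k (Suc p)", OF ex]
  show "i < grp_off k (Suc (grp_of k i))" unfolding grp_of_def .
qed

lemma in_grp_iff:
  assumes "i < n"
  shows "in_grp k p i \<longleftrightarrow> grp_of k i = p"
proof
  assume p: "in_grp k p i"
  show "grp_of k i = p" unfolding grp_of_def
  proof (rule Least_equality)
    show "i < grp_off k (Suc p)" using p by (simp add: in_grp_def)
    fix q assume q: "i < grp_off k (Suc q)"
    show "p \<le> q"
    proof (rule ccontr)
      assume "\<not> p \<le> q"
      then have "grp_off k (Suc q) \<le> grp_off k p" by (intro grp_off_mono) simp
      then show False using q p by (simp add: in_grp_def)
    qed
  qed
next
  assume p: "grp_of k i = p"
  have "grp_off k p \<le> i"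
  proof (cases p)
    case (Suc q)
    then have "q < (LEAST p. i < grp_off k (Suc p))" using p by (simp add: grp_of_def)
    then show ?thesis using not_less_Least[of q "\<lambda>p. i < grp_off k (Suc p)"] Suc by simp
  qed (simp add: grp_off_def)
  then show "in_grp k p i" using grp_of_less(2)[OF assms] p by (simp add: in_grp_def)
qed

lemma grp_off_le: "i < n \<Longrightarrow> grp_off k (grp_of k i) \<le> i"
  using in_grp_iff by (auto simp: in_grp_def)

lemma grp_local_index_less: "i < n \<Longrightarrow> i - grp_off k (grp_of k i) < k (grp_of k i)"
  using grp_of_less(2)[of i] grp_off_le[of i] by (simp add: grp_off_def)

lemma grp_member:
  assumes "p < ng" "u < k p"
  shows "grp_off k p + u < n" and "grp_of k (grp_off k p + u) = p"
proof -
  have "grp_off k p + u < grp_off k (Suc p)" using assms by (simp add: grp_off_def)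
  also have "\<dots> \<le> grp_off k ng" using assms by (intro grp_off_mono) simp
  also have "\<dots> = n" using part by (simp add: partition_sizes_def grp_off_def)
  finally show *: "grp_off k p + u < n" .
  show "grp_of k (grp_off k p + u) = p"
    using in_grp_iff[OF *, of p] assms by (simp add: in_grp_def grp_off_def)
qed

lemma grp_nonempty:
  assumes "p < ng"
  shows "\<exists>i<n. grp_of k i = p"
proof -
  have "0 < k p" using part assms by (simp add: partition_sizes_def Suc_le_eq)
  then show ?thesis using grp_member[OF assms, of 0] by blast
qed

lemma sum_grp:
  fixes f :: "nat \<Rightarrow> 'b :: comm_monoid_add"
  assumes "p < ng"
  shows "(\<Sum>i | i < n \<and> grp_of k i = p. f i) = (\<Sum>u<k p. f (grp_off k p + u))"
proof (rule sum.reindex_bij_witness[of _ "\<lambda>u. grp_off k p + u" "\<lambda>i. i - grp_off k p"])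
  fix i assume "i \<in> {i. i < n \<and> grp_of k i = p}"
  then show "grp_off k p + (i - grp_off k p) = i" "i - grp_off k p \<in> {..<k p}"
    "f (grp_off k p + (i - grp_off k p)) = f i"
    using grp_off_le[of i] grp_local_index_less[of i] by auto
next
  fix u assume "u \<in> {..<k p}"
  then show "grp_off k p + u - grp_off k p = u" "grp_off k p + u \<in> {i. i < n \<and> grp_of k i = p}"
    using grp_member[OF assms, of u] by auto
qed

lemma sum_grp_indicator:
  fixes f :: "nat \<Rightarrow> real"
  shows "(\<Sum>i<n. (if grp_of k i = p then f i else 0)) = (\<Sum>i | i < n \<and> grp_of k i = p. f i)"
  by (simp add: sum.If_cases Int_def)

lemma agg_weights_eq: "p < ng \<Longrightarrow> agg_weights k a p = (\<Sum>i | i < n \<and> grp_of k i = p. a i)"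
  by (simp add: agg_weights_def sum_grp)

lemma agg_weights_pos:
  assumes "\<And>i. i < n \<Longrightarrow> 0 < a i" "p < ng"
  shows "0 < agg_weights k a p"
  unfolding agg_weights_eq[OF assms(2)]
  using assms(1) grp_nonempty[OF assms(2)] by (intro sum_pos) auto

lemma B_mat_index: "i < n \<Longrightarrow> p < ng \<Longrightarrow> B_mat n ng k $$ (i, p) = (if grp_of k i = p then 1 else 0)"
  by (simp add: B_mat_def in_grp_iff)

lemma B_mat_mult_vec:
  assumes "v \<in> carrier_vec ng" "i < n"
  shows "vec_index (B_mat n ng k *\<^sub>v v) i = vec_index v (grp_of k i)"
proof -
  have "vec_index (B_mat n ng k *\<^sub>v v) i = (\<Sum>p<ng. (if grp_of k i = p then 1 else 0) * vec_index v p)"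
    by (subst mult_mat_vec_index_sum[of _ n ng]) (use assms B_mat_index in \<open>auto simp: B_mat_def\<close>)
  also have "\<dots> = (\<Sum>p<ng. if grp_of k i = p then vec_index v p else 0)"
    by (intro sum.cong refl) auto
  also have "\<dots> = vec_index v (grp_of k i)" using grp_of_less(1)[OF assms(2)] by simp
  finally show ?thesis .
qed

lemma C_mat_index:
  "i < n \<Longrightarrow> p < ng \<Longrightarrow> C_mat n ng k c $$ (p, i) = (if grp_of k i = p then c p (i - grp_off k p) else 0)"
  by (simp add: C_mat_def in_grp_iff)

lemma C_mat_mult_vec:
  assumes "v \<in> carrier_vec n" "p < ng"
  shows "vec_index (C_mat n ng k c *\<^sub>v v) p = (\<Sum>u<k p. c p u * vec_index v (grp_off k p + u))"
proof -
  have "vec_index (C_mat n ng k c *\<^sub>v v) p =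
      (\<Sum>i<n. (if grp_of k i = p then c p (i - grp_off k p) else 0) * vec_index v i)"
    by (subst mult_mat_vec_index_sum[of _ ng n]) (use assms C_mat_index in \<open>auto simp: C_mat_def\<close>)
  also have "\<dots> = (\<Sum>i<n. if grp_of k i = p then c p (i - grp_off k p) * vec_index v i else 0)"
    by (intro sum.cong refl) auto
  also have "\<dots> = (\<Sum>u<k p. c p u * vec_index v (grp_off k p + u))"
    unfolding sum_grp_indicator sum_grp[OF assms(2)] by simp
  finally show ?thesis .
qed

text \<open>The block diagonal matrix is the Laplacian of one graph without edges between groups,
  because the degree of a node counts only neighbours in its own group. This brings layers 1 and 2
  into the scope of \<open>component_graph\<close>.\<close>

lemma block_laplacian_index:
  assumes ij: "i < n" "j < n"
  shows "block_laplacian n ng k G $$ (i, j) = laplacian_entry n (block_graph k G) i j"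
proof -
  define p where "p = grp_of k i"
  have p: "p < ng" using grp_of_less(1)[OF ij(1)] by (simp add: p_def)
  have "block_laplacian n ng k G $$ (i, j) = (\<Sum>q<ng. if p = q then
      (if grp_of k j = p then laplacian_entry (k p) (G p) (i - grp_off k p) (j - grp_off k p) else 0) else 0)"
    unfolding block_laplacian_def using ij by (auto simp: in_grp_iff p_def intro!: sum.cong)
  also have "\<dots> = (if grp_of k j = p then laplacian_entry (k p) (G p) (i - grp_off k p) (j - grp_off k p) else 0)"
    using p by simp
  also have "\<dots> = laplacian_entry n (block_graph k G) i j"
  proof (cases "i = j")
    case True
    have "(\<Sum>l<n. adj (block_graph k G) i l) =
        (\<Sum>l<n. if grp_of k l = p then adj (G p) (i - grp_off k p) (l - grp_off k p) else 0)"
      by (intro sum.cong refl) (auto simp: adj_def block_graph_def p_def)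
    also have "\<dots> = (\<Sum>u<k p. adj (G p) (i - grp_off k p) u)"
      unfolding sum_grp_indicator sum_grp[OF p] by simp
    finally show ?thesis using True by (simp add: laplacian_entry_def adj_def block_graph_def p_def)
  next
    case False
    \<comment> \<open>Truncated subtraction keeps distinct indices distinct here, as both lie above
      the offset of their group.\<close>
    then have "i - grp_off k p \<noteq> j - grp_off k p" if "grp_of k j = p"
      using grp_off_le[OF ij(1)] grp_off_le[OF ij(2)] that by (auto simp: p_def)
    then show ?thesis using False
      by (auto simp: laplacian_entry_def adj_def block_graph_def p_def)
  qed
  finally show ?thesis .
qed

lemma component_graph_block_graph:
  assumes "\<forall>p<ng. undirected_connected (k p) (G p)"
  shows "component_graph n (grp_of k) (block_graph k G)"
  unfolding component_graph_def
proof (intro conjI allI impI)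
  fix i j assume ij: "i < n" "j < n" "block_graph k G i j"
  then have "undirected_connected (k (grp_of k i)) (G (grp_of k i))"
    using assms grp_of_less(1) by blast
  then show "block_graph k G j i"
    using ij grp_local_index_less[OF ij(1)] grp_local_index_less[OF ij(2)]
    unfolding block_graph_def undirected_connected_def by auto
  show "grp_of k i = grp_of k j" using ij by (simp add: block_graph_def)
next
  fix i j assume ij: "i < n" "j < n" "grp_of k i = grp_of k j"
  define p where "p = grp_of k i"
  have p: "p < ng" using ij grp_of_less(1) by (auto simp: p_def)
  have conn: "(\<lambda>u v. u < k p \<and> v < k p \<and> G p u v)\<^sup>*\<^sup>* (i - grp_off k p) (j - grp_off k p)"
    using assms p grp_local_index_less[OF ij(1)] grp_local_index_less[OF ij(2)] ij(3)
    unfolding undirected_connected_def p_def by auto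
  have "(\<lambda>u v. u < n \<and> v < n \<and> block_graph k G u v)\<^sup>*\<^sup>* (grp_off k p + u) (grp_off k p + v)"
    if "(\<lambda>u v. u < k p \<and> v < k p \<and> G p u v)\<^sup>*\<^sup>* u v" for u v
    using that
  proof (induction rule: rtranclp_induct)
    case (step v w)
    then show ?case using grp_member[OF p]
      by (intro rtranclp.rtrancl_into_rtrancl[OF step.IH]) (auto simp: block_graph_def)
  qed simp
  from this[OF conn] show "(\<lambda>u v. u < n \<and> v < n \<and> block_graph k G u v)\<^sup>*\<^sup>* i j"
    using grp_off_le[OF ij(1)] grp_off_le[OF ij(2)] ij(3) by (simp add: p_def)
qed

end

lemma component_graph_connected:
  "undirected_connected n G \<Longrightarrow> component_graph n (\<lambda>_. 0) G"
  by (auto simp: undirected_connected_def component_graph_def)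

subsection \<open>Existence by the method of steps\<close>

text \<open>Zero history makes the delayed signal jump at \<open>h\<close>. Splitting there leaves
  the zero function up to one point, followed by a continuous piece.\<close>

lemma delayed_integrable:
  fixes f :: "real \<Rightarrow> real"
  assumes zero: "\<And>t. t < 0 \<Longrightarrow> f t = 0" and cont: "continuous_on {0..} f" and h: "h \<ge> 0"
  shows "(\<lambda>s. f (s - h)) integrable_on {0..b}"
proof -
  have 1: "(\<lambda>s. f (s - h)) integrable_on {0..h}"
    by (rule integrable_spike_finite[of "{h}" _ _ "\<lambda>_. 0"]) (use zero in auto)
  have 2: "(\<lambda>s. f (s - h)) integrable_on {h..max b h}"
    by (intro integrable_continuous_real continuous_on_compose2[OF cont]) (auto intro!: continuous_intros)
  have "(\<lambda>s. f (s - h)) integrable_on {0..max b h}"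
    using h 1 2 by (intro Henstock_Kurzweil_Integration.integrable_combine[of 0 h "max b h"]) auto
  then show ?thesis by (rule integrable_on_subinterval) auto
qed

lemma continuous_on_atLeastI:
  fixes f :: "real \<Rightarrow> real"
  assumes "\<And>b. continuous_on {a..b} f"
  shows "continuous_on {a..} f"
proof (clarsimp simp: continuous_on_eq_continuous_within)
  fix x assume x: "a \<le> x"
  have "at x within {a..} = at x within {a..x + 1}"
    by (rule at_within_nhd[of x "{x - 1<..<x + 1}"]) (use x in auto)
  moreover have "continuous (at x within {a..x + 1}) f"
    using assms[of "x + 1"] x by (simp add: continuous_on_eq_continuous_within)
  ultimately show "continuous (at x within {a..}) f" by simp
qed

text \<open>Picard iterates. With positive delays, each iterate at time \<open>t\<close> reads the
  previous one only up to \<open>t - min h1 h2\<close>, so on every bounded interval the sequence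
  becomes stationary and no convergence argument arises.\<close>

primrec dde_iter :: "nat \<Rightarrow> (nat \<Rightarrow> nat \<Rightarrow> real) \<Rightarrow> (nat \<Rightarrow> nat \<Rightarrow> real) \<Rightarrow> real \<Rightarrow> real \<Rightarrow> (nat \<Rightarrow> real)
    \<Rightarrow> nat \<Rightarrow> nat \<Rightarrow> real \<Rightarrow> real" where
  "dde_iter n A B h1 h2 w0 0 = (\<lambda>i t. if t < 0 then 0 else w0 i)"
| "dde_iter n A B h1 h2 w0 (Suc m) = (\<lambda>i t. if t < 0 then 0 else w0 i + integral {0..t}
     (\<lambda>s. \<Sum>j<n. A i j * dde_iter n A B h1 h2 w0 m j (s - h1) + B i j * dde_iter n A B h1 h2 w0 m j (s - h2)))"

text \<open>Two delayed terms cover both necessity arguments, since their initial states are chosen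
  such that the undelayed coupling of layer 1 vanishes.\<close>

lemma DDE_system_exists:
  fixes A B :: "nat \<Rightarrow> nat \<Rightarrow> real" and w0 :: "nat \<Rightarrow> real"
  assumes h: "h1 > 0" "h2 > 0"
  obtains w :: "nat \<Rightarrow> real \<Rightarrow> real" where
    "\<And>i t. t < 0 \<Longrightarrow> w i t = 0" "\<And>i. w i 0 = w0 i"
    "\<And>i. continuous_on {0..} (w i)"
    "\<And>i t. t \<ge> 0 \<Longrightarrow>
      ((\<lambda>s. \<Sum>j<n. A i j * w j (s - h1) + B i j * w j (s - h2)) has_integral (w i t - w0 i)) {0..t}"
proof -
  define W where "W = dde_iter n A B h1 h2 w0"
  define \<delta> where "\<delta> = min h1 h2"
  have \<delta>: "\<delta> > 0" "\<delta> \<le> h1" "\<delta> \<le> h2" using h by (auto simp: \<delta>_def)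
  have W0: "W m i t = 0" if "t < 0" for m i t
    using that by (cases m) (auto simp: W_def)
  have WSuc: "W (Suc m) i t = w0 i + integral {0..t}
      (\<lambda>s. \<Sum>j<n. A i j * W m j (s - h1) + B i j * W m j (s - h2))" if "t \<ge> 0" for m i t
    using that by (simp add: W_def)
  have stab: "W (Suc m) i t = W m i t" if "t < \<delta> * real m" for m i t
    using that
  proof (induction m arbitrary: i t)
    case 0
    then show ?case by (simp add: W0)
  next
    case (Suc m)
    show ?case
    proof (cases "t < 0")
      case False
      have eq: "W (Suc m) j (s - h') = W m j (s - h')" if "s \<in> {0..t}" "\<delta> \<le> h'" for j s h'
        by (rule Suc.IH) (use that Suc.prems in \<open>auto simp: algebra_simps\<close>)
      show ?thesis using False unfolding WSuc[OF leI[OF False]]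
        by (intro arg_cong2[of _ _ _ _ "(+)"] refl integral_cong sum.cong) (simp_all add: eq \<delta>)
    qed (simp add: W0)
  qed
  have stab': "W p i t = W m i t" if "m \<le> p" "t < \<delta> * real m" for m p i t
    using that
  proof (induction p rule: dec_induct)
    case (step q)
    have "\<delta> * real m \<le> \<delta> * real q" using step.hyps \<delta> by simp
    then have "W (Suc q) i t = W q i t" using step.prems by (intro stab) linarith
    then show ?case using step by simp
  qed simp
  have Wcont: "continuous_on {0..} (W m i)" for m i
  proof (induction m arbitrary: i)
    case 0
    have "continuous_on {0..} (\<lambda>t::real. w0 i)" by simp
    then show ?case by (rule continuous_on_eq) (simp add: W_def)
  next
    case (Suc m)
    show ?case
    proof (rule continuous_on_atLeastI)
      fix b :: real
      have "(\<lambda>s. \<Sum>j<n. A i j * W m j (s - h1) + B i j * W m j (s - h2)) integrable_on {0..b}"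
        using h by (intro integrable_sum integrable_add delayed_integrable)
          (auto simp: W0 intro!: continuous_intros Suc)
      from indefinite_integral_continuous_1[OF this]
      have "continuous_on {0..b} (\<lambda>t. w0 i + integral {0..t}
          (\<lambda>s. \<Sum>j<n. A i j * W m j (s - h1) + B i j * W m j (s - h2)))"
        by (intro continuous_intros)
      then show "continuous_on {0..b} (W (Suc m) i)"
        by (rule continuous_on_eq) (simp add: WSuc)
    qed
  qed
  \<comment> \<open>The added 1 makes \<open>t < \<delta> * real (N t)\<close> strict, the range in
    which iterate number \<open>N t\<close> is already final.\<close>
  define N where "N t = nat \<lceil>t / \<delta>\<rceil> + 1" for t
  define w where "w i t = W (N t) i t" for i t
  have N: "t < \<delta> * real (N t)" for t
  proof -
    have "t / \<delta> < real (N t)" unfolding N_def by linarith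
    then show ?thesis using \<delta> by (simp add: field_simps)
  qed
  have w: "w i t = W m i t" if "t < \<delta> * real m" for i t m
    using stab'[of m "N t" t i] stab'[of "N t" m t i] N[of t] that unfolding w_def
    by (cases "m \<le> N t") auto
  have "w i t = 0" if "t < 0" for i t using that by (simp add: w_def W0)
  moreover have "w i 0 = w0 i" for i
    using w[of 0 1 i] \<delta> WSuc[of 0 0 i] by simp
  moreover have "continuous_on {0..} (w i)" for i
  proof (rule continuous_on_atLeastI)
    fix b :: real
    have "continuous_on {0..b} (W (N b) i)" by (rule continuous_on_subset[OF Wcont]) auto
    then show "continuous_on {0..b} (w i)"
      by (rule continuous_on_eq) (use w[of _ "N b"] N[of b] in auto)
  qed
  moreover have "((\<lambda>s. \<Sum>j<n. A i j * w j (s - h1) + B i j * w j (s - h2)) has_integral (w i t - w0 i)) {0..t}"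
    if t: "t \<ge> 0" for i t
  proof -
    have "(\<lambda>s. \<Sum>j<n. A i j * W (N t) j (s - h1) + B i j * W (N t) j (s - h2)) integrable_on {0..t}"
      using h by (intro integrable_sum integrable_add delayed_integrable)
        (auto simp: W0 intro!: continuous_intros Wcont)
    then have I: "((\<lambda>s. \<Sum>j<n. A i j * W (N t) j (s - h1) + B i j * W (N t) j (s - h2)) has_integral
        (W (Suc (N t)) i t - w0 i)) {0..t}"
      unfolding WSuc[OF t] by (simp add: integrable_integral)
    have e1: "W (Suc (N t)) i t = w i t" using stab[OF N] by (simp add: w_def)
    have e2: "(\<Sum>j<n. A i j * W (N t) j (s - h1) + B i j * W (N t) j (s - h2)) =
        (\<Sum>j<n. A i j * w j (s - h1) + B i j * w j (s - h2))" if "s \<in> {0..t}" for s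
    proof -
      have "w j (s - h1) = W (N t) j (s - h1)" "w j (s - h2) = W (N t) j (s - h2)" for j
        using that N[of t] h by (intro w; auto)+
      then show ?thesis by simp
    qed
    show ?thesis using has_integral_eq[OF e2 I] unfolding e1 .
  qed
  ultimately show ?thesis by (rule that)
qed

subsection \<open>Unstable modes\<close>

lemma integral_equation_continuous:
  fixes g :: "real \<Rightarrow> real"
  assumes eq: "\<And>t. t \<ge> 0 \<Longrightarrow> (g has_integral (F t - F0)) {0..t}"
  shows "continuous_on {0..} F"
proof (rule continuous_on_atLeastI)
  fix b :: real
  show "continuous_on {0..b} F"
  proof (cases "b \<ge> 0")
    case True
    have "g integrable_on {0..b}" using eq[OF True] by blast
    then have "continuous_on {0..b} (\<lambda>t. F0 + integral {0..t} g)"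
      by (intro continuous_intros indefinite_integral_continuous_1)
    then show ?thesis
      by (rule continuous_on_eq) (use integral_unique[OF eq] in auto)
  qed simp
qed

text \<open>The integrand may jump before \<open>c\<close>, where delayed arguments are still
  crossing 0. Past \<open>c\<close> the integral equation becomes a classical differential
  equation.\<close>

lemma integral_equation_derivative:
  fixes g :: "real \<Rightarrow> real"
  assumes eq: "\<And>t. t \<ge> 0 \<Longrightarrow> (g has_integral (F t - F0)) {0..t}"
    and g: "continuous_on {c..} g" and c: "c \<ge> 0" "t > c"
  shows "(F has_real_derivative g t) (at t)"
proof -
  have "((\<lambda>x. integral {c..x} g) has_real_derivative g t) (at t within {c..t + 1})"
    using c by (intro integral_has_real_derivative continuous_on_subset[OF g]) auto
  moreover have "at t within {c..t + 1} = at t" using c by (intro at_within_interior) auto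
  ultimately have D: "((\<lambda>x. F c + integral {c..x} g) has_real_derivative g t) (at t)"
    by (auto intro!: derivative_eq_intros)
  show ?thesis
  proof (rule has_field_derivative_transform_within_open[OF D, of "{c<..}"])
    fix x assume x: "x \<in> {c<..}"
    have gi: "g integrable_on {0..x}" using eq[of x] x c by auto
    have "integral {0..c} g + integral {c..x} g = integral {0..x} g"
      using x c gi by (intro Henstock_Kurzweil_Integration.integral_combine) auto
    then show "F c + integral {c..x} g = F x"
      using integral_unique[OF eq[of c]] integral_unique[OF eq[of x]] x c by simp
  qed (use c in auto)
qed

text \<open>Weighting by \<open>a\<close> turns the right eigenvector \<open>v\<close> into a left
  one, so the sum \<open>z\<close> of \<open>a i * v i * w i\<close> obeys a scalar delay equation.
  Terms constant on groups, the input \<open>H\<close> as well as the common limit \<open>K\<close>,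
  are annihilated. Starting at \<open>v\<close> makes \<open>z0\<close> the weighted square norm of
  \<open>v\<close>, which is positive.\<close>

lemma unstable_mode:
  fixes a v :: "nat \<Rightarrow> real" and w H :: "nat \<Rightarrow> real \<Rightarrow> real"
  assumes graph: "component_graph n \<gamma> E"
    and pos: "\<And>i. i < n \<Longrightarrow> 0 < a i"
    and h: "h > 0" and lh: "l * h \<ge> pi / 2"
    and v: "\<exists>i<n. v i \<noteq> 0" "\<And>i. i < n \<Longrightarrow> (\<Sum>j<n. laplacian_entry n E i j * v j) = l * a i * v i"
    and zero: "\<And>i t. t < 0 \<Longrightarrow> w i t = 0"
    and cont: "\<And>i. continuous_on {0..} (w i)"
    and int: "\<And>i t. \<lbrakk>i < n; t \<ge> 0\<rbrakk> \<Longrightarrow> ((\<lambda>s. - (\<Sum>j<n. laplacian_entry n E i j * w j (s - h)) / a i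
        + H (\<gamma> i) s) has_integral (w i t - v i)) {0..t}"
    and lim: "\<And>i. i < n \<Longrightarrow> (w i \<longlongrightarrow> K) at_top"
  shows False
proof -
  let ?L = "laplacian_entry n E"
  have l: "l \<noteq> 0"
  proof
    assume "l = 0"
    then show False using lh pi_half_gt_zero by simp
  qed
  \<comment> \<open>Eigenvectors for nonzero \<open>l\<close> are orthogonal, in the weighted sense,
    to the kernel of the Laplacian, which contains the group indicators.\<close>
  have grp0: "(\<Sum>i | i < n \<and> \<gamma> i = p. a i * v i) = 0" for p
  proof -
    have "l * (\<Sum>i | i < n \<and> \<gamma> i = p. a i * v i) = (\<Sum>i | i < n \<and> \<gamma> i = p. \<Sum>j<n. ?L i j * v j)"
      by (simp add: sum_distrib_left v(2) mult.assoc)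
    also have "\<dots> = 0"
      by (subst sum.swap) (simp add: component_laplacian_group_sum[OF graph] flip: sum_distrib_right)
    finally show ?thesis using l by simp
  qed
  have av_group: "(\<Sum>i<n. a i * v i * f (\<gamma> i)) = 0" for f
  proof -
    have "(\<Sum>i<n. a i * v i * f (\<gamma> i)) = (\<Sum>p\<in>\<gamma> ` {..<n}. \<Sum>i\<in>{i \<in> {..<n}. \<gamma> i = p}. a i * v i * f (\<gamma> i))"
      by (rule sum.image_gen) simp
    also have "\<dots> = (\<Sum>p\<in>\<gamma> ` {..<n}. (\<Sum>i | i < n \<and> \<gamma> i = p. a i * v i) * f p)"
      by (simp add: sum_distrib_right)
    finally show ?thesis by (simp add: grp0)
  qed
  define z where "z t = (\<Sum>i<n. a i * v i * w i t)" for t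
  define z0 where "z0 = (\<Sum>i<n. a i * v i * v i)"
  have z_int: "((\<lambda>s. - l * z (s - h)) has_integral (z t - z0)) {0..t}" if "t \<ge> 0" for t
  proof -
    have "((\<lambda>s. \<Sum>i<n. a i * v i * (- (\<Sum>j<n. ?L i j * w j (s - h)) / a i + H (\<gamma> i) s))
        has_integral (\<Sum>i<n. a i * v i * (w i t - v i))) {0..t}"
      by (intro has_integral_sum has_integral_mult_right int that) auto
    moreover have "(\<Sum>i<n. a i * v i * (w i t - v i)) = z t - z0"
      by (simp add: z_def z0_def right_diff_distrib sum_subtractf)
    moreover have "(\<Sum>i<n. a i * v i * (- (\<Sum>j<n. ?L i j * w j (s - h)) / a i + H (\<gamma> i) s)) = - l * z (s - h)" for s
    proof -
      have "(\<Sum>i<n. a i * v i * (- (\<Sum>j<n. ?L i j * w j (s - h)) / a i + H (\<gamma> i) s)) =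
          (\<Sum>i<n. - (\<Sum>j<n. v i * ?L i j * w j (s - h)) + a i * v i * H (\<gamma> i) s)"
      proof (intro sum.cong refl)
        fix i assume "i \<in> {..<n}"
        then have "a i > 0" using pos by simp
        then have "a i * v i * (- (\<Sum>j<n. ?L i j * w j (s - h)) / a i + H (\<gamma> i) s) =
          - (v i * (\<Sum>j<n. ?L i j * w j (s - h))) + a i * v i * H (\<gamma> i) s"
          by (simp add: field_simps)
        then show "a i * v i * (- (\<Sum>j<n. ?L i j * w j (s - h)) / a i + H (\<gamma> i) s) =
          - (\<Sum>j<n. v i * ?L i j * w j (s - h)) + a i * v i * H (\<gamma> i) s"
          by (simp only: sum_distrib_left mult.assoc)
      qed
      also have "\<dots> = - (\<Sum>i<n. \<Sum>j<n. v i * ?L i j * w j (s - h))"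
        using av_group[of "\<lambda>p. H p s"] by (simp add: sum.distrib sum_negf sum_subtractf)
      also have "(\<Sum>i<n. \<Sum>j<n. v i * ?L i j * w j (s - h)) = (\<Sum>j<n. (\<Sum>i<n. ?L j i * v i) * w j (s - h))"
        unfolding sum_distrib_right
        by (subst sum.swap, intro sum.cong refl) (auto simp: component_laplacian_sym[OF graph])
      also have "\<dots> = l * z (s - h)"
        by (simp add: v(2) z_def sum_distrib_left mult.assoc)
      finally show ?thesis by simp
    qed
    ultimately show ?thesis by simp
  qed
  have z_neg: "z t = 0" if "t < 0" for t using that by (simp add: z_def zero)
  have z_cont: "continuous_on {0..} z" unfolding z_def[abs_def] by (intro continuous_intros cont)
  have "z0 = 0"
  proof (rule DDE_unstable[OF h lh _ z_cont])
    fix t assume t: "0 \<le> t" "t \<le> h"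
    \<comment> \<open>On \<open>[0, h]\<close> the delayed argument is negative except at the single
      point \<open>h\<close>, so zero history holds \<open>z\<close> at its initial value.\<close>
    have "((\<lambda>s. - l * z (s - h)) has_integral 0) {0..t}"
      by (rule has_integral_spike_finite[of "{h}" _ _ "\<lambda>_. 0"]) (use t z_neg in auto)
    from has_integral_unique[OF z_int[OF t(1)] this] show "z t = z0" by simp
  next
    fix t assume t: "t > h"
    have "continuous_on {h..} (\<lambda>s. - l * z (s - h))"
      by (intro continuous_intros continuous_on_compose2[OF z_cont]) auto
    from integral_equation_derivative[OF z_int this _ t]
    show "(z has_real_derivative - l * z (t - h)) (at t)" using h by simp
  next
    have "(z \<longlongrightarrow> (\<Sum>i<n. a i * v i * K)) at_top"
      unfolding z_def[abs_def] by (intro tendsto_intros lim) auto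
    then show "(z \<longlongrightarrow> 0) at_top" using av_group[of "\<lambda>_. K"] by simp
  qed
  moreover have "z0 > 0"
  proof -
    obtain i where i: "i < n" "v i \<noteq> 0" using v(1) by auto
    have "0 < a i * (v i * v i)" using i pos by (auto simp: zero_less_mult_iff linorder_neq_iff)
    also have "\<dots> \<le> (\<Sum>i<n. a i * (v i * v i))"
      by (rule member_le_sum) (use i pos in \<open>auto intro!: mult_nonneg_nonneg simp: less_imp_le\<close>)
    finally show ?thesis by (simp add: z0_def mult.assoc)
  qed
  ultimately show False by simp
qed

subsection \<open>Spectra of the lifted Laplacians\<close>

text \<open>As \<open>C * B\<close> is the identity, \<open>B\<close> lifts eigenvectors of
  \<open>M\<close> injectively. Conversely \<open>C\<close> maps an eigenvector \<open>u\<close> of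
  the product to one of \<open>M\<close>, since \<open>C u = 0\<close> would force
  \<open>e u = 0\<close>.\<close>

lemma eigenvalue_lift:
  fixes M :: "real mat"
  assumes B: "B \<in> carrier_mat n m" and C: "C \<in> carrier_mat m n" and M: "M \<in> carrier_mat m m"
    and CB: "C * B = 1\<^sub>m m"
  shows "eigenvalue M e \<Longrightarrow> eigenvalue (B * M * C) e"
    and "\<lbrakk>eigenvalue (B * M * C) e; e \<noteq> 0\<rbrakk> \<Longrightarrow> eigenvalue M e"
proof -
  have L: "B * M * C \<in> carrier_mat n n" using B C M by auto
  have app: "(B * M * C) *\<^sub>v u = B *\<^sub>v (M *\<^sub>v (C *\<^sub>v u))" if u: "u \<in> carrier_vec n" for u
  proof -
    have Cu: "C *\<^sub>v u \<in> carrier_vec m" using C u by simp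
    have "(B * M * C) *\<^sub>v u = (B * M) *\<^sub>v (C *\<^sub>v u)"
      by (rule assoc_mult_mat_vec[OF _ C u]) (use B M in auto)
    also have "\<dots> = B *\<^sub>v (M *\<^sub>v (C *\<^sub>v u))" by (rule assoc_mult_mat_vec[OF B M Cu])
    finally show ?thesis .
  qed
  have CBv: "C *\<^sub>v (B *\<^sub>v u) = u" if u: "u \<in> carrier_vec m" for u
    using assoc_mult_mat_vec[OF C B u] CB u by simp
  show "eigenvalue (B * M * C) e" if ev: "eigenvalue M e"
  proof -
    obtain v where v: "v \<in> carrier_vec m" "v \<noteq> 0\<^sub>v m" "M *\<^sub>v v = e \<cdot>\<^sub>v v"
      using ev M by (auto simp: eigenvalue_def eigenvector_def)
    have Bv: "B *\<^sub>v v \<in> carrier_vec n" using B v by simp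
    have "(B * M * C) *\<^sub>v (B *\<^sub>v v) = e \<cdot>\<^sub>v (B *\<^sub>v v)"
      unfolding app[OF Bv] CBv[OF v(1)] v(3) using B v(1) by (simp add: mult_mat_vec)
    moreover have "B *\<^sub>v v \<noteq> 0\<^sub>v n"
    proof
      assume "B *\<^sub>v v = 0\<^sub>v n"
      then have "v = C *\<^sub>v 0\<^sub>v n" using CBv[OF v(1)] by simp
      moreover have "C *\<^sub>v 0\<^sub>v n = 0\<^sub>v m" using C by (intro eq_vecI) auto
      ultimately show False using v(2) by simp
    qed
    ultimately show ?thesis
      unfolding eigenvalue_def eigenvector_def using L Bv by (metis carrier_matD(1))
  qed
  show "eigenvalue M e" if ev: "eigenvalue (B * M * C) e" and e: "e \<noteq> 0"
  proof -
    obtain u where u: "u \<in> carrier_vec n" "u \<noteq> 0\<^sub>v n" "(B * M * C) *\<^sub>v u = e \<cdot>\<^sub>v u"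
      using ev L unfolding eigenvalue_def eigenvector_def by (metis carrier_matD(1))
    define v where "v = C *\<^sub>v u"
    have v: "v \<in> carrier_vec m" using C u by (simp add: v_def)
    have Mv: "M *\<^sub>v v \<in> carrier_vec m" using M v by simp
    have eq: "B *\<^sub>v (M *\<^sub>v v) = e \<cdot>\<^sub>v u" using u app by (simp add: v_def)
    then have "M *\<^sub>v v = C *\<^sub>v (e \<cdot>\<^sub>v u)" using CBv[OF Mv] by simp
    then have ev': "M *\<^sub>v v = e \<cdot>\<^sub>v v" using C u by (simp add: v_def mult_mat_vec)
    have "v \<noteq> 0\<^sub>v m"
    proof
      assume "v = 0\<^sub>v m"
      then have "M *\<^sub>v v = 0\<^sub>v m" using M by (intro eq_vecI) auto
      then have eu: "e \<cdot>\<^sub>v u = 0\<^sub>v n" using eq B by (intro eq_vecI) (auto simp: eq[symmetric])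
      have "vec_index u i = 0" if "i < n" for i
      proof -
        have "vec_index (e \<cdot>\<^sub>v u) i = 0" using eu that by simp
        then show ?thesis using that u(1) e by simp
      qed
      then have "u = 0\<^sub>v n" using u(1) by (intro eq_vecI) auto
      then show False using u(2) by simp
    qed
    then show ?thesis
      unfolding eigenvalue_def eigenvector_def using v ev' M by (metis carrier_matD(1))
  qed
qed

lemma finite_eigenvalues:
  fixes L :: "'a :: field mat"
  assumes "L \<in> carrier_mat n n"
  shows "finite {e. eigenvalue L e}"
proof -
  have "char_poly L \<noteq> 0" using degree_monic_char_poly[OF assms] by auto
  then have "finite {e. poly (char_poly L) e = 0}" by (rule poly_roots_finite)
  then show ?thesis using eigenvalue_root_char_poly[OF assms] by simp
qed

lemma eigenvalue_le_lambda_max: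
  "L \<in> carrier_mat n n \<Longrightarrow> eigenvalue L e \<Longrightarrow> e \<le> lambda_max L"
  unfolding lambda_max_def by (intro Max_ge finite_eigenvalues) auto

text \<open>A real matrix may have no real eigenvalue, and the maximum of the empty set carries no
  information. A known eigenvalue excludes this; below it is 0.\<close>

lemma eigenvalue_lambda_max:
  "L \<in> carrier_mat n n \<Longrightarrow> eigenvalue L e \<Longrightarrow> eigenvalue L (lambda_max L)"
  using Max_in[OF finite_eigenvalues, of L n] unfolding lambda_max_def by blast

subsection \<open>Sums over groups\<close>

context
  fixes n ng :: nat and k :: "nat \<Rightarrow> nat"
  assumes part: "partition_sizes n ng k"
begin

lemma sum_over_groups:
  fixes f :: "nat \<Rightarrow> real"
  shows "(\<Sum>p<ng. \<Sum>i | i < n \<and> grp_of k i = p. f i) = (\<Sum>i<n. f i)"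
  using sum.group[of "{..<n}" "{..<ng}" "grp_of k" f] grp_of_less(1)[OF part] by auto

lemma sum_weights_group:
  fixes f :: "nat \<Rightarrow> real"
  shows "(\<Sum>i<n. a i * f (grp_of k i)) = (\<Sum>p<ng. agg_weights k a p * f p)"
proof -
  have "(\<Sum>i<n. a i * f (grp_of k i)) = (\<Sum>p<ng. \<Sum>i | i < n \<and> grp_of k i = p. a i * f (grp_of k i))"
    by (rule sum_over_groups[symmetric])
  also have "\<dots> = (\<Sum>p<ng. agg_weights k a p * f p)"
    by (intro sum.cong refl) (simp add: agg_weights_eq[OF part] sum_distrib_right)
  finally show ?thesis .
qed

lemma C_mat_B_mat:
  assumes "stochastic_rows ng k c"
  shows "C_mat n ng k c * B_mat n ng k = 1\<^sub>m ng"
proof (rule eq_matI)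
  fix p q assume "p < dim_row (1\<^sub>m ng :: real mat)" "q < dim_col (1\<^sub>m ng :: real mat)"
  then have pq: "p < ng" "q < ng" by auto
  have "(C_mat n ng k c * B_mat n ng k) $$ (p, q) = (\<Sum>i<n. C_mat n ng k c $$ (p, i) * B_mat n ng k $$ (i, q))"
    using pq by (simp add: C_mat_def B_mat_def scalar_prod_def lessThan_atLeast0)
  also have "\<dots> = (\<Sum>i<n. if grp_of k i = p then (if p = q then c p (i - grp_off k p) else 0) else 0)"
    by (intro sum.cong refl) (use pq in \<open>auto simp: C_mat_index[OF part] B_mat_index[OF part]\<close>)
  also have "\<dots> = (\<Sum>u<k p. if p = q then c p u else 0)"
    unfolding sum_grp_indicator[OF part] sum_grp[OF part pq(1)] by (intro sum.cong refl) auto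
  also have "\<dots> = 1\<^sub>m ng $$ (p, q)"
    using assms pq by (auto simp: stochastic_rows_def)
  finally show "(C_mat n ng k c * B_mat n ng k) $$ (p, q) = 1\<^sub>m ng $$ (p, q)" .
qed (auto simp: C_mat_def B_mat_def)

end

subsection \<open>The three-layer system\<close>

lemma mult_mat_zero_vec: "A \<in> carrier_mat n m \<Longrightarrow> A *\<^sub>v 0\<^sub>v m = (0\<^sub>v n :: 'a :: semiring_0 vec)"
  by (intro eq_vecI) auto

lemma K_mat_mult_vec:
  assumes "A \<in> carrier_mat n n" "v \<in> carrier_vec n" "i < n"
  shows "vec_index ((K_mat n a * A) *\<^sub>v v) i = (\<Sum>j<n. A $$ (i, j) * vec_index v j) / a i"
proof -
  have "K_mat n a * A \<in> carrier_mat n n" using assms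
    by (intro mult_carrier_mat[of _ n n]) (auto simp: K_mat_def)
  then have "vec_index ((K_mat n a * A) *\<^sub>v v) i = (\<Sum>j<n. (K_mat n a * A) $$ (i, j) * vec_index v j)"
    using assms by (intro mult_mat_vec_index_sum) auto
  also have "\<dots> = (\<Sum>j<n. A $$ (i, j) * vec_index v j) / a i"
    unfolding sum_divide_distrib using assms by (intro sum.cong refl) (simp add: K_mat_mult_index)
  finally show ?thesis .
qed

locale three_layer =
  fixes N1 N2 N3 :: nat
    and k1 k2 :: "nat \<Rightarrow> nat"
    and G1 G2 :: "nat \<Rightarrow> nat \<Rightarrow> nat \<Rightarrow> bool"
    and G3 :: "nat \<Rightarrow> nat \<Rightarrow> bool"
    and c1 c2 :: "nat \<Rightarrow> nat \<Rightarrow> real"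
    and a :: "nat \<Rightarrow> real"
    and \<tau>2 \<tau>3 :: real
  assumes N_pos: "0 < N1" "0 < N2" "0 < N3"
    and part1: "partition_sizes N1 N2 k1"
    and part2: "partition_sizes N2 N3 k2"
    and graphs1: "\<forall>p<N2. undirected_connected (k1 p) (G1 p)"
    and graphs2: "\<forall>p<N3. undirected_connected (k2 p) (G2 p)"
    and graph3: "undirected_connected N3 G3"
    and stoch1: "stochastic_rows N2 k1 c1"
    and stoch2: "stochastic_rows N3 k2 c2"
    and a_pos: "\<forall>i<N1. 0 < a i"
    and delays: "0 \<le> \<tau>2" "0 \<le> \<tau>3"
begin

abbreviation "\<gamma>1 \<equiv> grp_of k1"
abbreviation "\<gamma>2 \<equiv> grp_of k2"
abbreviation "a2 \<equiv> agg_weights k1 a"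
abbreviation "a3 \<equiv> agg_weights k2 a2"
abbreviation "lap1 \<equiv> laplacian_entry N1 (block_graph k1 G1)"
abbreviation "lap2 \<equiv> laplacian_entry N2 (block_graph k2 G2)"
abbreviation "lap3 \<equiv> laplacian_entry N3 G3"
abbreviation "h2 \<equiv> 2 * \<tau>2"
abbreviation "h3 \<equiv> 2 * \<tau>2 + 2 * \<tau>3"
abbreviation "K1 \<equiv> K_mat N1 a"
abbreviation "K2 \<equiv> K_mat N2 a2"
abbreviation "K3 \<equiv> K_mat N3 a3"
abbreviation "LD1 \<equiv> block_laplacian N1 N2 k1 G1"
abbreviation "LD2 \<equiv> block_laplacian N2 N3 k2 G2"
abbreviation "LD3 \<equiv> laplacian N3 G3"
abbreviation "B1 \<equiv> B_mat N1 N2 k1"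
abbreviation "C1 \<equiv> C_mat N1 N2 k1 c1"
abbreviation "B2 \<equiv> B_mat N2 N3 k2"
abbreviation "C2 \<equiv> C_mat N2 N3 k2 c2"
abbreviation "sol \<equiv> delayed_solution N1 N2 N3 K1 LD1 K2 LD2 K3 LD3 B1 C1 B2 C2 \<tau>2 \<tau>3"

definition avg1 :: "(nat \<Rightarrow> real) \<Rightarrow> nat \<Rightarrow> real" where
  "avg1 f q = (\<Sum>u<k1 q. c1 q u * f (grp_off k1 q + u))"

definition avg2 :: "(nat \<Rightarrow> real) \<Rightarrow> nat \<Rightarrow> real" where
  "avg2 f r = (\<Sum>u<k2 r. c2 r u * f (grp_off k2 r + u))"

definition flow2 :: "(nat \<Rightarrow> real) \<Rightarrow> nat \<Rightarrow> real" where
  "flow2 f p = (\<Sum>q<N2. lap2 p q * avg1 f q) / a2 p"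

definition flow3 :: "(nat \<Rightarrow> real) \<Rightarrow> nat \<Rightarrow> real" where
  "flow3 f r = (\<Sum>s<N3. lap3 r s * avg2 (avg1 f) s) / a3 r"

text \<open>The right-hand side after elimination of the auxiliary signals. Measurements travel up
  and commands travel down, so \<open>\<tau>2\<close> is passed twice for layer 2, and both delays
  are passed twice for layer 3.\<close>

definition rhs :: "(nat \<Rightarrow> real \<Rightarrow> real) \<Rightarrow> nat \<Rightarrow> real \<Rightarrow> real" where
  "rhs x i t = - (\<Sum>j<N1. lap1 i j * x j t) / a i - flow2 (\<lambda>j. x j (t - h2)) (\<gamma>1 i)
     - flow3 (\<lambda>j. x j (t - h3)) (\<gamma>2 (\<gamma>1 i))"

lemma carriers:
  "K1 \<in> carrier_mat N1 N1" "K2 \<in> carrier_mat N2 N2" "K3 \<in> carrier_mat N3 N3"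
  "LD1 \<in> carrier_mat N1 N1" "LD2 \<in> carrier_mat N2 N2" "LD3 \<in> carrier_mat N3 N3"
  "B1 \<in> carrier_mat N1 N2" "C1 \<in> carrier_mat N2 N1" "B2 \<in> carrier_mat N2 N3" "C2 \<in> carrier_mat N3 N2"
  by (auto simp: K_mat_def block_laplacian_def laplacian_def B_mat_def C_mat_def)

lemma a2_pos: "p < N2 \<Longrightarrow> 0 < a2 p"
  using agg_weights_pos[OF part1] a_pos by blast

lemma a3_pos: "r < N3 \<Longrightarrow> 0 < a3 r"
  using agg_weights_pos[OF part2] a2_pos by blast

lemma graph1': "component_graph N1 \<gamma>1 (block_graph k1 G1)"
  by (rule component_graph_block_graph[OF part1 graphs1])

lemma graph2': "component_graph N2 \<gamma>2 (block_graph k2 G2)"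
  by (rule component_graph_block_graph[OF part2 graphs2])

lemma graph3': "component_graph N3 (\<lambda>_. 0) G3"
  by (rule component_graph_connected[OF graph3])

lemma avg1_cong:
  assumes "\<And>j. \<lbrakk>j < N1; \<gamma>1 j = q\<rbrakk> \<Longrightarrow> f j = g j" "q < N2"
  shows "avg1 f q = avg1 g q"
  unfolding avg1_def using assms grp_member[OF part1] by (intro sum.cong refl) auto

lemma avg2_cong:
  assumes "\<And>q. \<lbrakk>q < N2; \<gamma>2 q = r\<rbrakk> \<Longrightarrow> f q = g q" "r < N3"
  shows "avg2 f r = avg2 g r"
  unfolding avg2_def using assms grp_member[OF part2] by (intro sum.cong refl) auto

lemma avg1_const: "q < N2 \<Longrightarrow> avg1 (\<lambda>_. x) q = x"
  using stoch1 unfolding avg1_def stochastic_rows_def by (simp flip: sum_distrib_right)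

lemma avg2_const: "r < N3 \<Longrightarrow> avg2 (\<lambda>_. x) r = x"
  using stoch2 unfolding avg2_def stochastic_rows_def by (simp flip: sum_distrib_right)

lemma avg1_lift: "q < N2 \<Longrightarrow> avg1 (\<lambda>j. f (\<gamma>1 j)) q = f q"
  using avg1_cong[of q "\<lambda>j. f (\<gamma>1 j)" "\<lambda>_. f q"] by (simp add: avg1_const)

lemma avg2_lift: "r < N3 \<Longrightarrow> avg2 (\<lambda>q. f (\<gamma>2 q)) r = f r"
  using avg2_cong[of r "\<lambda>q. f (\<gamma>2 q)" "\<lambda>_. f r"] by (simp add: avg2_const)

lemma avg1_add: "avg1 (\<lambda>j. f j + g j) q = avg1 f q + avg1 g q"
  by (simp add: avg1_def distrib_left sum.distrib)

lemma avg2_add: "avg2 (\<lambda>j. f j + g j) r = avg2 f r + avg2 g r"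
  by (simp add: avg2_def distrib_left sum.distrib)

section \<open>Elimination and reconstruction of the auxiliary signals\<close>

lemma signals_rhs:
  assumes carr: "\<And>t. x1 t \<in> carrier_vec N1"
    and neg1: "\<And>t. t < 0 \<Longrightarrow> x1 t = 0\<^sub>v N1" and neg2: "\<And>t. t < 0 \<Longrightarrow> x2 t = 0\<^sub>v N2"
    and neg3: "\<And>t. t < 0 \<Longrightarrow> x3 t = 0\<^sub>v N3" and neg4: "\<And>t. t < 0 \<Longrightarrow> y2 t = 0\<^sub>v N2"
    and x2: "\<And>t. t \<ge> 0 \<Longrightarrow> x2 t = C1 *\<^sub>v x1 (t - \<tau>2)"
    and y1: "\<And>t. t \<ge> 0 \<Longrightarrow> y1 t = B1 *\<^sub>v (- ((K2 * LD2) *\<^sub>v x2 (t - \<tau>2)) + y2 (t - \<tau>2))"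
    and x3: "\<And>t. t \<ge> 0 \<Longrightarrow> x3 t = C2 *\<^sub>v x2 (t - \<tau>3)"
    and y2: "\<And>t. t \<ge> 0 \<Longrightarrow> y2 t = B2 *\<^sub>v (- ((K3 * LD3) *\<^sub>v x3 (t - \<tau>3)))"
    and t: "t \<ge> 0" and i: "i < N1"
  shows "vec_index (- ((K1 * LD1) *\<^sub>v x1 t) + y1 t) i = rhs (\<lambda>j t. vec_index (x1 t) j) i t"
proof -
  note car = carriers
  have KL: "K2 * LD2 \<in> carrier_mat N2 N2" "K3 * LD3 \<in> carrier_mat N3 N3" "K1 * LD1 \<in> carrier_mat N1 N1"
    using car by auto
  \<comment> \<open>Because all signals vanish at negative times and delays are nonnegative, the
    signal equations hold at every real time and can be composed without tracking signs of
    arguments.\<close>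
  have x2': "x2 t = C1 *\<^sub>v x1 (t - \<tau>2)" for t
    using x2 neg2 neg1[of "t - \<tau>2"] mult_mat_zero_vec[OF car(8)] delays by (cases "t < 0") auto
  have x2c: "x2 t \<in> carrier_vec N2" for t
    unfolding x2' using car(8) carr by (rule mult_mat_vec_carrier)
  have x3': "x3 t = C2 *\<^sub>v x2 (t - \<tau>3)" for t
    using x3 neg3 neg2[of "t - \<tau>3"] mult_mat_zero_vec[OF car(10)] delays by (cases "t < 0") auto
  have x3c: "x3 t \<in> carrier_vec N3" for t
    unfolding x3' using car(10) x2c by (rule mult_mat_vec_carrier)
  have u3c: "- ((K3 * LD3) *\<^sub>v x3 t) \<in> carrier_vec N3" for t
    using mult_mat_vec_carrier[OF KL(2) x3c] by simp
  have y2': "y2 t = B2 *\<^sub>v (- ((K3 * LD3) *\<^sub>v x3 (t - \<tau>3)))" for t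
  proof (cases "t < 0")
    case True
    then have "x3 (t - \<tau>3) = 0\<^sub>v N3" using neg3 delays by simp
    then have "- ((K3 * LD3) *\<^sub>v x3 (t - \<tau>3)) = 0\<^sub>v N3"
      by (simp add: mult_mat_zero_vec[OF KL(2)])
    then show ?thesis using neg4 True mult_mat_zero_vec[OF car(9)] by simp
  qed (use y2 in auto)
  have y2c: "y2 t \<in> carrier_vec N2" for t
    unfolding y2' using car(9) u3c by (rule mult_mat_vec_carrier)
  have x2i: "vec_index (x2 t) q = avg1 (vec_index (x1 (t - \<tau>2))) q" if "q < N2" for t q
    unfolding x2' avg1_def by (rule C_mat_mult_vec[OF part1 carr that])
  have x3i: "vec_index (x3 t) r = avg2 (avg1 (vec_index (x1 (t - \<tau>3 - \<tau>2)))) r" if "r < N3" for t r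
  proof -
    have "vec_index (x3 t) r = avg2 (vec_index (x2 (t - \<tau>3))) r"
      unfolding x3' avg2_def by (rule C_mat_mult_vec[OF part2 x2c that])
    also have "\<dots> = avg2 (avg1 (vec_index (x1 (t - \<tau>3 - \<tau>2)))) r"
      using that by (intro avg2_cong x2i)
    finally show ?thesis .
  qed
  define p where "p = \<gamma>1 i"
  have p: "p < N2" using grp_of_less(1)[OF part1 i] by (simp add: p_def)
  define r where "r = \<gamma>2 p"
  have r: "r < N3" using grp_of_less(1)[OF part2 p] by (simp add: r_def)
  have lap: "LD1 $$ (i, j) = lap1 i j" if "j < N1" for j
    using block_laplacian_index[OF part1 i that] .
  have lap2: "LD2 $$ (p, j) = lap2 p j" if "j < N2" for j
    using block_laplacian_index[OF part2 p that] .
  have lap3: "LD3 $$ (r, j) = lap3 r j" if "j < N3" for j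
    using r that by (simp add: laplacian_def)
  have u2c: "- ((K2 * LD2) *\<^sub>v x2 s) + y2 s \<in> carrier_vec N2" for s
    using mult_mat_vec_carrier[OF KL(1) x2c] y2c by simp
  have y2i: "vec_index (y2 s) p = - flow3 (vec_index (x1 (s - \<tau>3 - \<tau>3 - \<tau>2))) r" for s
  proof -
    have "vec_index (y2 s) p = vec_index (- ((K3 * LD3) *\<^sub>v x3 (s - \<tau>3))) r"
      unfolding y2' r_def by (rule B_mat_mult_vec[OF part2 u3c p])
    also have "\<dots> = - vec_index ((K3 * LD3) *\<^sub>v x3 (s - \<tau>3)) r"
      using r KL(2) by (intro index_uminus_vec) auto
    also have "vec_index ((K3 * LD3) *\<^sub>v x3 (s - \<tau>3)) r =
        (\<Sum>j<N3. LD3 $$ (r, j) * vec_index (x3 (s - \<tau>3)) j) / a3 r"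
      by (rule K_mat_mult_vec[OF car(6) x3c r])
    finally show ?thesis by (simp add: flow3_def lap3 x3i)
  qed
  have "vec_index (y1 t) i = vec_index (- ((K2 * LD2) *\<^sub>v x2 (t - \<tau>2)) + y2 (t - \<tau>2)) p"
    unfolding y1[OF t] p_def by (rule B_mat_mult_vec[OF part1 u2c i])
  also have "\<dots> = - vec_index ((K2 * LD2) *\<^sub>v x2 (t - \<tau>2)) p + vec_index (y2 (t - \<tau>2)) p"
    using p KL(1) y2c[of "t - \<tau>2"] by auto
  also have "vec_index ((K2 * LD2) *\<^sub>v x2 (t - \<tau>2)) p =
      (\<Sum>j<N2. LD2 $$ (p, j) * vec_index (x2 (t - \<tau>2)) j) / a2 p"
    by (rule K_mat_mult_vec[OF car(5) x2c p])
  also have "\<dots> = flow2 (vec_index (x1 (t - \<tau>2 - \<tau>2))) p"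
    by (simp add: flow2_def lap2 x2i)
  finally have y1i: "vec_index (y1 t) i = - flow2 (vec_index (x1 (t - \<tau>2 - \<tau>2))) p
      - flow3 (vec_index (x1 (t - \<tau>2 - \<tau>3 - \<tau>3 - \<tau>2))) r"
    by (simp add: y2i)
  have "t - \<tau>2 - \<tau>2 = t - h2" "t - \<tau>2 - \<tau>3 - \<tau>3 - \<tau>2 = t - h3" by simp_all
  note y1i' = y1i[unfolded this]
  have y1c: "y1 t \<in> carrier_vec N1"
    unfolding y1[OF t] using car(7) u2c by (rule mult_mat_vec_carrier)
  have "vec_index (- ((K1 * LD1) *\<^sub>v x1 t) + y1 t) i =
      - vec_index ((K1 * LD1) *\<^sub>v x1 t) i + vec_index (y1 t) i"
    using i KL(3) y1c by auto
  also have "vec_index ((K1 * LD1) *\<^sub>v x1 t) i = (\<Sum>j<N1. LD1 $$ (i, j) * vec_index (x1 t) j) / a i"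
    by (rule K_mat_mult_vec[OF car(4) carr i])
  also have "\<dots> = (\<Sum>j<N1. lap1 i j * vec_index (x1 t) j) / a i" by (simp add: lap)
  finally show ?thesis unfolding y1i' rhs_def p_def[symmetric] r_def[symmetric] by simp
qed

lemma solution_integral:
  assumes "sol x0 x1 x2 x3 y1 y2" "i < N1" "t \<ge> 0"
  shows "(rhs (\<lambda>j t. vec_index (x1 t) j) i has_integral (vec_index (x1 t) i - vec_index x0 i)) {0..t}"
proof -
  note D = assms(1)[unfolded delayed_solution_def]
  have "((\<lambda>s. vec_index (- ((K1 * LD1) *\<^sub>v x1 s) + y1 s) i) has_integral
      (vec_index (x1 t) i - vec_index x0 i)) {0..t}"
    using D assms(2,3) by blast
  moreover have "vec_index (- ((K1 * LD1) *\<^sub>v x1 s) + y1 s) i = rhs (\<lambda>j t. vec_index (x1 t) j) i s"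
    if "s \<in> {0..t}" for s
    by (rule signals_rhs[of x1 x2 x3 y2]) (use D assms(2) that in auto)
  ultimately show ?thesis by (rule has_integral_eq[rotated])
qed

text \<open>The assumption in the necessity direction speaks about solutions of the full system, so
  a solution of the eliminated equation must be completed by its auxiliary signals.\<close>

lemma solution_exists:
  assumes neg: "\<And>i t. t < 0 \<Longrightarrow> x i t = 0"
    and int: "\<And>i t. \<lbrakk>i < N1; t \<ge> 0\<rbrakk> \<Longrightarrow> (rhs x i has_integral (x i t - x i 0)) {0..t}"
  shows "\<exists>x2 x3 y1 y2. sol (vec N1 (\<lambda>i. x i 0)) (\<lambda>t. vec N1 (\<lambda>i. x i t)) x2 x3 y1 y2"
proof -
  define x1 where "x1 t = vec N1 (\<lambda>i. x i t)" for t
  define x2 where "x2 t = (if t < 0 then 0\<^sub>v N2 else C1 *\<^sub>v x1 (t - \<tau>2))" for t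
  define x3 where "x3 t = (if t < 0 then 0\<^sub>v N3 else C2 *\<^sub>v x2 (t - \<tau>3))" for t
  define y2 where "y2 t = (if t < 0 then 0\<^sub>v N2 else B2 *\<^sub>v (- ((K3 * LD3) *\<^sub>v x3 (t - \<tau>3))))" for t
  define y1 where "y1 t = (if t < 0 then 0\<^sub>v N1
      else B1 *\<^sub>v (- ((K2 * LD2) *\<^sub>v x2 (t - \<tau>2)) + y2 (t - \<tau>2)))" for t
  have dims: "dim_row C1 = N2" "dim_row C2 = N3" "dim_row B1 = N1" "dim_row B2 = N2"
    using carriers by auto
  have neg1: "x1 t = 0\<^sub>v N1" if "t < 0" for t
    using that neg by (intro eq_vecI) (auto simp: x1_def)
  have car: "x1 t \<in> carrier_vec N1" "x2 t \<in> carrier_vec N2" "x3 t \<in> carrier_vec N3"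
    "y1 t \<in> carrier_vec N1" "y2 t \<in> carrier_vec N2" for t
    by (auto simp: x1_def x2_def x3_def y1_def y2_def dims intro!: carrier_vecI)
  have rhs_cong: "rhs (\<lambda>j t. vec_index (x1 t) j) i s = rhs x i s" if "i < N1" for i s
  proof -
    define p where "p = \<gamma>1 i"
    have p: "p < N2" using grp_of_less(1)[OF part1 that] by (simp add: p_def)
    have e1: "avg1 (\<lambda>j. vec_index (x1 s) j) q = avg1 (\<lambda>j. x j s) q" if "q < N2" for q s
      using that by (intro avg1_cong) (auto simp: x1_def)
    have e2: "avg2 (avg1 (\<lambda>j. vec_index (x1 s) j)) r = avg2 (avg1 (\<lambda>j. x j s)) r" if "r < N3" for r s
      using that e1 by (intro avg2_cong) auto
    have "flow2 (\<lambda>j. vec_index (x1 s) j) p = flow2 (\<lambda>j. x j s) p" for p s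
      by (simp add: flow2_def e1)
    moreover have "flow3 (\<lambda>j. vec_index (x1 s) j) p = flow3 (\<lambda>j. x j s) p" for p s
      by (simp add: flow3_def e2)
    moreover have "(\<Sum>j<N1. lap1 i j * vec_index (x1 s) j) = (\<Sum>j<N1. lap1 i j * x j s)"
      by (intro sum.cong refl) (auto simp: x1_def)
    ultimately show ?thesis unfolding rhs_def by simp
  qed
  have "sol (x1 0) x1 x2 x3 y1 y2"
    unfolding delayed_solution_def
  proof (intro conjI allI impI)
    fix t :: real and i assume ti: "t \<ge> 0" "i < N1"
    have "vec_index (- ((K1 * LD1) *\<^sub>v x1 s) + y1 s) i = rhs x i s" if "s \<in> {0..t}" for s
    proof -
      have "vec_index (- ((K1 * LD1) *\<^sub>v x1 s) + y1 s) i = rhs (\<lambda>j t. vec_index (x1 t) j) i s"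
        by (rule signals_rhs[of x1 x2 x3 y2])
          (use that ti neg1 car in \<open>auto simp: x2_def x3_def y1_def y2_def\<close>)
      then show ?thesis using rhs_cong[OF ti(2)] by simp
    qed
    then show "((\<lambda>s. vec_index (- ((K1 * LD1) *\<^sub>v x1 s) + y1 s) i) has_integral
        (vec_index (x1 t) i - vec_index (x1 0) i)) {0..t}"
      using has_integral_eq[OF _ int[OF ti(2,1)]] ti by (simp add: x1_def)
  qed (use car neg1 in \<open>auto simp: x2_def x3_def y1_def y2_def\<close>)
  then show ?thesis unfolding x1_def[abs_def] by blast
qed

end

section \<open>Conservation of the weighted state sum and convergence to consensus\<close>

lemma laplacian_total:
  assumes "component_graph n \<gamma> E"
  shows "(\<Sum>i<n. \<Sum>j<n. laplacian_entry n E i j * f j) = 0"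
proof -
  have "(\<Sum>i<n. laplacian_entry n E i j) = 0" if "j < n" for j
  proof -
    have "(\<Sum>i<n. laplacian_entry n E i j) = (\<Sum>i<n. laplacian_entry n E j i * 1)"
      using component_laplacian_sym[OF assms] that by (intro sum.cong refl) auto
    then show ?thesis using component_laplacian_kernel[OF assms that, of "\<lambda>_. 1"] by simp
  qed
  then show ?thesis by (subst sum.swap) (simp flip: sum_distrib_right)
qed

context three_layer
begin

text \<open>Summing \<open>a\<close> over groups produces exactly the weights inverted in
  \<open>K2\<close> and \<open>K3\<close>. Each layer thus contributes the total of a Laplacian
  image, which is 0 by its column sums.\<close>

lemma rhs_weighted_sum: "(\<Sum>i<N1. a i * rhs x i t) = 0"
proof -
  define F where "F = flow2 (\<lambda>j. x j (t - h2))"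
  define H where "H = flow3 (\<lambda>j. x j (t - h3))"
  have "(\<Sum>i<N1. a i * rhs x i t) =
      (\<Sum>i<N1. - (\<Sum>j<N1. lap1 i j * x j t) - a i * F (\<gamma>1 i) - a i * H (\<gamma>2 (\<gamma>1 i)))"
  proof (intro sum.cong refl)
    fix i assume "i \<in> {..<N1}"
    then have "a i \<noteq> 0" using a_pos by force
    then show "a i * rhs x i t = - (\<Sum>j<N1. lap1 i j * x j t) - a i * F (\<gamma>1 i) - a i * H (\<gamma>2 (\<gamma>1 i))"
      by (simp add: rhs_def F_def H_def right_diff_distrib)
  qed
  also have "\<dots> = - (\<Sum>p<N2. a2 p * F p) - (\<Sum>p<N2. a2 p * H (\<gamma>2 p))"
    using sum_weights_group[OF part1, of a F] sum_weights_group[OF part1, of a "\<lambda>p. H (\<gamma>2 p)"]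
      laplacian_total[OF graph1', of "\<lambda>j. x j t"]
    by (simp add: sum_subtractf sum_negf)
  also have "(\<Sum>p<N2. a2 p * H (\<gamma>2 p)) = (\<Sum>r<N3. a3 r * H r)"
    by (rule sum_weights_group[OF part2])
  also have "(\<Sum>r<N3. a3 r * H r) = (\<Sum>r<N3. \<Sum>s<N3. lap3 r s * avg2 (avg1 (\<lambda>j. x j (t - h3))) s)"
    by (intro sum.cong refl) (use a3_pos in \<open>force simp: H_def flow3_def\<close>)
  also have "\<dots> = 0" by (rule laplacian_total[OF graph3'])
  also have "(\<Sum>p<N2. a2 p * F p) = (\<Sum>p<N2. \<Sum>q<N2. lap2 p q * avg1 (\<lambda>j. x j (t - h2)) q)"
    by (intro sum.cong refl) (use a2_pos in \<open>force simp: F_def flow2_def\<close>)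
  also have "\<dots> = 0" by (rule laplacian_total[OF graph2'])
  finally show ?thesis by simp
qed

lemma consensus:
  assumes eig2: "\<And>\<mu> v. \<lbrakk>\<exists>p<N2. v p \<noteq> 0; \<forall>p<N2. (\<Sum>q<N2. lap2 p q * v q) = \<mu> * a2 p * v p\<rbrakk>
      \<Longrightarrow> \<mu> * h2 < pi / 2"
    and eig3: "\<And>\<mu> v. \<lbrakk>\<exists>p<N3. v p \<noteq> 0; \<forall>p<N3. (\<Sum>q<N3. lap3 p q * v q) = \<mu> * a3 p * v p\<rbrakk>
      \<Longrightarrow> \<mu> * h3 < pi / 2"
    and int: "\<And>i t. \<lbrakk>i < N1; t \<ge> 0\<rbrakk> \<Longrightarrow> (rhs x i has_integral (x i t - x0 i)) {0..t}"
    and i: "i < N1"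
  shows "(x i \<longlongrightarrow> (\<Sum>j<N1. a j * x0 j) / (\<Sum>j<N1. a j)) at_top"
proof -
  have h: "h2 \<ge> 0" "h3 \<ge> h2" "h3 \<ge> 0" using delays by auto
  \<comment> \<open>Beyond \<open>h3\<close> all delayed arguments are positive and
    \<open>rhs\<close> is continuous; the margin 1 keeps \<open>T\<close> strictly inside that
    range, so derivatives are two-sided.\<close>
  define T where "T = h3 + 1"
  have cont: "continuous_on {0..} (x j)" if "j < N1" for j
    by (rule integral_equation_continuous[OF int[OF that]])
  have shift: "continuous_on {h3..} (\<lambda>t. x j (t - h'))" if "j < N1" "h' \<le> h3" for j h'
    by (rule continuous_on_compose2[OF cont[OF that(1)]]) (use that in \<open>auto intro!: continuous_intros\<close>)
  have avg1c: "continuous_on {h3..} (\<lambda>t. avg1 (\<lambda>j. x j (t - h')) q)" if "q < N2" "h' \<le> h3" for q h'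
    unfolding avg1_def using that grp_member(1)[OF part1] by (intro continuous_intros shift) auto
  have avg2c: "continuous_on {h3..} (\<lambda>t. avg2 (avg1 (\<lambda>j. x j (t - h'))) r)" if "r < N3" "h' \<le> h3" for r h'
    unfolding avg2_def using that grp_member(1)[OF part2] by (intro continuous_intros avg1c) auto
  have rhsc: "continuous_on {h3..} (rhs x j)" if "j < N1" for j
  proof -
    have "continuous_on {h3..} (\<lambda>t. (\<Sum>l<N1. lap1 j l * x l (t - 0)))"
      using h by (intro continuous_intros shift) auto
    moreover have "continuous_on {h3..} (\<lambda>t. (\<Sum>q<N2. lap2 (\<gamma>1 j) q * avg1 (\<lambda>j. x j (t - h2)) q))"
      using h by (intro continuous_intros avg1c) auto
    moreover have "continuous_on {h3..} (\<lambda>t. (\<Sum>s<N3. lap3 (\<gamma>2 (\<gamma>1 j)) s * avg2 (avg1 (\<lambda>j. x j (t - h3))) s))"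
      using h by (intro continuous_intros avg2c) auto
    ultimately show ?thesis
      unfolding rhs_def[abs_def] flow2_def flow3_def divide_inverse
      by (intro continuous_on_diff continuous_on_minus continuous_on_mult_right) auto
  qed
  have x': "(x j has_real_derivative rhs x j t) (at t)" if "j < N1" "t \<ge> T" for j t
    using integral_equation_derivative[OF int[OF that(1)] rhsc[OF that(1)] h(3)] that by (auto simp: T_def)

  define m1 where "m1 p t = (\<Sum>i | i < N1 \<and> \<gamma>1 i = p. a i * x i t) / (\<Sum>i | i < N1 \<and> \<gamma>1 i = p. a i)" for p t
  define m2 where "m2 r t = (\<Sum>p | p < N2 \<and> \<gamma>2 p = r. a2 p * m1 p t) / (\<Sum>p | p < N2 \<and> \<gamma>2 p = r. a2 p)" for r t
  \<comment> \<open>The condition \<open>0 = s\<close> is the membership test for the constant label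
    of layer 3, in the shape that \<open>layer_decay\<close> produces. \<open>m3 0\<close> is the
    global weighted mean.\<close>
  define m3 where "m3 (s :: nat) t = (\<Sum>r | r < N3 \<and> 0 = s. a3 r * m2 r t) / (\<Sum>r | r < N3 \<and> 0 = s. a3 r)" for s t
  define r1 where "r1 p t = flow2 (\<lambda>j. x j (t - h2)) p + flow3 (\<lambda>j. x j (t - h3)) (\<gamma>2 p)" for p t
  define r2 where "r2 r t = flow3 (\<lambda>j. x j (t - h3)) r" for r t
  define d1 where "d1 j t = x j t - m1 (\<gamma>1 j) t" for j t
  define d2 where "d2 p t = m1 p t - m2 (\<gamma>2 p) t" for p t
  define d3 where "d3 r t = m2 r t - m3 0 t" for r t
  \<comment> \<open>The discrepancy between the average formed by \<open>C1\<close> and the weighted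
    average \<open>m1\<close>: a delayed combination of deviations of layer 1, hence square
    integrable. \<open>g3\<close> plays the same role for \<open>C2\<close> composed with
    \<open>C1\<close>.\<close>
  define g2 where "g2 q t = avg1 (\<lambda>j. d1 j (t - h2)) q" for q t
  define g3 where "g3 r t = avg2 (\<lambda>q. d2 q (t - h3) + avg1 (\<lambda>j. d1 j (t - h3)) q) r" for r t

  have avg_x: "avg1 (\<lambda>j. x j s) q = m1 q s + avg1 (\<lambda>j. d1 j s) q" if "q < N2" for q s
  proof -
    have "avg1 (\<lambda>j. x j s) q = avg1 (\<lambda>j. m1 (\<gamma>1 j) s + d1 j s) q" by (simp add: d1_def)
    then show ?thesis using that by (simp add: avg1_add avg1_lift[of q "\<lambda>p. m1 p s"])
  qed
  have avg_m: "avg2 (avg1 (\<lambda>j. x j s)) r = m2 r s + avg2 (\<lambda>q. d2 q s + avg1 (\<lambda>j. d1 j s) q) r" if "r < N3" for r s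
  proof -
    have "avg2 (avg1 (\<lambda>j. x j s)) r = avg2 (\<lambda>q. m2 (\<gamma>2 q) s + (d2 q s + avg1 (\<lambda>j. d1 j s) q)) r"
      using that by (intro avg2_cong) (auto simp: avg_x d2_def)
    then show ?thesis using that by (simp add: avg2_add avg2_lift[of r "\<lambda>p. m2 p s"])
  qed

  have deriv1: "(x j has_real_derivative - (\<Sum>l<N1. lap1 j l * (x l (t - 0) + 0)) / a j - r1 (\<gamma>1 j) t) (at t)"
    if "t \<ge> T" "j < N1" for j t
    using x'[OF that(2,1)] by (simp add: rhs_def r1_def diff_diff_eq)
  have pos1: "0 < a j" if "j < N1" for j using a_pos that by blast
  have eig1: "\<mu> * 0 < pi / 2" for \<mu> :: real by simp
  note zero1 = sq_integrable_tail_zero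
  have m1': "(m1 (\<gamma>1 j) has_real_derivative - r1 (\<gamma>1 j) t) (at t)" if "j < N1" "t \<ge> T" for j t
    unfolding m1_def[abs_def]
    by (rule layer_decay(1)[OF graph1', where h = 0 and T = T and g = "\<lambda>_ _. 0"];
        use pos1 eig1 deriv1 zero1 that in blast)
  have d1: "sq_integrable_tail (d1 j)" "(d1 j \<longlongrightarrow> 0) at_top" if "j < N1" for j
    unfolding d1_def[abs_def] m1_def
    by (rule layer_decay(2,3)[OF graph1', where h = 0 and T = T and g = "\<lambda>_ _. 0" and r = r1];
        use pos1 eig1 deriv1 zero1 that in blast)+

  have deriv2: "(m1 p has_real_derivative - (\<Sum>q<N2. lap2 p q * (m1 q (t - h2) + g2 q t)) / a2 p - r2 (\<gamma>2 p) t) (at t)"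
    if "t \<ge> T" "p < N2" for p t
  proof -
    have "\<exists>j<N1. \<gamma>1 j = p" by (rule grp_nonempty[OF part1 that(2)])
    then obtain j where j: "j < N1" "\<gamma>1 j = p" by blast
    have "(\<Sum>q<N2. lap2 p q * (m1 q (t - h2) + g2 q t)) = (\<Sum>q<N2. lap2 p q * avg1 (\<lambda>j. x j (t - h2)) q)"
      by (intro sum.cong refl) (simp add: g2_def avg_x)
    then show ?thesis using m1'[OF j(1) that(1)] j by (simp add: r1_def r2_def flow2_def)
  qed
  have gs2: "sq_integrable_tail (g2 q)" if "q < N2" for q
    unfolding g2_def[abs_def] avg1_def using that grp_member(1)[OF part1]
    by (intro sq_integrable_tail_sum sq_integrable_tail_cmult sq_integrable_tail_shift d1) auto
  have m2': "(m2 (\<gamma>2 p) has_real_derivative - r2 (\<gamma>2 p) t) (at t)" if "p < N2" "t \<ge> T" for p t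
    unfolding m2_def[abs_def]
    by (rule layer_decay(1)[OF graph2', where h = h2 and T = T and g = g2];
        use a2_pos eig2 deriv2 gs2 h that in blast)
  have d2: "sq_integrable_tail (d2 p)" "(d2 p \<longlongrightarrow> 0) at_top" if "p < N2" for p
    unfolding d2_def[abs_def] m2_def
    by (rule layer_decay(2,3)[OF graph2', where h = h2 and T = T and g = g2 and r = r2];
        use a2_pos eig2 deriv2 gs2 h that in blast)+

  have deriv3: "(m2 r has_real_derivative - (\<Sum>s<N3. lap3 r s * (m2 s (t - h3) + g3 s t)) / a3 r - 0) (at t)"
    if "t \<ge> T" "r < N3" for r t
  proof -
    have "\<exists>p<N2. \<gamma>2 p = r" by (rule grp_nonempty[OF part2 that(2)])
    then obtain p where p: "p < N2" "\<gamma>2 p = r" by blast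
    have "(\<Sum>s<N3. lap3 r s * (m2 s (t - h3) + g3 s t)) = (\<Sum>s<N3. lap3 r s * avg2 (avg1 (\<lambda>j. x j (t - h3))) s)"
      by (intro sum.cong refl) (simp add: g3_def avg_m)
    then show ?thesis using m2'[OF p(1) that(1)] p by (simp add: r2_def flow3_def)
  qed
  have gs3: "sq_integrable_tail (g3 r)" if "r < N3" for r
    unfolding g3_def[abs_def] avg2_def avg1_def using that grp_member(1)[OF part1] grp_member(1)[OF part2]
    by (intro sq_integrable_tail_sum sq_integrable_tail_cmult sq_integrable_tail_add
        sq_integrable_tail_shift[of "d2 _"] sq_integrable_tail_shift[of "d1 _"] d1 d2) auto
  have d3: "(d3 r \<longlongrightarrow> 0) at_top" if "r < N3" for r
    unfolding d3_def[abs_def] m3_def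
    by (rule layer_decay(3)[OF graph3', where h = h3 and T = T and g = g3 and r = "\<lambda>_ _. 0"];
        use a3_pos eig3 deriv3 gs3 h that in blast)

  have m1w: "a2 p * m1 p t = (\<Sum>i | i < N1 \<and> \<gamma>1 i = p. a i * x i t)" if "p < N2" for p t
    using a2_pos[OF that] by (simp add: m1_def agg_weights_eq[OF part1 that])
  have m2w: "a3 r * m2 r t = (\<Sum>p | p < N2 \<and> \<gamma>2 p = r. a2 p * m1 p t)" if "r < N3" for r t
    using a3_pos[OF that] by (simp add: m2_def agg_weights_eq[OF part2 that])
  \<comment> \<open>The weighted means are nested, so the global mean is the conserved weighted sum
    of the physical states divided by the total weight. With
    \<open>x i = d1 i + d2 p + d3 r + m3 0\<close> this fixes the limit.\<close>
  have m3_eq: "m3 0 t = (\<Sum>j<N1. a j * x0 j) / (\<Sum>j<N1. a j)" if "t \<ge> 0" for t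
  proof -
    have "(\<Sum>r<N3. a3 r * m2 r t) = (\<Sum>p<N2. a2 p * m1 p t)"
      using sum_over_groups[OF part2, of "\<lambda>p. a2 p * m1 p t"] by (simp add: m2w)
    also have "\<dots> = (\<Sum>j<N1. a j * x j t)"
      using sum_over_groups[OF part1, of "\<lambda>j. a j * x j t"] by (simp add: m1w)
    also have "\<dots> = (\<Sum>j<N1. a j * x0 j)"
    proof -
      have "((\<lambda>s. \<Sum>j<N1. a j * rhs x j s) has_integral (\<Sum>j<N1. a j * (x j t - x0 j))) {0..t}"
        by (intro has_integral_sum has_integral_mult_right int that) auto
      then have "((\<lambda>s. 0 :: real) has_integral (\<Sum>j<N1. a j * (x j t - x0 j))) {0..t}"
        unfolding rhs_weighted_sum .
      then have "(\<Sum>j<N1. a j * (x j t - x0 j)) = 0" using has_integral_unique has_integral_0 by blast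
      then show ?thesis by (simp add: right_diff_distrib sum_subtractf)
    qed
    finally have num: "(\<Sum>r<N3. a3 r * m2 r t) = (\<Sum>j<N1. a j * x0 j)" .
    have den: "(\<Sum>r<N3. a3 r) = (\<Sum>j<N1. a j)"
      using sum_weights_group[OF part1, of a "\<lambda>_. 1"] sum_weights_group[OF part2, of a2 "\<lambda>_. 1"] by simp
    show ?thesis using num den by (simp add: m3_def lessThan_def)
  qed
  define p where "p = \<gamma>1 i"
  define r where "r = \<gamma>2 p"
  have p: "p < N2" using grp_of_less(1)[OF part1 i] by (simp add: p_def)
  have r: "r < N3" using grp_of_less(1)[OF part2 p] by (simp add: r_def)
  have "((\<lambda>t. d1 i t + d2 p t + d3 r t + (\<Sum>j<N1. a j * x0 j) / (\<Sum>j<N1. a j)) \<longlongrightarrow>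
      0 + 0 + 0 + (\<Sum>j<N1. a j * x0 j) / (\<Sum>j<N1. a j)) at_top"
    by (intro tendsto_add tendsto_const d1(2)[OF i] d2(2)[OF p] d3[OF r])
  then have "((\<lambda>t. d1 i t + d2 p t + d3 r t + (\<Sum>j<N1. a j * x0 j) / (\<Sum>j<N1. a j)) \<longlongrightarrow>
      (\<Sum>j<N1. a j * x0 j) / (\<Sum>j<N1. a j)) at_top" by simp
  then show ?thesis
  proof (rule Lim_transform_eventually)
    show "\<forall>\<^sub>F t in at_top. d1 i t + d2 p t + d3 r t + (\<Sum>j<N1. a j * x0 j) / (\<Sum>j<N1. a j) = x i t"
      using eventually_ge_at_top[of 0]
      by eventually_elim (simp add: m3_eq[symmetric] d1_def d2_def d3_def p_def[symmetric] r_def[symmetric])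
  qed
qed

end

section \<open>Spectral form of the delay conditions, necessity and sufficiency\<close>

lemma eigenvalue_K_mat_iff:
  assumes A: "A \<in> carrier_mat n n" and pos: "\<And>i. i < n \<Longrightarrow> 0 < a i"
  shows "eigenvalue (K_mat n a * A) e \<longleftrightarrow>
    (\<exists>v. (\<exists>i<n. v i \<noteq> 0) \<and> (\<forall>i<n. (\<Sum>j<n. A $$ (i, j) * v j) = e * a i * v i))"
proof -
  have KA: "K_mat n a * A \<in> carrier_mat n n"
    using A by (intro mult_carrier_mat[of _ n n]) (auto simp: K_mat_def)
  have "(\<Sum>j<n. (K_mat n a * A) $$ (i, j) * v j) = e * v i \<longleftrightarrow>
      (\<Sum>j<n. A $$ (i, j) * v j) = e * a i * v i" if "i < n" for i v
  proof -
    have "(\<Sum>j<n. (K_mat n a * A) $$ (i, j) * v j) = (\<Sum>j<n. A $$ (i, j) * v j) / a i"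
      unfolding sum_divide_distrib using that by (intro sum.cong refl) (simp add: K_mat_mult_index[OF A])
    then show ?thesis using pos[OF that] by (auto simp: field_simps)
  qed
  then show ?thesis unfolding eigenvalue_sum_iff[OF KA] by auto
qed

text \<open>Lifting preserves the nonzero part of the spectrum. A violated delay bound makes the
  largest eigenvalue nonzero, so it descends to the small matrix along with an eigenvector.\<close>

lemma lambda_max_lift:
  fixes M :: "real mat"
  assumes B: "B \<in> carrier_mat n m" and C: "C \<in> carrier_mat m n" and M: "M \<in> carrier_mat m m"
    and CB: "C * B = 1\<^sub>m m" and e: "eigenvalue M e"
  shows "e \<le> lambda_max (B * M * C)"
    and "lambda_max (B * M * C) \<noteq> 0 \<Longrightarrow> eigenvalue M (lambda_max (B * M * C))"
proof -
  have L: "B * M * C \<in> carrier_mat n n" using B C M by auto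
  have ev: "eigenvalue (B * M * C) e" by (rule eigenvalue_lift(1)[OF B C M CB e])
  show "e \<le> lambda_max (B * M * C)" by (rule eigenvalue_le_lambda_max[OF L ev])
  show "eigenvalue M (lambda_max (B * M * C))" if "lambda_max (B * M * C) \<noteq> 0"
    using eigenvalue_lift(2)[OF B C M CB eigenvalue_lambda_max[OF L ev] that] .
qed

context three_layer
begin

abbreviation "lam2 \<equiv> lambda_max (B1 * K2 * LD2 * C1)"
abbreviation "lam3 \<equiv> lambda_max (B1 * B2 * K3 * LD3 * C2 * C1)"

abbreviation "eig2 e v \<equiv> (\<exists>p<N2. v p \<noteq> 0) \<and> (\<forall>p<N2. (\<Sum>q<N2. lap2 p q * v q) = e * a2 p * v p)"
abbreviation "eig3 e v \<equiv> (\<exists>p<N3. v p \<noteq> 0) \<and> (\<forall>p<N3. (\<Sum>q<N3. lap3 p q * v q) = e * a3 p * v p)"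

lemma eigenvalue2_iff: "eigenvalue (K2 * LD2) e \<longleftrightarrow> (\<exists>v. eig2 e v)"
  by (subst eigenvalue_K_mat_iff[OF carriers(5)]) (simp_all add: a2_pos block_laplacian_index[OF part2])

lemma eigenvalue3_iff: "eigenvalue (K3 * LD3) e \<longleftrightarrow> (\<exists>v. eig3 e v)"
  by (subst eigenvalue_K_mat_iff[OF carriers(6)]) (simp_all add: a3_pos laplacian_def)

lemma zero_eigenvalue2: "eigenvalue (K2 * LD2) 0"
  unfolding eigenvalue2_iff using component_laplacian_kernel[OF graph2', of _ "\<lambda>_. 1"] N_pos
  by (intro exI[of _ "\<lambda>_. 1"]) auto

lemma zero_eigenvalue3: "eigenvalue (K3 * LD3) 0"
  unfolding eigenvalue3_iff using component_laplacian_kernel[OF graph3', of _ "\<lambda>_. 1"] N_pos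
  by (intro exI[of _ "\<lambda>_. 1"]) auto

lemma L2_factor: "B1 * K2 * LD2 * C1 = B1 * (K2 * LD2) * C1"
  using carriers by (simp add: assoc_mult_mat[of B1 N1 N2 K2 N2 LD2 N2])

lemma L3_factor: "B1 * B2 * K3 * LD3 * C2 * C1 = (B1 * B2) * (K3 * LD3) * (C2 * C1)"
proof -
  have B: "B1 * B2 \<in> carrier_mat N1 N3" and M: "K3 * LD3 \<in> carrier_mat N3 N3" using carriers by auto
  have "B1 * B2 * K3 * LD3 = (B1 * B2) * (K3 * LD3)"
    by (rule assoc_mult_mat[OF B carriers(3,6)])
  moreover have "(B1 * B2) * (K3 * LD3) * C2 * C1 = (B1 * B2) * (K3 * LD3) * (C2 * C1)"
    by (rule assoc_mult_mat[OF mult_carrier_mat[OF B M] carriers(10,8)])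
  ultimately show ?thesis by simp
qed

lemma CB2: "(C2 * C1) * (B1 * B2) = 1\<^sub>m N3"
proof -
  have "(C2 * C1) * (B1 * B2) = C2 * (C1 * (B1 * B2))"
    by (rule assoc_mult_mat[OF carriers(10,8) mult_carrier_mat[OF carriers(7,9)]])
  also have "C1 * (B1 * B2) = (C1 * B1) * B2"
    by (rule assoc_mult_mat[OF carriers(8,7,9), symmetric])
  also have "\<dots> = B2" using C_mat_B_mat[OF part1 stoch1] carriers by simp
  finally show ?thesis using C_mat_B_mat[OF part2 stoch2] by simp
qed

lemmas lam2_lift = lambda_max_lift[OF carriers(7,8) mult_carrier_mat[OF carriers(2,5)]
    C_mat_B_mat[OF part1 stoch1], folded L2_factor]

lemmas lam3_lift = lambda_max_lift[OF mult_carrier_mat[OF carriers(7,9)] mult_carrier_mat[OF carriers(10,8)]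
    mult_carrier_mat[OF carriers(3,6)] CB2, folded L3_factor]

text \<open>The initial state copies an unstable eigenvector of layer 2 to the nodes of layer 1.
  Feedback through layer 3 is present as well, but it acts equally on all members of a group of
  layer 2 and is therefore invisible to the projection in \<open>unstable_mode\<close>.\<close>

lemma delay2_necessary:
  assumes conv: "\<And>x0 x1 x2 x3 y1 y2 i. \<lbrakk>x0 \<in> carrier_vec N1; sol x0 x1 x2 x3 y1 y2; i < N1\<rbrakk> \<Longrightarrow>
      ((\<lambda>t. vec_index (x1 t) i) \<longlongrightarrow> (\<Sum>j<N1. a j * vec_index x0 j) / (\<Sum>j<N1. a j)) at_top"
  shows "4 * lam2 * \<tau>2 < pi"
proof (rule ccontr)
  assume "\<not> 4 * lam2 * \<tau>2 < pi"
  then have lh: "lam2 * h2 \<ge> pi / 2" by simp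
  then have ne: "lam2 * h2 \<noteq> 0" using pi_half_gt_zero by linarith
  then have "lam2 \<noteq> 0" and tau: "h2 > 0" "h3 > 0" using delays by auto
  then obtain v where v: "eig2 lam2 v"
    using lam2_lift(2)[OF zero_eigenvalue2] unfolding eigenvalue2_iff by blast
  define A where "A p q = - lap2 p q / a2 p" for p q
  \<comment> \<open>The feedback through layer 3 as a matrix over nodes of layer 2;
    \<open>q - grp_off k2 (\<gamma>2 q)\<close> is the local index under which \<open>c2\<close>
    stores the weight of node \<open>q\<close>. Row \<open>p\<close> depends only on the group of
    \<open>p\<close>, so it sums to \<open>H (\<gamma>2 p)\<close>.\<close>
  define B where "B p q = - lap3 (\<gamma>2 p) (\<gamma>2 q) * c2 (\<gamma>2 q) (q - grp_off k2 (\<gamma>2 q)) / a3 (\<gamma>2 p)" for p q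
  obtain w where w: "\<And>i t. t < 0 \<Longrightarrow> w i t = 0" "\<And>i. w i 0 = v i" "\<And>i. continuous_on {0..} (w i)"
    "\<And>i t. t \<ge> 0 \<Longrightarrow>
      ((\<lambda>s. \<Sum>j<N2. A i j * w j (s - h2) + B i j * w j (s - h3)) has_integral (w i t - v i)) {0..t}"
    using DDE_system_exists[OF tau] by blast
  define H where "H r s = - (\<Sum>u<N3. lap3 r u * avg2 (\<lambda>q. w q (s - h3)) u) / a3 r" for r s
  have wsum: "(\<Sum>j<N2. A p j * w j (s - h2) + B p j * w j (s - h3)) =
      - (\<Sum>q<N2. lap2 p q * w q (s - h2)) / a2 p + H (\<gamma>2 p) s" for p s
  proof -
    have "(\<Sum>u<N3. lap3 (\<gamma>2 p) u * avg2 (\<lambda>q. w q (s - h3)) u) =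
        (\<Sum>u<N3. \<Sum>q | q < N2 \<and> \<gamma>2 q = u. lap3 (\<gamma>2 p) (\<gamma>2 q) * c2 (\<gamma>2 q) (q - grp_off k2 (\<gamma>2 q)) * w q (s - h3))"
    proof (intro sum.cong refl)
      fix u assume "u \<in> {..<N3}"
      then have u: "u < N3" by simp
      show "lap3 (\<gamma>2 p) u * avg2 (\<lambda>q. w q (s - h3)) u =
        (\<Sum>q | q < N2 \<and> \<gamma>2 q = u. lap3 (\<gamma>2 p) (\<gamma>2 q) * c2 (\<gamma>2 q) (q - grp_off k2 (\<gamma>2 q)) * w q (s - h3))"
        unfolding sum_grp[OF part2 u] avg2_def sum_distrib_left
        by (intro sum.cong refl) (simp add: grp_member(2)[OF part2 u])
    qed
    also have "\<dots> = (\<Sum>q<N2. lap3 (\<gamma>2 p) (\<gamma>2 q) * c2 (\<gamma>2 q) (q - grp_off k2 (\<gamma>2 q)) * w q (s - h3))"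
      by (rule sum_over_groups[OF part2])
    finally show ?thesis
      by (simp add: A_def B_def H_def sum.distrib sum_negf sum_divide_distrib sum_subtractf)
  qed
  define x where "x i t = w (\<gamma>1 i) t" for i t
  have rhs: "rhs x i s = (\<Sum>j<N2. A (\<gamma>1 i) j * w j (s - h2) + B (\<gamma>1 i) j * w j (s - h3))" if "i < N1" for i s
  proof -
    have "(\<Sum>j<N1. lap1 i j * x j s) = 0"
      unfolding x_def by (rule component_laplacian_kernel[OF graph1' that])
    moreover have "flow2 (\<lambda>j. x j (s - h2)) (\<gamma>1 i) = (\<Sum>q<N2. lap2 (\<gamma>1 i) q * w q (s - h2)) / a2 (\<gamma>1 i)"
      unfolding flow2_def x_def using avg1_lift[of _ "\<lambda>q. w q (s - h2)"] by simp
    moreover have "flow3 (\<lambda>j. x j (s - h3)) (\<gamma>2 (\<gamma>1 i)) = - H (\<gamma>2 (\<gamma>1 i)) s"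
    proof -
      have "avg2 (avg1 (\<lambda>j. x j (s - h3))) u = avg2 (\<lambda>q. w q (s - h3)) u" if "u < N3" for u
        unfolding x_def using that avg1_lift[of _ "\<lambda>q. w q (s - h3)"] by (intro avg2_cong) auto
      then show ?thesis unfolding flow3_def H_def by simp
    qed
    ultimately show ?thesis unfolding rhs_def wsum by simp
  qed
  obtain x2 x3 y1 y2 where s: "sol (vec N1 (\<lambda>i. x i 0)) (\<lambda>t. vec N1 (\<lambda>i. x i t)) x2 x3 y1 y2"
  proof -
    have "(rhs x i has_integral (x i t - x i 0)) {0..t}" if "i < N1" "t \<ge> 0" for i t
      using w(4)[OF that(2), of "\<gamma>1 i"] unfolding rhs[OF that(1), symmetric]
      by (simp add: x_def w(2))
    then show ?thesis using solution_exists[of x] w(1) that by (auto simp: x_def)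
  qed
  have lim: "(w p \<longlongrightarrow> (\<Sum>j<N1. a j * x j 0) / (\<Sum>j<N1. a j)) at_top" if p: "p < N2" for p
  proof -
    have "\<exists>i<N1. \<gamma>1 i = p" by (rule grp_nonempty[OF part1 p])
    then obtain i where i: "i < N1" "\<gamma>1 i = p" by blast
    from conv[OF _ s i(1)] i show ?thesis by (simp add: x_def)
  qed
  show False
  proof (rule unstable_mode[OF graph2' a2_pos tau(1) lh, where v = v and w = w and H = H])
    show "((\<lambda>s. - (\<Sum>j<N2. lap2 i j * w j (s - h2)) / a2 i + H (\<gamma>2 i) s) has_integral (w i t - v i)) {0..t}"
      if "i < N2" "t \<ge> 0" for i t
      using w(4)[OF that(2), of i] unfolding wsum .
  qed (use v w lim in auto)
qed

text \<open>An eigenvector of layer 3 copied down to layer 1 is constant on the groups of both lower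
  layers, so their Laplacians vanish along the constructed solution and only the delay
  \<open>h3\<close> remains.\<close>

lemma delay3_necessary:
  assumes conv: "\<And>x0 x1 x2 x3 y1 y2 i. \<lbrakk>x0 \<in> carrier_vec N1; sol x0 x1 x2 x3 y1 y2; i < N1\<rbrakk> \<Longrightarrow>
      ((\<lambda>t. vec_index (x1 t) i) \<longlongrightarrow> (\<Sum>j<N1. a j * vec_index x0 j) / (\<Sum>j<N1. a j)) at_top"
  shows "4 * lam3 * (\<tau>2 + \<tau>3) < pi"
proof (rule ccontr)
  assume "\<not> 4 * lam3 * (\<tau>2 + \<tau>3) < pi"
  then have lh: "lam3 * h3 \<ge> pi / 2" by (simp add: algebra_simps)
  then have ne: "lam3 * h3 \<noteq> 0" using pi_half_gt_zero by linarith
  then have "lam3 \<noteq> 0" "h3 \<noteq> 0" by (metis mult_zero_left, metis mult_zero_right)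
  \<comment> \<open>Only \<open>h3\<close> is known to be positive; \<open>h2\<close> may be 0,
    which is harmless because \<open>flow2\<close> vanishes along this solution.\<close>
  then have tau: "h3 > 0" using delays by linarith
  from \<open>lam3 \<noteq> 0\<close> obtain v where v: "eig3 lam3 v"
    using lam3_lift(2)[OF zero_eigenvalue3] unfolding eigenvalue3_iff by blast
  obtain w where w: "\<And>i t. t < 0 \<Longrightarrow> w i t = 0" "\<And>i. w i 0 = v i" "\<And>i. continuous_on {0..} (w i)"
    "\<And>i t. t \<ge> 0 \<Longrightarrow>
      ((\<lambda>s. \<Sum>j<N3. - lap3 i j / a3 i * w j (s - h3) + 0 * w j (s - h3)) has_integral (w i t - v i)) {0..t}"
    using DDE_system_exists[OF tau tau, where A = "\<lambda>i j. - lap3 i j / a3 i" and B = "\<lambda>_ _. 0"] by blast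
  have wsum: "(\<Sum>j<N3. - lap3 r j / a3 r * w j (s - h3) + 0 * w j (s - h3)) =
      - (\<Sum>q<N3. lap3 r q * w q (s - h3)) / a3 r" for r s
    by (simp add: sum_negf sum_divide_distrib)
  define x where "x i t = w (\<gamma>2 (\<gamma>1 i)) t" for i t
  have rhs: "rhs x i s = - (\<Sum>q<N3. lap3 (\<gamma>2 (\<gamma>1 i)) q * w q (s - h3)) / a3 (\<gamma>2 (\<gamma>1 i))" if "i < N1" for i s
  proof -
    have "(\<Sum>j<N1. lap1 i j * x j s) = 0"
      unfolding x_def
      by (rule component_laplacian_kernel[OF graph1' that, where f = "\<lambda>p. w (\<gamma>2 p) s"])
    moreover have "flow2 (\<lambda>j. x j (s - h2)) (\<gamma>1 i) = 0"
    proof -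
      have "flow2 (\<lambda>j. x j (s - h2)) (\<gamma>1 i) = (\<Sum>q<N2. lap2 (\<gamma>1 i) q * w (\<gamma>2 q) (s - h2)) / a2 (\<gamma>1 i)"
        unfolding flow2_def x_def using avg1_lift[of _ "\<lambda>q. w (\<gamma>2 q) (s - h2)"] by simp
      then show ?thesis
        using component_laplacian_kernel[OF graph2' grp_of_less(1)[OF part1 that], where f = "\<lambda>r. w r (s - h2)"]
        by simp
    qed
    moreover have "flow3 (\<lambda>j. x j (s - h3)) (\<gamma>2 (\<gamma>1 i)) =
        (\<Sum>q<N3. lap3 (\<gamma>2 (\<gamma>1 i)) q * w q (s - h3)) / a3 (\<gamma>2 (\<gamma>1 i))"
    proof -
      have "avg2 (avg1 (\<lambda>j. x j (s - h3))) u = w u (s - h3)" if "u < N3" for u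
      proof -
        have "avg2 (avg1 (\<lambda>j. x j (s - h3))) u = avg2 (\<lambda>q. w (\<gamma>2 q) (s - h3)) u"
          unfolding x_def using that avg1_lift[of _ "\<lambda>q. w (\<gamma>2 q) (s - h3)"] by (intro avg2_cong) auto
        then show ?thesis using avg2_lift[OF that, of "\<lambda>r. w r (s - h3)"] by simp
      qed
      then show ?thesis unfolding flow3_def by simp
    qed
    ultimately show ?thesis unfolding rhs_def by simp
  qed
  obtain x2 x3 y1 y2 where s: "sol (vec N1 (\<lambda>i. x i 0)) (\<lambda>t. vec N1 (\<lambda>i. x i t)) x2 x3 y1 y2"
  proof -
    have "(rhs x i has_integral (x i t - x i 0)) {0..t}" if "i < N1" "t \<ge> 0" for i t
      using w(4)[OF that(2), of "\<gamma>2 (\<gamma>1 i)"] unfolding wsum rhs[OF that(1), symmetric]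
      by (simp add: x_def w(2))
    then show ?thesis using solution_exists[of x] w(1) that by (auto simp: x_def)
  qed
  have lim: "(w r \<longlongrightarrow> (\<Sum>j<N1. a j * x j 0) / (\<Sum>j<N1. a j)) at_top" if r: "r < N3" for r
  proof -
    have "\<exists>p<N2. \<gamma>2 p = r" by (rule grp_nonempty[OF part2 r])
    then obtain p where p: "p < N2" "\<gamma>2 p = r" by blast
    have "\<exists>i<N1. \<gamma>1 i = p" by (rule grp_nonempty[OF part1 p(1)])
    then obtain i where i: "i < N1" "\<gamma>1 i = p" by blast
    from conv[OF _ s i(1)] i p show ?thesis by (simp add: x_def)
  qed
  show False
  proof (rule unstable_mode[OF graph3' a3_pos tau lh, where v = v and w = w and H = "\<lambda>_ _. 0"])
    show "((\<lambda>s. - (\<Sum>j<N3. lap3 i j * w j (s - h3)) / a3 i + 0) has_integral (w i t - v i)) {0..t}"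
      if "i < N3" "t \<ge> 0" for i t
      using w(4)[OF that(2), of i] unfolding wsum by simp
  qed (use v w lim in auto)
qed

lemma delays_sufficient:
  assumes "4 * lam2 * \<tau>2 < pi" "4 * lam3 * (\<tau>2 + \<tau>3) < pi"
    and s: "sol x0 x1 x2 x3 y1 y2" and i: "i < N1"
  shows "((\<lambda>t. vec_index (x1 t) i) \<longlongrightarrow> (\<Sum>j<N1. a j * vec_index x0 j) / (\<Sum>j<N1. a j)) at_top"
proof (rule consensus[where ?x0.0 = "vec_index x0"])
  fix \<mu> v assume "\<exists>p<N2. v p \<noteq> 0" "\<forall>p<N2. (\<Sum>q<N2. lap2 p q * v q) = \<mu> * a2 p * v p"
  then have "eigenvalue (K2 * LD2) \<mu>" unfolding eigenvalue2_iff by blast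
  then have "\<mu> \<le> lam2" by (rule lam2_lift(1))
  then have "\<mu> * h2 \<le> lam2 * h2" using delays by (intro mult_right_mono) auto
  then show "\<mu> * h2 < pi / 2" using assms(1) by simp
next
  fix \<mu> v assume "\<exists>p<N3. v p \<noteq> 0" "\<forall>p<N3. (\<Sum>q<N3. lap3 p q * v q) = \<mu> * a3 p * v p"
  then have "eigenvalue (K3 * LD3) \<mu>" unfolding eigenvalue3_iff by blast
  then have "\<mu> \<le> lam3" by (rule lam3_lift(1))
  then have "\<mu> * h3 \<le> lam3 * h3" using delays by (intro mult_right_mono) auto
  then show "\<mu> * h3 < pi / 2" using assms(2) by (simp add: algebra_simps)
qed (use solution_integral[OF s] i in auto)

end

text \<open>The bounds are stated as products because an eigenvalue bound may be 0, as
  \<open>lambda_max\<close> of the layer 3 matrix is for \<open>N3 = 1\<close>; the quotient would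
  then fail to express an unrestricted delay. Each component of the consensus vector is the weighted
  mean of the initial state.\<close>

theorem theorem6:
  fixes N1 N2 N3 :: nat
    and k1 k2 :: "nat \<Rightarrow> nat"
    and G1 G2 :: "nat \<Rightarrow> nat \<Rightarrow> nat \<Rightarrow> bool"
    and G3 :: "nat \<Rightarrow> nat \<Rightarrow> bool"
    and c1 c2 :: "nat \<Rightarrow> nat \<Rightarrow> real"
    and a :: "nat \<Rightarrow> real"
    and \<tau>2 \<tau>3 :: real
  assumes N_pos: "0 < N1" "0 < N2" "0 < N3"
    and part1: "partition_sizes N1 N2 k1"
    and part2: "partition_sizes N2 N3 k2"
    and graphs1: "\<forall>p<N2. undirected_connected (k1 p) (G1 p)"
    and graphs2: "\<forall>p<N3. undirected_connected (k2 p) (G2 p)"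
    and graph3: "undirected_connected N3 G3"
    and stoch1: "stochastic_rows N2 k1 c1"
    and stoch2: "stochastic_rows N3 k2 c2"
    and a_pos: "\<forall>i<N1. 0 < a i"
    and delays: "0 \<le> \<tau>2" "0 \<le> \<tau>3"
  defines "K1 \<equiv> K_mat N1 a"
    and "K2 \<equiv> K_mat N2 (agg_weights k1 a)"
    and "K3 \<equiv> K_mat N3 (agg_weights k2 (agg_weights k1 a))"
    and "LD1 \<equiv> block_laplacian N1 N2 k1 G1"
    and "LD2 \<equiv> block_laplacian N2 N3 k2 G2"
    and "LD3 \<equiv> laplacian N3 G3"
    and "B1 \<equiv> B_mat N1 N2 k1" and "C1 \<equiv> C_mat N1 N2 k1 c1"
    and "B2 \<equiv> B_mat N2 N3 k2" and "C2 \<equiv> C_mat N2 N3 k2 c2"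
  shows "(\<forall>x0 \<in> carrier_vec N1. \<forall>x1 x2 x3 y1 y2.
            delayed_solution N1 N2 N3 K1 LD1 K2 LD2 K3 LD3 B1 C1 B2 C2 \<tau>2 \<tau>3
              x0 x1 x2 x3 y1 y2 \<longrightarrow>
            (\<forall>i<N1. ((\<lambda>t. x1 t $ i) \<longlongrightarrow>
                       (\<Sum>j<N1. a j * x0 $ j) / (\<Sum>j<N1. a j)) at_top))
         \<longleftrightarrow>
         (4 * lambda_max (B1 * K2 * LD2 * C1) * \<tau>2 < pi \<and>
          4 * lambda_max (B1 * B2 * K3 * LD3 * C2 * C1) * (\<tau>2 + \<tau>3) < pi)"
proof -
  interpret three_layer N1 N2 N3 k1 k2 G1 G2 G3 c1 c2 a \<tau>2 \<tau>3
    using N_pos part1 part2 graphs1 graphs2 graph3 stoch1 stoch2 a_pos delays by unfold_locales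
  show ?thesis
    unfolding K1_def K2_def K3_def LD1_def LD2_def LD3_def B1_def C1_def B2_def C2_def
    using delay2_necessary delay3_necessary delays_sufficient by blast
qed

end
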